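(* Let $\Gamma$ be the $3$-regular tree and $\Gamma_0$ its edge graph, with graph distance $d$, and let $\Sigma=[3-2\sqrt2,3+2\sqrt2]$. With $\tilde P_6$, $\psi_z$, $m$ and the relation between $t$ and $\lambda$ as in the context, for any $F\in\ell^2(\Gamma_0)$ we have the explicit spectral resolution (of $-\Delta_{\Gamma_0}$) $$F=\tilde P_6F+\int_\Sigma\tilde P_\lambda F\,dm(\lambda)$$ for $$\tilde P_\lambda F(x)=\frac1{3(6-\lambda)}\sum_{y}\psi_{\frac12+it}(d(x,y))F(y).$$
   Context: The edge graph $\Gamma_0$ has the edges of $\Gamma$ as vertices, two being adjacent if and only if they share an endpoint (it is $4$-regular). $\Delta_{\Gamma_0}F(x)=\sum_{y\sim x}(F(y)-F(x))$. In the spectral resolution, $\tilde P_\lambda F$ is a $\lambda$-eigenfunction of $-\Delta_{\Gamma_0}$. $\tilde P_6$ is the orthogonal projection of $\ell^2(\Gamma_0)$ onto the space of $\ell^2$ eigenfunctions of $-\Delta_{\Gamma_0}$ with eigenvalue $6$, given by $\tilde P_6F(x)=\sum_y\frac13\left(-\frac12\right)^{d(x,y)}F(y)$. For $z\in\mathbb C$ with $2^{2z-1}\ne1$: $c(z)=\frac13\,\frac{2^{1-z}-2^{z-1}}{2^{-z}-2^{z-1}}$, $\varphi_z(n)=c(z)2^{-nz}+c(1-z)2^{-n(1-z)}$, and $\psi_z(n)=\tilde c(z)2^{-nz}+\tilde c(1-z)2^{-n(1-z)}$ with $\tilde c(z)=(2+2^{-z}+2^z)c(z)$, so that $\psi_z(n)=2\varphi_z(n)+\varphi_z(n+1)+\varphi_z(n-1)$.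 The parameters $t\in[0,\frac{\pi}{\log2}]$ and $\lambda\in\Sigma$ are related by $\lambda=3-2\sqrt2\cos(t\log2)$, i.e. $t=\frac1{\log2}\cos^{-1}\left(\frac{3-\lambda}{2\sqrt2}\right)$. The measure $m$ on $\Sigma$ is $$dm(\lambda)=\frac{3\sqrt{-\lambda^2+6\lambda-1}}{\sqrt2\,\pi(-\lambda^2+6\lambda+3)}\,d\lambda .$$
   Formalization: The printed density of m is false (F=δ_x needs m(Σ)=3, printed mass ≈0.897); it is corrected to dm=9√(−λ²+6λ−1)/(2π(−λ²+6λ))dλ. The sum defining P̃_λF(x) is read as convergent in L²(Σ,m) in λ, and the resolution holds at each x. *)

theory Defs
  imports "HOL-Analysis.Analysis"
begin

subsection \<open>Trees and edge graphs\<close>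

definition simple_graph :: "'v set \<Rightarrow> 'v set set \<Rightarrow> bool" where
  "simple_graph V E \<longleftrightarrow> (\<forall>e\<in>E. e \<subseteq> V \<and> card e = 2)"

definition connected_graph :: "'v set \<Rightarrow> 'v set set \<Rightarrow> bool" where
  "connected_graph V E \<longleftrightarrow> V \<noteq> {} \<and> (\<forall>u\<in>V. \<forall>v\<in>V. (u, v) \<in> {(a, b). {a, b} \<in> E}\<^sup>*)"

definition graph_cycle :: "'v set set \<Rightarrow> 'v list \<Rightarrow> bool" where
  "graph_cycle E vs \<longleftrightarrow> distinct vs \<and> 3 \<le> length vs \<and>
     (\<forall>i<length vs. {vs ! i, vs ! (Suc i mod length vs)} \<in> E)"

definition tree_graph :: "'v set \<Rightarrow> 'v set set \<Rightarrow> bool" where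
  "tree_graph V E \<longleftrightarrow> simple_graph V E \<and> connected_graph V E \<and> \<not> (\<exists>vs. graph_cycle E vs)"

definition regular_graph :: "nat \<Rightarrow> 'v set \<Rightarrow> 'v set set \<Rightarrow> bool" where
  "regular_graph k V E \<longleftrightarrow> (\<forall>v\<in>V. finite {e\<in>E. v \<in> e} \<and> card {e\<in>E. v \<in> e} = k)"

text \<open>The edge graph of a graph with edge set \<open>E\<close> has vertex set \<open>E\<close>; it is represented by its
  (symmetric, irreflexive) adjacency relation.\<close>

definition edge_graph :: "'v set set \<Rightarrow> ('v set \<times> 'v set) set" where
  "edge_graph E = {(x, y). x \<in> E \<and> y \<in> E \<and> x \<noteq> y \<and> x \<inter> y \<noteq> {}}"

definition graph_dist :: "('a \<times> 'a) set \<Rightarrow> 'a \<Rightarrow> 'a \<Rightarrow> nat" where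
  "graph_dist R x y = (LEAST n. (x, y) \<in> R ^^ n)"

definition laplacian :: "('a \<times> 'a) set \<Rightarrow> ('a \<Rightarrow> complex) \<Rightarrow> 'a \<Rightarrow> complex" where
  "laplacian R F x = (\<Sum>y\<in>{y. (x, y) \<in> R}. F y - F x)"

subsection \<open>Square-summable functions and the eigenvalue 6\<close>

text \<open>Functions on a set \<open>A\<close> are functions on the whole type, of which only the values on \<open>A\<close>
  matter.\<close>

definition ell2 :: "'a set \<Rightarrow> ('a \<Rightarrow> complex) set" where
  "ell2 A = {F. (\<lambda>x. (cmod (F x))\<^sup>2) summable_on A}"

definition ell2_inner :: "'a set \<Rightarrow> ('a \<Rightarrow> complex) \<Rightarrow> ('a \<Rightarrow> complex) \<Rightarrow> complex" where
  "ell2_inner A F G = (\<Sum>\<^sub>\<infinity>x\<in>A. F x * cnj (G x))"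

definition eigenfunction :: "'v set set \<Rightarrow> real \<Rightarrow> ('v set \<Rightarrow> complex) \<Rightarrow> bool" where
  "eigenfunction E l F \<longleftrightarrow> (\<forall>x\<in>E. - laplacian (edge_graph E) F x = of_real l * F x)"

definition is_orthogonal_projection ::
  "'a set \<Rightarrow> ('a \<Rightarrow> complex) set \<Rightarrow> ('a \<Rightarrow> complex) \<Rightarrow> ('a \<Rightarrow> complex) \<Rightarrow> bool" where
  "is_orthogonal_projection A S F G \<longleftrightarrow>
     G \<in> S \<and> (\<forall>H\<in>S. ell2_inner A (\<lambda>x. F x - G x) H = 0)"

definition P6 :: "'v set set \<Rightarrow> ('v set \<Rightarrow> complex) \<Rightarrow> 'v set \<Rightarrow> complex" where
  "P6 E F x = (\<Sum>\<^sub>\<infinity>y\<in>E. (1/3) * (- (1/2)) ^ graph_dist (edge_graph E) x y * F y)"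

subsection \<open>Spherical functions and the spectral measure\<close>

definition c_fun :: "complex \<Rightarrow> complex" where
  "c_fun z = (1/3) * ((2 powr (1 - z) - 2 powr (z - 1)) / (2 powr (- z) - 2 powr (z - 1)))"

definition c_tilde :: "complex \<Rightarrow> complex" where
  "c_tilde z = (2 + 2 powr (- z) + 2 powr z) * c_fun z"

definition \<phi>_fun :: "complex \<Rightarrow> int \<Rightarrow> complex" where
  "\<phi>_fun z n = c_fun z * 2 powr (- (of_int n * z))
             + c_fun (1 - z) * 2 powr (- (of_int n * (1 - z)))"

definition \<psi>_fun :: "complex \<Rightarrow> nat \<Rightarrow> complex" where
  "\<psi>_fun z n = c_tilde z * 2 powr (- (of_nat n * z))
             + c_tilde (1 - z) * 2 powr (- (of_nat n * (1 - z)))"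

lemma \<psi>_fun_eq_\<phi>_fun:
  "\<psi>_fun z n = 2 * \<phi>_fun z (int n) + \<phi>_fun z (int n + 1) + \<phi>_fun z (int n - 1)"
  unfolding \<psi>_fun_def \<phi>_fun_def c_tilde_def
  by (simp add: algebra_simps powr_add powr_diff powr_minus divide_simps)

definition \<Sigma>_set :: "real set" where
  "\<Sigma>_set = {3 - 2 * sqrt 2 .. 3 + 2 * sqrt 2}"

definition t_of :: "real \<Rightarrow> real" where
  "t_of l = arccos ((3 - l) / (2 * sqrt 2)) / ln 2"

text \<open>At the two end points of \<open>\<Sigma>_set\<close> the functions \<open>c\<close> and \<open>\<psi>\<close> are undefined
  (\<open>2\<^bsup>2z-1\<^esup> = 1\<close>; here the value is a junk value), but these points are null for \<open>spec_measure\<close>.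

  The source prints the density as
  \<open>3 sqrt (-l\<^sup>2 + 6l - 1) / (sqrt 2 \<pi> (-l\<^sup>2 + 6l + 3))\<close>. With that density the resolution is false:
  for the delta function \<open>F = \<delta>\<^sub>x\<close> at the point \<open>x\<close> the projection to the eigenvalue 6 is \<open>1/3\<close> and
  the kernel \<open>\<psi>(0) / (3 (6 - l))\<close> is the constant \<open>2/9\<close>, so the total mass has to be 3, whereas it
  is \<open>(3 / sqrt 2) (1 - 1 / sqrt 3) < 1\<close>. The density below is three times the Plancherel
  (Kesten--McKay) density of the 3-regular tree,
  \<open>d\<mu>(t) = (ln 2 / (3 \<pi>)) |c(1/2 + it)|\<^sup>-\<^sup>2 dt\<close>, written in the variable \<open>l\<close>. Vanishing outside
  \<open>\<Sigma>_set\<close>, it is the only measure on \<open>\<Sigma>_set\<close> for which the resolution with the kernel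
  \<open>\<psi>(d(x,y)) / (3 (6 - l))\<close> holds.\<close>

definition spec_measure :: "real measure" where
  "spec_measure = density lborel (\<lambda>l. ennreal (indicator \<Sigma>_set l *
      (9 * sqrt (- l\<^sup>2 + 6 * l - 1) / (2 * pi * (- l\<^sup>2 + 6 * l)))))"

subsection \<open>The generalized projections onto the continuous spectrum\<close>

definition square_integrable :: "'b measure \<Rightarrow> ('b \<Rightarrow> complex) \<Rightarrow> bool" where
  "square_integrable M g \<longleftrightarrow> g \<in> borel_measurable M \<and> integrable M (\<lambda>l. (cmod (g l))\<^sup>2)"

text \<open>Unconditional convergence of \<open>\<Sum>y\<in>A. f y\<close> to \<open>S\<close> in \<open>L\<^sup>2(M)\<close>, in analogy to \<open>has_sum\<close>.\<close>

definition L2_has_sum :: "'b measure \<Rightarrow> ('a \<Rightarrow> 'b \<Rightarrow> complex) \<Rightarrow> ('b \<Rightarrow> complex) \<Rightarrow> 'a set \<Rightarrow> bool" where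
  "L2_has_sum M f S A \<longleftrightarrow>
     (\<forall>y\<in>A. square_integrable M (f y)) \<and> square_integrable M S \<and>
     ((\<lambda>B. LINT l|M. (cmod ((\<Sum>y\<in>B. f y l) - S l))\<^sup>2) \<longlongrightarrow> 0) (finite_subsets_at_top A)"

text \<open>\<open>P l x\<close> stands for the value at \<open>x\<close> of the generalized projection of \<open>F\<close>. As
  \<open>\<psi>\<^bsub>1/2+it\<^esub>(d(x,y))\<close> is not square summable in \<open>y\<close>, the sum
  \<open>\<Sum>y. \<psi>\<^bsub>1/2+it\<^esub>(d(x,y)) F(y)\<close> need not converge for a fixed \<open>l\<close> when \<open>F\<close> is merely in \<open>\<ell>\<^sup>2\<close>. For each
  \<open>x\<close> it is a series of functions of \<open>l\<close>, convergent in \<open>L\<^sup>2\<close>; its sum is determined for almost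
  every \<open>l\<close>.\<close>

definition is_spectral_projection ::
  "'v set set \<Rightarrow> ('v set \<Rightarrow> complex) \<Rightarrow> (real \<Rightarrow> 'v set \<Rightarrow> complex) \<Rightarrow> bool" where
  "is_spectral_projection E F P \<longleftrightarrow>
     (\<forall>x\<in>E. L2_has_sum spec_measure
        (\<lambda>y l. 1 / (3 * (6 - of_real l)) *
               (\<psi>_fun (Complex (1/2) (t_of l)) (graph_dist (edge_graph E) x y) * F y))
        (\<lambda>l. P l x) E)"

end

theory Submission
  imports Defs
begin

text \<open>
Fix an edge \<open>x\<close> of the 3-regular tree. A vertex \<open>y\<close> of the edge graph at distance \<open>n \<ge> 1\<close> from \<open>x\<close>
has one neighbour at distance \<open>n - 1\<close>, one at distance \<open>n\<close> and two at distance \<open>n + 1\<close>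
(\<open>nbrs_dist\<close>). So an \<open>l\<close>-eigenfunction of \<open>-\<Delta>\<close> that depends only on the distance to \<open>x\<close> solves a
three-term recursion; normalised at \<open>n = 0\<close>, its solution is a polynomial in \<open>l\<close>, called
\<open>spherical l n\<close> below. The same count, read from the sphere of radius \<open>n\<close> inwards and outwards, shows
that the mean of any \<open>l\<close>-eigenfunction \<open>H\<close> over this sphere is \<open>spherical l n * H x\<close>
(\<open>sphere_sum_eigenfunction\<close>).

The continuous part of the theorem rests on one fact about these polynomials
(\<open>spectral_mean_orthogonal\<close>): they are orthogonal for the probability measure on the spectrum that has an atom of mass \<open>1/3\<close> at
\<open>6\<close> and is \<open>2/9\<close> of the given measure on \<open>\<Sigma>\<close>, and the squared norm of \<open>spherical _ n\<close> is the
reciprocal of the number of points of a sphere of radius \<open>n\<close>. On the interior of \<open>\<Sigma>\<close> the kernel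
\<open>\<psi>(n) / (3 (6 - l))\<close> is \<open>2/9 * spherical l n\<close>, because both sides satisfy the recursion
(\<open>kernel_eq_spherical\<close>), and \<open>spherical 6 n = (-1/2) ^ n\<close> is three times the kernel of \<open>P6\<close>.

Orthogonality to the constant polynomial says that the kernel of \<open>P6\<close> plus the integral of the
kernel of the generalized projections is the kernel of the identity (\<open>integral_kernel\<close>). It comes
down to the Fourier coefficients of the Poisson kernel \<open>1 / (5 - 4 cos 2t)\<close>. Full orthogonality
follows from this case by a symmetry of the recursion, and it gives a Bessel inequality
(\<open>bessel_kernel\<close>): in \<open>L\<^sup>2\<close> of the spectral measure, the squared norm of a partial sum of the
series that defines the generalized projection is at most the corresponding partial sum of
\<open>|F|\<^sup>2\<close>. Hence the series converges in \<open>L\<^sup>2\<close>. Its limit is integrable since the measure is finite,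
integration commutes with the sum, and the eigenvalue equation passes to the limit.

For the eigenvalue \<open>6\<close>, the weights \<open>4 ^ (-n)\<close> beat the size \<open>2 ^ (n + 1)\<close> of the spheres, so the kernel
of \<open>P6\<close> has square-summable rows, and averaging over spheres shows that it reproduces every
\<open>\<ell>\<^sup>2\<close> eigenfunction (\<open>K6_reproducing\<close>). A symmetric reproducing kernel whose columns lie in the
eigenspace is the orthogonal projection onto it. Its rows are not absolutely summable, so the bound on
\<open>\<ell>\<^sup>2\<close> is taken from the reproducing property: on finitely supported functions the operator is a
contraction (\<open>K6_on_bound\<close>), and the bound persists in the limit (\<open>P6_bound\<close>).
\<close>

section \<open>Distances in the edge graph of a cubic tree\<close>

definition adj :: "'v set set \<Rightarrow> ('v \<times> 'v) set" where
  "adj E = {(a, b). {a, b} \<in> E}"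

lemma sym_adj: "sym (adj E)"
  by (auto simp: sym_def adj_def insert_commute)

text \<open>A walk from \<open>u\<close> to \<open>v\<close> of minimal length that avoids the edge \<open>{u, v}\<close> visits no vertex twice,
  so together with that edge it is a cycle. This is the only way in which acyclicity enters.\<close>

lemma acyclic_imp_bridge:
  assumes nocyc: "\<not> (\<exists>vs. graph_cycle E vs)" and e: "{u, v} \<in> E" and "u \<noteq> v"
  shows "(u, v) \<notin> (adj (E - {{u, v}}))\<^sup>*"
proof
  let ?R = "adj (E - {{u, v}})"
  assume "(u, v) \<in> ?R\<^sup>*"
  then obtain n0 where "(u, v) \<in> ?R ^^ n0" using rtrancl_imp_relpow by blast
  define n where "n = (LEAST n. (u, v) \<in> ?R ^^ n)"
  have n: "(u, v) \<in> ?R ^^ n"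
    unfolding n_def by (rule LeastI) fact
  have least: "n \<le> m" if "(u, v) \<in> ?R ^^ m" for m
    unfolding n_def by (rule Least_le) fact
  obtain f where f: "f 0 = u" "f n = v" "\<And>i. i < n \<Longrightarrow> (f i, f (Suc i)) \<in> ?R"
    using n by (auto simp: relpow_fun_conv)
  have pow: "(f i, f j) \<in> ?R ^^ (j - i)" if "i \<le> j" "j \<le> n" for i j
    unfolding relpow_fun_conv by (rule exI[of _ "\<lambda>k. f (i + k)"]) (use that f(3) in auto)
  have "inj_on f {0..n}"
  proof (rule linorder_inj_onI)
    fix i j assume ij: "i < j" "i \<in> {0..n}" "j \<in> {0..n}"
    show "f i \<noteq> f j"
    proof
      assume "f i = f j"
      hence "(u, f j) \<in> ?R ^^ i" "(f j, v) \<in> ?R ^^ (n - j)"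
        using pow[of 0 i] pow[of j n] ij f by auto
      hence "(u, v) \<in> ?R ^^ (i + (n - j))" by (auto simp: relpow_add)
      from least[OF this] ij show False by auto
    qed
  qed (auto)
  moreover have "n \<noteq> 0" using f(1,2) \<open>u \<noteq> v\<close> by (metis)
  moreover have "n \<noteq> 1" using f(3)[of 0] f(1,2) by (auto simp: adj_def)
  moreover have "{map f [0..<Suc n] ! i, map f [0..<Suc n] ! (Suc i mod length (map f [0..<Suc n]))} \<in> E"
    if "i < Suc n" for i
  proof (cases "i = n")
    case True
    then show ?thesis using e f(1,2) by (simp add: insert_commute nth_append del: upt_Suc)
  next
    case False
    then show ?thesis using f(3)[of i] that by (auto simp: adj_def simp del: upt_Suc)
  qed
  ultimately have "graph_cycle E (map f [0..<Suc n])"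
    unfolding graph_cycle_def
    by (auto simp: distinct_map atLeastLessThanSuc_atLeastAtMost simp del: upt_Suc)
  with nocyc show False by blast
qed

locale cubic_tree =
  fixes V :: "'v set" and E :: "'v set set"
  assumes tree: "tree_graph V E" and cubic: "regular_graph 3 V E"
begin

abbreviation d :: "'v set \<Rightarrow> 'v set \<Rightarrow> nat" where
  "d \<equiv> graph_dist (edge_graph E)"

definition nbrs :: "'v set \<Rightarrow> 'v set set" where
  "nbrs x = {y. (x, y) \<in> edge_graph E}"

lemma edge_two_vertices:
  assumes "y \<in> E" "u \<in> y" obtains v where "y = {u, v}" "v \<noteq> u" "u \<in> V" "v \<in> V"
proof -
  have "y \<subseteq> V" "card y = 2"
    using assms tree unfolding tree_graph_def simple_graph_def by auto
  then obtain a b where "y = {a, b}" "a \<noteq> b" by (auto simp: card_2_iff)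
  with that[of a] that[of b] assms \<open>y \<subseteq> V\<close> show thesis by auto
qed

lemma edge_nonempty: "y \<in> E \<Longrightarrow> \<exists>u. u \<in> y"
  using tree unfolding tree_graph_def simple_graph_def by fastforce

lemma adj_ne: "{u, v} \<in> E \<Longrightarrow> u \<noteq> v"
  using tree unfolding tree_graph_def simple_graph_def by fastforce

lemma adj_in_V: "{u, v} \<in> E \<Longrightarrow> u \<in> V \<and> v \<in> V"
  using tree unfolding tree_graph_def simple_graph_def by fastforce

lemma bridge: "{u, v} \<in> E \<Longrightarrow> (u, v) \<notin> (adj (E - {{u, v}}))\<^sup>*"
  using acyclic_imp_bridge[of E u v] adj_ne tree unfolding tree_graph_def by blast

lemma connected: "u \<in> V \<Longrightarrow> v \<in> V \<Longrightarrow> (u, v) \<in> (adj E)\<^sup>*"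
  using tree unfolding tree_graph_def connected_graph_def adj_def by blast

lemma other_edges:
  assumes "u \<in> V" "y \<in> E" "u \<in> y"
  shows "card {e \<in> E. u \<in> e \<and> e \<noteq> y} = 2" "finite {e \<in> E. u \<in> e \<and> e \<noteq> y}"
proof -
  have "{e \<in> E. u \<in> e \<and> e \<noteq> y} = {e \<in> E. u \<in> e} - {y}" by auto
  moreover have "finite {e \<in> E. u \<in> e}" "card {e \<in> E. u \<in> e} = 3"
    using cubic assms unfolding regular_graph_def by auto
  ultimately show "card {e \<in> E. u \<in> e \<and> e \<noteq> y} = 2" "finite {e \<in> E. u \<in> e \<and> e \<noteq> y}"
    using assms by auto
qed

lemma nbrs_split:
  assumes "{u, v} \<in> E"
  shows "nbrs {u, v} = {e \<in> E. u \<in> e \<and> e \<noteq> {u, v}} \<union> {e \<in> E. v \<in> e \<and> e \<noteq> {u, v}}"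
    and "{e \<in> E. u \<in> e \<and> e \<noteq> {u, v}} \<inter> {e \<in> E. v \<in> e \<and> e \<noteq> {u, v}} = {}"
proof -
  show "nbrs {u, v} = {e \<in> E. u \<in> e \<and> e \<noteq> {u, v}} \<union> {e \<in> E. v \<in> e \<and> e \<noteq> {u, v}}"
    using assms by (auto simp: nbrs_def edge_graph_def)
  have "e = {u, v}" if "e \<in> E" "u \<in> e" "v \<in> e" for e
    using edge_two_vertices[OF that(1,2)] that adj_ne[OF assms] by blast
  thus "{e \<in> E. u \<in> e \<and> e \<noteq> {u, v}} \<inter> {e \<in> E. v \<in> e \<and> e \<noteq> {u, v}} = {}" by auto
qed

lemma sym_edge_graph: "(y, z) \<in> edge_graph E \<Longrightarrow> (z, y) \<in> edge_graph E"
  by (auto simp: edge_graph_def)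

text \<open>The distance of the vertex \<open>v\<close> from the edge \<open>x\<close> in the tree itself. Distances in the edge graph
  are read off from it: they are one more than the level of the nearer end point.\<close>

definition level :: "'v set \<Rightarrow> 'v \<Rightarrow> nat" where
  "level x v = (LEAST n. \<exists>a\<in>x. (a, v) \<in> adj E ^^ n)"

context
  fixes x :: "'v set"
  assumes xE: "x \<in> E"
begin

lemma level_attained: "v \<in> V \<Longrightarrow> \<exists>a\<in>x. (a, v) \<in> adj E ^^ level x v"
proof -
  assume "v \<in> V"
  obtain a where "a \<in> x" "a \<in> V" using edge_nonempty[OF xE] edge_two_vertices[OF xE] by metis
  with connected[OF _ \<open>v \<in> V\<close>, of a] obtain n where "\<exists>a\<in>x. (a, v) \<in> adj E ^^ n"
    using rtrancl_imp_relpow by blast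
  thus ?thesis unfolding level_def by (rule LeastI)
qed

lemma level_le: "a \<in> x \<Longrightarrow> (a, v) \<in> adj E ^^ n \<Longrightarrow> level x v \<le> n"
  unfolding level_def by (rule Least_le) auto

lemma level_zero_iff: "v \<in> V \<Longrightarrow> level x v = 0 \<longleftrightarrow> v \<in> x"
  using level_attained[of v] level_le[of v v 0] by auto

lemma level_adj_le: "{v, w} \<in> E \<Longrightarrow> level x w \<le> Suc (level x v)"
proof -
  assume e: "{v, w} \<in> E"
  then obtain a where "a \<in> x" "(a, v) \<in> adj E ^^ level x v"
    using level_attained adj_in_V by blast
  moreover from this e have "(a, w) \<in> adj E ^^ Suc (level x v)" by (auto simp: adj_def)
  ultimately show ?thesis using level_le by blast
qed

lemma parent_exists:
  assumes "v \<in> V" "level x v = Suc k" obtains w where "{v, w} \<in> E" "level x w = k"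
proof -
  obtain a where a: "a \<in> x" "(a, v) \<in> adj E ^^ Suc k"
    using level_attained[OF assms(1)] assms(2) by auto
  then obtain w where w: "(a, w) \<in> adj E ^^ k" "{w, v} \<in> E" by (auto simp: adj_def)
  have "level x w = k"
    using level_le[OF a(1) w(1)] level_adj_le[OF w(2)] assms(2) by simp
  with that w show thesis by (simp add: insert_commute)
qed

lemma descending_path:
  assumes "v \<in> V" "level x v \<le> k"
  shows "\<exists>a\<in>x. (v, a) \<in> {(a, b). {a, b} \<in> E \<and> level x a \<noteq> level x b \<and> level x a \<le> k \<and> level x b \<le> k}\<^sup>*"
  using assms
proof (induction "level x v" arbitrary: v)
  case 0
  then show ?case using level_zero_iff[of v] by auto
next
  case (Suc n)
  obtain w where w: "{v, w} \<in> E" "level x w = n"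
    using parent_exists[OF Suc.prems(1)] Suc.hyps(2) by metis
  then obtain a where "a \<in> x"
    "(w, a) \<in> {(a, b). {a, b} \<in> E \<and> level x a \<noteq> level x b \<and> level x a \<le> k \<and> level x b \<le> k}\<^sup>*"
    using Suc.hyps(1)[of w] Suc.hyps(2) Suc.prems(2) adj_in_V[OF w(1)] by auto
  with w Suc.hyps(2) Suc.prems(2) show ?case
    by (intro bexI[of _ a] converse_rtrancl_into_rtrancl[of v w]) auto
qed

text \<open>Both vertices descend to an end of \<open>x\<close> through edges that join different levels up to \<open>k\<close>, and
  the two ends are joined by \<open>x\<close>. An edge \<open>e\<close> that is not of this kind is never used; if its own ends
  are joined in this way, it contradicts \<open>bridge\<close>.\<close>

lemma connected_avoiding:
  assumes v: "v \<in> V" "level x v \<le> k" and w: "w \<in> V" "level x w \<le> k"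
    and "e \<noteq> x"
    and e: "\<And>a b. e = {a, b} \<Longrightarrow> level x a = level x b \<or> level x a > k \<or> level x b > k"
  shows "(v, w) \<in> (adj (E - {e}))\<^sup>*"
proof -
  have sub: "{(a, b). {a, b} \<in> E \<and> level x a \<noteq> level x b \<and> level x a \<le> k \<and> level x b \<le> k}
      \<subseteq> adj (E - {e})"
    using e by (fastforce simp: adj_def)
  obtain a where a: "a \<in> x" "(v, a) \<in> (adj (E - {e}))\<^sup>*"
    using descending_path[OF v] rtrancl_mono[OF sub] by blast
  obtain b where b: "b \<in> x" "(w, b) \<in> (adj (E - {e}))\<^sup>*"
    using descending_path[OF w] rtrancl_mono[OF sub] by blast
  have "(a, b) \<in> (adj (E - {e}))\<^sup>*"
  proof (cases "a = b")
    case False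
    hence "x = {a, b}" using edge_two_vertices[OF xE a(1)] b(1) by blast
    thus ?thesis using xE \<open>e \<noteq> x\<close> by (auto simp: adj_def)
  qed auto
  moreover have "(b, w) \<in> (adj (E - {e}))\<^sup>*"
    using b(2) sym_rtrancl[OF sym_adj] by (meson symD)
  ultimately show ?thesis using a(2) by (meson rtrancl_trans)
qed

text \<open>If the ends of an edge other than \<open>x\<close> had equal level, their descents to \<open>x\<close> would avoid it.\<close>

lemma level_adj_ne:
  assumes e: "{u, v} \<in> E" and "{u, v} \<noteq> x" shows "level x u \<noteq> level x v"
proof
  assume eq: "level x u = level x v"
  have "(u, v) \<in> (adj (E - {{u, v}}))\<^sup>*"
    using adj_in_V[OF e] eq \<open>{u, v} \<noteq> x\<close>
    by (intro connected_avoiding[of u "level x u" v]) (auto simp: doubleton_eq_iff)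
  with bridge[OF e] show False by blast
qed

text \<open>With two parents, \<open>v\<close> could reach \<open>w1\<close> through \<open>w2\<close>, staying below the level of \<open>v\<close> after the
  first step and so avoiding the edge \<open>{v, w1}\<close>.\<close>

lemma parent_unique:
  assumes e1: "{v, w1} \<in> E" and e2: "{v, w2} \<in> E"
    and "level x v = Suc (level x w1)" "level x w2 = level x w1"
  shows "w1 = w2"
proof (rule ccontr)
  assume "w1 \<noteq> w2"
  have "v \<notin> x" using level_zero_iff[of v] adj_in_V[OF e1] assms(3) by simp
  have "(w2, w1) \<in> (adj (E - {{v, w1}}))\<^sup>*"
    using adj_in_V[OF e1] adj_in_V[OF e2] assms \<open>v \<notin> x\<close>
    by (intro connected_avoiding[of w2 "level x w1" w1]) (auto simp: doubleton_eq_iff)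
  moreover have "(v, w2) \<in> adj (E - {{v, w1}})"
    using e2 \<open>w1 \<noteq> w2\<close> by (auto simp: adj_def doubleton_eq_iff)
  ultimately have "(v, w1) \<in> (adj (E - {{v, w1}}))\<^sup>*" by (rule converse_rtrancl_into_rtrancl[rotated])
  with bridge[OF e1] show False by blast
qed

text \<open>The candidate for the distance in the edge graph, in terms of levels. The local structure
  of the edge graph is easy to see for it (\<open>edge_level_nbrs\<close>) and in turn forces it to be the distance
  (\<open>edge_level_eq_dist\<close>).\<close>

definition edge_level :: "'v set \<Rightarrow> nat" where
  "edge_level y = (if y = x then 0 else Suc (Min (level x ` y)))"

lemma edge_level_pair:
  assumes "{u, v} \<in> E" "{u, v} \<noteq> x" shows "edge_level {u, v} = Suc (min (level x u) (level x v))"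
  using assms unfolding edge_level_def by simp

lemma edge_cases:
  assumes "y \<in> E" "y \<noteq> x"
  obtains u v where "y = {u, v}" "level x v = Suc (level x u)" "u \<in> V" "v \<in> V"
proof -
  obtain a where "a \<in> y" using edge_nonempty[OF assms(1)] by blast
  then obtain b where ab: "y = {a, b}" "a \<in> V" "b \<in> V" using edge_two_vertices[OF assms(1)] by metis
  have "level x a \<noteq> level x b" "level x b \<le> Suc (level x a)" "level x a \<le> Suc (level x b)"
    using level_adj_ne[of a b] level_adj_le[of a b] level_adj_le[of b a] assms ab
    by (auto simp: insert_commute)
  then consider "level x b = Suc (level x a)" | "level x a = Suc (level x b)" by linarith
  thus thesis
    using that[of a b] that[of b a] ab by cases (auto simp: insert_commute)
qed

lemma edge_level_center: "card (nbrs x) = 4 \<and> finite (nbrs x) \<and> (\<forall>y\<in>nbrs x. edge_level y = 1)"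
proof -
  obtain u where "u \<in> x" using edge_nonempty[OF xE] by blast
  then obtain v where uv: "x = {u, v}" "u \<in> V" "v \<in> V" using edge_two_vertices[OF xE] by metis
  have c: "card (nbrs x) = 4" "finite (nbrs x)"
    using nbrs_split[of u v] other_edges[of u x] other_edges[of v x] xE uv
    by (auto simp: card_Un_disjoint)
  have "edge_level y = 1" if y: "y \<in> nbrs x" for y
  proof -
    have yE: "y \<in> E" "y \<noteq> x" using y by (auto simp: nbrs_def edge_graph_def)
    then obtain a b where ab: "y = {a, b}" "level x b = Suc (level x a)" "a \<in> V" "b \<in> V"
      by (rule edge_cases)
    obtain w where "w \<in> x" "w \<in> y" using y by (auto simp: nbrs_def edge_graph_def)
    hence "level x a = 0" using ab level_zero_iff[of a] level_zero_iff[of b] by auto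
    thus ?thesis using ab yE edge_level_pair[of a b] by auto
  qed
  with c show ?thesis by auto
qed

text \<open>Let \<open>y = {u, v}\<close> with \<open>v\<close> the farther end. Both other edges at \<open>v\<close> lead away from \<open>x\<close>. Of the
  two other edges at \<open>u\<close> one leads back to \<open>x\<close> (it is \<open>x\<close> itself if \<open>u\<close> is an end of \<open>x\<close>), and
  the remaining one is a sibling of \<open>y\<close>.\<close>

lemma edge_level_nbrs:
  assumes y: "y \<in> E" "y \<noteq> x"
  obtains p q a b where "nbrs y = {p, q, a, b}" "distinct [p, q, a, b]"
    "Suc (edge_level p) = edge_level y" "edge_level q = edge_level y"
    "edge_level a = Suc (edge_level y)" "edge_level b = Suc (edge_level y)"
proof -
  obtain u v where uv: "y = {u, v}" "level x v = Suc (level x u)" "u \<in> V" "v \<in> V"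
    using edge_cases[OF y] by blast
  have uvE: "{u, v} \<in> E" using uv y by simp
  have ly: "edge_level y = Suc (level x u)" using edge_level_pair[of u v] uv y by auto
  have "v \<notin> x" using level_zero_iff[of v] uv by auto
  have up: "edge_level e = Suc (edge_level y)" if e: "e \<in> E" "v \<in> e" "e \<noteq> y" for e
  proof -
    obtain w where w: "e = {v, w}" using edge_two_vertices[OF e(1,2)] by blast
    have "w \<noteq> u" using w e uv by (auto simp: insert_commute)
    have "e \<noteq> x" using e(2) \<open>v \<notin> x\<close> by auto
    have "level x w \<noteq> level x u"
      using parent_unique[of v u w] uv w e \<open>w \<noteq> u\<close> uvE by (auto simp: insert_commute)
    moreover have "level x v \<noteq> level x w" "level x w \<le> Suc (level x v)" "level x v \<le> Suc (level x w)"
      using level_adj_ne[of v w] level_adj_le[of v w] level_adj_le[of w v] e w \<open>e \<noteq> x\<close>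
      by (auto simp: insert_commute)
    ultimately have "level x w = Suc (level x v)" using uv(2) by linarith
    with edge_level_pair[of v w] e(1) w \<open>e \<noteq> x\<close> ly uv(2) show ?thesis by auto
  qed
  obtain a b where ab: "{e \<in> E. v \<in> e \<and> e \<noteq> y} = {a, b}" "a \<noteq> b"
    using other_edges(1)[of v y] uv y by (auto simp: card_2_iff)
  obtain p where p: "p \<in> E" "u \<in> p" "p \<noteq> y" "Suc (edge_level p) = edge_level y"
    and puniq: "\<And>e. e \<in> E \<Longrightarrow> u \<in> e \<Longrightarrow> e \<noteq> y \<Longrightarrow> e \<noteq> p \<Longrightarrow> edge_level e = edge_level y"
  proof (cases "level x u")
    case 0
    hence ux: "u \<in> x" using level_zero_iff uv by auto
    show thesis
    proof (rule that[of x])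
      fix e assume e: "e \<in> E" "u \<in> e" "e \<noteq> y" "e \<noteq> x"
      obtain w where w: "e = {u, w}" using edge_two_vertices[OF e(1,2)] by blast
      thus "edge_level e = edge_level y" using ly 0 edge_level_pair[of u w] e by auto
    qed (use xE ux y ly 0 in \<open>auto simp: edge_level_def\<close>)
  next
    case (Suc k)
    then obtain w where w: "{u, w} \<in> E" "level x w = k" using parent_exists uv(3) by blast
    have "u \<notin> x" using level_zero_iff[of u] uv Suc by auto
    show thesis
    proof (rule that[of "{u, w}"])
      show "{u, w} \<noteq> y" using uv w Suc by (auto simp: doubleton_eq_iff)
      show "Suc (edge_level {u, w}) = edge_level y"
        using edge_level_pair[OF w(1)] \<open>u \<notin> x\<close> w Suc ly by auto
    next
      fix e assume e: "e \<in> E" "u \<in> e" "e \<noteq> y" "e \<noteq> {u, w}"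
      obtain w' where w': "e = {u, w'}" using edge_two_vertices[OF e(1,2)] by blast
      have "e \<noteq> x" using e \<open>u \<notin> x\<close> by auto
      have "level x w' \<noteq> level x w"
        using parent_unique[of u w w'] w w' e Suc by auto
      moreover have "level x u \<noteq> level x w'" "level x w' \<le> Suc (level x u)" "level x u \<le> Suc (level x w')"
        using level_adj_ne[of u w'] level_adj_le[of u w'] level_adj_le[of w' u] e w' \<open>e \<noteq> x\<close>
        by (auto simp: insert_commute)
      ultimately have "level x w' = Suc (level x u)" using w Suc by linarith
      thus "edge_level e = edge_level y" using edge_level_pair[of u w'] e w' \<open>e \<noteq> x\<close> ly by auto
    qed (use w in auto)
  qed
  obtain q where q: "{e \<in> E. u \<in> e \<and> e \<noteq> y} = {p, q}" "p \<noteq> q"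
  proof -
    have "card ({e \<in> E. u \<in> e \<and> e \<noteq> y} - {p}) = 1"
      using other_edges[of u y] uv y p by (subst card_Diff_singleton) auto
    then obtain q where "{e \<in> E. u \<in> e \<and> e \<noteq> y} - {p} = {q}" by (auto simp: card_1_singleton_iff)
    with p that[of q] show thesis by auto
  qed
  have qE: "q \<in> {e \<in> E. u \<in> e \<and> e \<noteq> y}" using q by auto
  have abE: "a \<in> {e \<in> E. v \<in> e \<and> e \<noteq> y}" "b \<in> {e \<in> E. v \<in> e \<and> e \<noteq> y}" using ab by auto
  have "nbrs y = {p, q, a, b}" "distinct [p, q, a, b]"
    using nbrs_split[OF uvE] ab q unfolding uv(1)[symmetric] by auto
  moreover have "edge_level q = edge_level y" using puniq[of q] qE q(2) by blast
  moreover have "edge_level a = Suc (edge_level y)" "edge_level b = Suc (edge_level y)"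
    using up abE by blast+
  ultimately show thesis using p(4) that by metis
qed

text \<open>Every vertex of the edge graph other than \<open>x\<close> has a neighbour of smaller \<open>edge_level\<close>, which
  gives a path, and \<open>edge_level\<close> grows by at most one along an edge, which makes that path shortest.\<close>

lemma edge_level_eq_dist: "y \<in> E \<Longrightarrow> edge_level y = d x y"
proof -
  assume yE: "y \<in> E"
  have path: "(x, y) \<in> edge_graph E ^^ edge_level y" if "y \<in> E" for y
    using that
  proof (induction "edge_level y" arbitrary: y)
    case 0
    thus ?case by (auto simp: edge_level_def split: if_splits)
  next
    case (Suc n)
    have "y \<noteq> x" using Suc.hyps(2) by (auto simp: edge_level_def)
    then obtain p where p: "p \<in> nbrs y" "Suc (edge_level p) = edge_level y"
      by (rule edge_level_nbrs[OF Suc.prems]) (metis insertI1)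
    hence pE: "p \<in> E" "(p, y) \<in> edge_graph E"
      using sym_edge_graph[of y p] by (auto simp: nbrs_def edge_graph_def)
    have "(x, p) \<in> edge_graph E ^^ n"
    proof -
      have "n = edge_level p" using p(2) Suc.hyps(2) by linarith
      thus ?thesis using Suc.hyps(1)[OF _ pE(1)] by simp
    qed
    with pE have "(x, y) \<in> edge_graph E ^^ Suc n" by auto
    with Suc.hyps(2) show ?case by simp
  qed
  have lip: "edge_level z \<le> Suc (edge_level y)" if "(y, z) \<in> edge_graph E" for y z
  proof (cases "y = x")
    case True
    with edge_level_center that show ?thesis by (auto simp: nbrs_def)
  next
    case False
    have "y \<in> E" "z \<in> nbrs y" using that by (auto simp: nbrs_def edge_graph_def)
    obtain p q a b where pq: "nbrs y = {p, q, a, b}" "Suc (edge_level p) = edge_level y"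
      "edge_level q = edge_level y" "edge_level a = Suc (edge_level y)"
      "edge_level b = Suc (edge_level y)"
      by (rule edge_level_nbrs[OF \<open>y \<in> E\<close> False])
    from \<open>z \<in> nbrs y\<close> consider "z = p" | "z = q" | "z = a" | "z = b"
      unfolding pq(1) by blast
    thus ?thesis using pq(2-5) by cases (hypsubst, linarith)+
  qed
  have "edge_level y \<le> n" if "(x, y) \<in> edge_graph E ^^ n" for y n
    using that
  proof (induction n arbitrary: y)
    case 0
    hence "y = x" by simp
    show ?case unfolding \<open>y = x\<close> edge_level_def by simp
  next
    case (Suc n)
    then obtain z where "(x, z) \<in> edge_graph E ^^ n" "(z, y) \<in> edge_graph E" by auto
    with Suc.IH[of z] lip[of z y] show ?case by auto
  qed
  with path[OF yE] show ?thesis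
    unfolding graph_dist_def by (metis (mono_tags, lifting) Least_equality)
qed

end

lemma nbrs_subset: "nbrs x \<subseteq> E"
  by (auto simp: nbrs_def edge_graph_def)

lemma nbrs_sym: "y \<in> nbrs x \<longleftrightarrow> x \<in> nbrs y"
  by (auto simp: nbrs_def edge_graph_def)

lemma card_nbrs: "x \<in> E \<Longrightarrow> card (nbrs x) = 4" and finite_nbrs: "x \<in> E \<Longrightarrow> finite (nbrs x)"
  using edge_level_center by blast+

lemma dist_nbrs: "x \<in> E \<Longrightarrow> y \<in> nbrs x \<Longrightarrow> d x y = 1"
  using edge_level_center[of x] edge_level_eq_dist[of x y] subsetD[OF nbrs_subset, of y x] by metis

lemma dist_eq_0_iff: "x \<in> E \<Longrightarrow> y \<in> E \<Longrightarrow> d x y = 0 \<longleftrightarrow> y = x"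
  using edge_level_eq_dist[of x y] edge_level_def[of x y] by (metis nat.distinct(1))

lemma dist_commute: "d x y = d y x"
proof -
  have "(y, x) \<in> edge_graph E ^^ n" if "(x, y) \<in> edge_graph E ^^ n" for x y n
    using that
  proof (induction n arbitrary: y)
    case (Suc n)
    then obtain z where "(x, z) \<in> edge_graph E ^^ n" "(z, y) \<in> edge_graph E" by auto
    with Suc.IH[of z] sym_edge_graph[of z y] show ?case by (metis relpow_Suc_I2)
  qed auto
  hence "(x, y) \<in> edge_graph E ^^ n \<longleftrightarrow> (y, x) \<in> edge_graph E ^^ n" for n by blast
  thus ?thesis unfolding graph_dist_def by simp
qed

lemma nbrs_dist:
  assumes "x \<in> E" "y \<in> E" "d x y = Suc n"
  obtains p q a b where "nbrs y = {p, q, a, b}" "distinct [p, q, a, b]" "d x p = n"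
    "d x q = Suc n" "d x a = Suc (Suc n)" "d x b = Suc (Suc n)"
proof -
  have "y \<noteq> x" using dist_eq_0_iff[OF assms(1,2)] assms(3) by simp
  obtain p q a b where "nbrs y = {p, q, a, b}" "distinct [p, q, a, b]"
    "Suc (edge_level x p) = edge_level x y" "edge_level x q = edge_level x y"
    "edge_level x a = Suc (edge_level x y)" "edge_level x b = Suc (edge_level x y)"
    by (rule edge_level_nbrs[OF assms(1,2) \<open>y \<noteq> x\<close>])
  note pq = this
  have "p \<in> E" "q \<in> E" "a \<in> E" "b \<in> E" using nbrs_subset[of y] unfolding pq(1) by auto
  thus thesis
    using that[OF pq(1,2)] pq(3-6) assms(3) edge_level_eq_dist[OF assms(1)] assms(2) by simp
qed

end

section \<open>Spherical functions and sphere sums\<close>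

text \<open>The radial eigenfunctions: the values at distance \<open>n\<close> of the function that is \<open>1\<close> at the centre
  and has eigenvalue \<open>l\<close>. The two recursion steps are the eigenvalue equation at the centre, which has
  four neighbours at distance 1, and at distance \<open>n + 1\<close>.\<close>

fun spherical :: "real \<Rightarrow> nat \<Rightarrow> real" where
  "spherical l 0 = 1"
| "spherical l (Suc 0) = (4 - l) / 4"
| "spherical l (Suc (Suc n)) = ((3 - l) * spherical l (Suc n) - spherical l n) / 2"

definition sphere_size :: "nat \<Rightarrow> real" where
  "sphere_size n = (if n = 0 then 1 else 2 ^ Suc n)"

lemma sphere_size_pos: "sphere_size n > 0"
  by (simp add: sphere_size_def)

lemma spherical_at_0: "spherical 0 n = 1"
  by (induction n rule: induct_nat_012) auto

lemma spherical_at_6: "spherical 6 n = (- 1 / 2) ^ n"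
  by (induction n rule: induct_nat_012) (auto simp: power_minus')

context cubic_tree
begin

definition sphere_about :: "'v set \<Rightarrow> nat \<Rightarrow> 'v set set" where
  "sphere_about x n = {y \<in> E. d x y = n}"

lemma nbr_counts:
  assumes "x \<in> E" "y \<in> E" "d x y = Suc n"
  shows "card {z \<in> nbrs y. d x z = n} = 1" "card {z \<in> nbrs y. d x z = Suc n} = 1"
    "card {z \<in> nbrs y. d x z = Suc (Suc n)} = 2"
    "d x ` nbrs y = {n, Suc n, Suc (Suc n)}"
proof -
  obtain p q a b where pq: "nbrs y = {p, q, a, b}" "distinct [p, q, a, b]" and
    dd: "d x p = n" "d x q = Suc n" "d x a = Suc (Suc n)" "d x b = Suc (Suc n)"
    by (rule nbrs_dist[OF assms])
  have "{z \<in> nbrs y. d x z = n} = {p}" "{z \<in> nbrs y. d x z = Suc n} = {q}"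
    "{z \<in> nbrs y. d x z = Suc (Suc n)} = {a, b}"
    unfolding pq(1) using dd by auto
  thus "card {z \<in> nbrs y. d x z = n} = 1" "card {z \<in> nbrs y. d x z = Suc n} = 1"
    "card {z \<in> nbrs y. d x z = Suc (Suc n)} = 2" using pq(2) by simp_all
  show "d x ` nbrs y = {n, Suc n, Suc (Suc n)}" unfolding pq(1) using dd by simp
qed

lemma sum_radial_nbrs:
  fixes h :: "nat \<Rightarrow> 'b::comm_semiring_1"
  assumes "x \<in> E" "y \<in> E" "d x y = Suc n"
  shows "(\<Sum>z\<in>nbrs y. h (d x z)) = h n + h (Suc n) + 2 * h (Suc (Suc n))"
proof -
  obtain p q a b where pq: "nbrs y = {p, q, a, b}" "distinct [p, q, a, b]" and
    dd: "d x p = n" "d x q = Suc n" "d x a = Suc (Suc n)" "d x b = Suc (Suc n)"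
    by (rule nbrs_dist[OF assms])
  have "(\<Sum>z\<in>nbrs y. h (d x z)) = h (d x p) + (h (d x q) + (h (d x a) + h (d x b)))"
    using pq(2) unfolding pq(1) by (simp add: ac_simps)
  thus ?thesis unfolding dd by (simp add: mult_2 ac_simps)
qed

lemma sphere_about_0: "x \<in> E \<Longrightarrow> sphere_about x 0 = {x}"
  unfolding sphere_about_def using dist_eq_0_iff by auto

lemma sphere_about_1: "x \<in> E \<Longrightarrow> sphere_about x (Suc 0) = nbrs x"
proof -
  assume x: "x \<in> E"
  have "y \<in> nbrs x" if y: "y \<in> E" "d x y = Suc 0" for y
  proof -
    obtain p q a b where pq: "nbrs y = {p, q, a, b}" "d x p = 0"
      using nbrs_dist[OF x y] by metis
    have "p \<in> nbrs y" unfolding pq(1) by simp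
    moreover have "p = x"
      using pq(2) dist_eq_0_iff[OF x, of p] \<open>p \<in> nbrs y\<close> nbrs_subset by blast
    ultimately show ?thesis using nbrs_sym by blast
  qed
  thus ?thesis unfolding sphere_about_def using dist_nbrs[OF x] nbrs_subset by fastforce
qed

lemma finite_sphere_about: "x \<in> E \<Longrightarrow> finite (sphere_about x n)"
proof (induction n)
  case 0
  then show ?case by (simp add: sphere_about_0)
next
  case (Suc n)
  have "sphere_about x (Suc n) \<subseteq> (\<Union>z\<in>sphere_about x n. nbrs z)"
  proof
    fix y assume y: "y \<in> sphere_about x (Suc n)"
    hence y': "y \<in> E" "d x y = Suc n" by (auto simp: sphere_about_def)
    obtain p q a b where pq: "nbrs y = {p, q, a, b}" "d x p = n"
      using nbrs_dist[OF Suc.prems y'] by metis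
    have "p \<in> nbrs y" unfolding pq(1) by simp
    thus "y \<in> (\<Union>z\<in>sphere_about x n. nbrs z)"
      using nbrs_subset nbrs_sym pq(2) by (auto simp: sphere_about_def)
  qed
  moreover have "finite (\<Union>z\<in>sphere_about x n. nbrs z)"
    using Suc finite_nbrs by (auto simp: sphere_about_def)
  ultimately show ?case using finite_subset by blast
qed

lemma disjoint_spheres: "m \<noteq> n \<Longrightarrow> sphere_about x m \<inter> sphere_about x n = {}"
  by (auto simp: sphere_about_def)

lemma eigenfunction_iff:
  "eigenfunction E l H \<longleftrightarrow> (\<forall>x\<in>E. (\<Sum>y\<in>nbrs x. H y) = (4 - of_real l) * H x)"
proof -
  have "laplacian (edge_graph E) H x = (\<Sum>y\<in>nbrs x. H y) - 4 * H x" if "x \<in> E" for x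
    using card_nbrs[OF that] unfolding laplacian_def nbrs_def[symmetric] by (simp add: sum_subtractf)
  moreover have "- (S - 4 * h) = c * h \<longleftrightarrow> S = (4 - c) * h" for S h c :: complex
    by (auto simp: left_diff_distrib minus_diff_eq eq_diff_eq diff_eq_eq add.commute)
  ultimately show ?thesis unfolding eigenfunction_def by simp
qed

text \<open>On the left every \<open>y\<close> is counted as often as it has neighbours at distance \<open>n + 1\<close> from \<open>x\<close>:
  twice from the inner sphere (four times if that is \<open>x\<close> itself) and once from the other two.\<close>

lemma sphere_double_count:
  fixes H :: "'v set \<Rightarrow> complex"
  assumes x: "x \<in> E"
  shows "(\<Sum>z\<in>sphere_about x (Suc n). \<Sum>y\<in>nbrs z. H y) =
    (if n = 0 then 4 else 2) * (\<Sum>y\<in>sphere_about x n. H y)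
    + (\<Sum>y\<in>sphere_about x (Suc n). H y) + (\<Sum>y\<in>sphere_about x (Suc (Suc n)). H y)"
proof -
  let ?S = "sphere_about x"
  let ?U = "?S n \<union> ?S (Suc n) \<union> ?S (Suc (Suc n))"
  have fin: "finite ?U" using finite_sphere_about[OF x] by simp
  have "(\<Sum>z\<in>?S (Suc n). \<Sum>y\<in>nbrs z. H y) = (\<Sum>z\<in>?S (Suc n). \<Sum>y | y \<in> ?U \<and> z \<in> nbrs y. H y)"
  proof (rule sum.cong[OF refl], rule sum.cong)
    fix z assume "z \<in> ?S (Suc n)"
    hence z: "z \<in> E" "d x z = Suc n" by (auto simp: sphere_about_def)
    have "nbrs z \<subseteq> ?U"
    proof
      fix y assume "y \<in> nbrs z"
      hence "d x y \<in> {n, Suc n, Suc (Suc n)}" "y \<in> E"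
        using nbr_counts(4)[OF x z] nbrs_subset by blast+
      thus "y \<in> ?U" by (auto simp: sphere_about_def)
    qed
    thus "nbrs z = {y. y \<in> ?U \<and> z \<in> nbrs y}" using nbrs_sym by blast
  qed simp
  also have "\<dots> = (\<Sum>y\<in>?U. \<Sum>z | z \<in> ?S (Suc n) \<and> z \<in> nbrs y. H y)"
    by (rule sum.swap_restrict) (use finite_sphere_about[OF x] in auto)
  also have "\<dots> = (\<Sum>y\<in>?U. of_nat (card {z \<in> nbrs y. d x z = Suc n}) * H y)"
  proof (rule sum.cong[OF refl])
    fix y
    have "{z. z \<in> ?S (Suc n) \<and> z \<in> nbrs y} = {z \<in> nbrs y. d x z = Suc n}"
      using nbrs_subset by (auto simp: sphere_about_def)
    thus "(\<Sum>z | z \<in> ?S (Suc n) \<and> z \<in> nbrs y. H y) = of_nat (card {z \<in> nbrs y. d x z = Suc n}) * H y"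
      by simp
  qed
  also have "\<dots> = (\<Sum>y\<in>?S n. of_nat (card {z \<in> nbrs y. d x z = Suc n}) * H y)
    + (\<Sum>y\<in>?S (Suc n). of_nat (card {z \<in> nbrs y. d x z = Suc n}) * H y)
    + (\<Sum>y\<in>?S (Suc (Suc n)). of_nat (card {z \<in> nbrs y. d x z = Suc n}) * H y)"
    using finite_sphere_about[OF x]
    by (subst sum.union_disjoint | force simp: sphere_about_def)+
  also have "(\<Sum>y\<in>?S n. of_nat (card {z \<in> nbrs y. d x z = Suc n}) * H y)
      = (\<Sum>y\<in>?S n. (if n = 0 then 4 else 2) * H y)"
  proof (rule sum.cong[OF refl])
    fix y assume y: "y \<in> ?S n"
    show "of_nat (card {z \<in> nbrs y. d x z = Suc n}) * H y = (if n = 0 then 4 else 2) * H y"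
    proof (cases n)
      case 0
      hence "y = x" using y sphere_about_0[OF x] by simp
      moreover have "{z \<in> nbrs x. d x z = Suc 0} = nbrs x" using dist_nbrs[OF x] by auto
      ultimately show ?thesis using 0 card_nbrs[OF x] by simp
    next
      case (Suc m)
      have "card {z \<in> nbrs y. d x z = Suc (Suc m)} = 2"
        using nbr_counts(3)[OF x, of y m] y Suc by (auto simp: sphere_about_def)
      thus ?thesis using Suc by simp
    qed
  qed
  also have "(\<Sum>y\<in>?S (Suc n). of_nat (card {z \<in> nbrs y. d x z = Suc n}) * H y) = (\<Sum>y\<in>?S (Suc n). H y)"
    using nbr_counts(2)[OF x] by (intro sum.cong) (auto simp: sphere_about_def)
  also have "(\<Sum>y\<in>?S (Suc (Suc n)). of_nat (card {z \<in> nbrs y. d x z = Suc n}) * H y)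
     = (\<Sum>y\<in>?S (Suc (Suc n)). H y)"
    using nbr_counts(1)[OF x] by (intro sum.cong) (auto simp: sphere_about_def)
  finally show ?thesis by (simp only: sum_distrib_left)
qed

text \<open>By \<open>sphere_double_count\<close> the sphere sums of an eigenfunction satisfy the recursion of
  \<open>spherical\<close> weighted with the sphere sizes. So eigenfunctions have spherical means like the radial one;
  with \<open>H = 1\<close> and \<open>l = 0\<close> this computes the sizes of the spheres.\<close>

lemma sphere_sum_eigenfunction:
  assumes H: "eigenfunction E l H" and x: "x \<in> E"
  shows "(\<Sum>y\<in>sphere_about x n. H y) = of_real (sphere_size n * spherical l n) * H x"
proof (induction n rule: induct_nat_012)
  case 0
  then show ?case using x by (simp add: sphere_about_0 sphere_size_def)
next
  case 1
  then show ?case using H x by (simp add: sphere_about_1 sphere_size_def eigenfunction_iff)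
next
  case (ge2 n)
  have "(\<Sum>z\<in>sphere_about x (Suc n). \<Sum>y\<in>nbrs z. H y)
      = (4 - of_real l) * (\<Sum>z\<in>sphere_about x (Suc n). H z)"
    using H unfolding eigenfunction_iff sum_distrib_left
    by (intro sum.cong) (auto simp: sphere_about_def)
  hence rec: "(\<Sum>y\<in>sphere_about x (Suc (Suc n)). H y) =
      (3 - of_real l) * (\<Sum>z\<in>sphere_about x (Suc n). H z)
      - (if n = 0 then 4 else 2) * (\<Sum>y\<in>sphere_about x n. H y)"
    unfolding sphere_double_count[OF x] by (simp add: algebra_simps eq_diff_eq)
  show ?case unfolding rec ge2
    by (cases n) (simp_all add: sphere_size_def algebra_simps)
qed

text \<open>The recursion of \<open>spherical\<close> is the eigenvalue equation, written with the distances of the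
  four neighbours.\<close>

lemma eigenfunction_radial:
  assumes y: "y \<in> E"
  shows "eigenfunction E l (\<lambda>x. of_real (spherical l (d x y)))"
  unfolding eigenfunction_iff
proof
  fix x assume x: "x \<in> E"
  show "(\<Sum>z\<in>nbrs x. complex_of_real (spherical l (d z y))) = (4 - of_real l) * of_real (spherical l (d x y))"
  proof (cases "d y x")
    case 0
    hence "x = y" using dist_eq_0_iff[OF y x] by simp
    have "(\<Sum>z\<in>nbrs x. complex_of_real (spherical l (d z y))) = (\<Sum>z\<in>nbrs x. of_real (spherical l 1))"
      using dist_nbrs[OF y] \<open>x = y\<close> by (intro sum.cong) (auto simp: dist_commute)
    thus ?thesis using card_nbrs[OF x] 0 unfolding dist_commute[of x y]
      by (simp del: of_real_divide add: of_real_divide[symmetric]) (simp add: field_simps)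
  next
    case (Suc n)
    have "spherical l n + spherical l (Suc n) + 2 * spherical l (Suc (Suc n)) = (4 - l) * spherical l (Suc n)"
      by (simp add: field_simps)
    hence "complex_of_real (spherical l n) + of_real (spherical l (Suc n)) + 2 * of_real (spherical l (Suc (Suc n)))
        = (4 - of_real l) * of_real (spherical l (Suc n))"
      by (metis of_real_add of_real_mult of_real_diff of_real_numeral)
    thus ?thesis
      using sum_radial_nbrs[OF y x Suc, of "\<lambda>k. complex_of_real (spherical l k)"] Suc
      by (simp only: dist_commute[of _ y])
  qed
qed

lemma card_sphere_about:
  assumes "x \<in> E" shows "real (card (sphere_about x n)) = sphere_size n"
proof -
  have "eigenfunction E 0 (\<lambda>_. 1)"
    by (auto simp: eigenfunction_def laplacian_def)
  from sphere_sum_eigenfunction[OF this assms, of n]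
  have "complex_of_real (real (card (sphere_about x n))) = of_real (sphere_size n)"
    by (simp add: spherical_at_0)
  thus ?thesis by (simp only: of_real_eq_iff)
qed

definition ball_about :: "'v set \<Rightarrow> nat \<Rightarrow> 'v set set" where
  "ball_about x n = (\<Union>k\<le>n. sphere_about x k)"

lemma finite_ball_about: "x \<in> E \<Longrightarrow> finite (ball_about x n)"
  by (simp add: ball_about_def finite_sphere_about)

lemma sum_ball_about:
  fixes f :: "'v set \<Rightarrow> 'b::comm_monoid_add"
  assumes "x \<in> E" shows "(\<Sum>y\<in>ball_about x n. f y) = (\<Sum>k\<le>n. \<Sum>y\<in>sphere_about x k. f y)"
  unfolding ball_about_def
  by (rule sum.UNION_disjoint) (use assms finite_sphere_about disjoint_spheres in auto)

lemma filterlim_ball_about: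
  assumes "x \<in> E"
  shows "filterlim (ball_about x) (finite_subsets_at_top E) sequentially"
  unfolding filterlim_finite_subsets_at_top
proof (intro allI impI)
  fix X assume X: "finite X \<and> X \<subseteq> E"
  show "\<forall>\<^sub>F n in sequentially. finite (ball_about x n) \<and> X \<subseteq> ball_about x n \<and> ball_about x n \<subseteq> E"
  proof (rule eventually_sequentiallyI)
    fix n assume n: "n \<ge> Max (insert 0 (d x ` X))"
    have "d x y \<le> n" if "y \<in> X" for y
      using n Max_ge[of "insert 0 (d x ` X)" "d x y"] X that by auto
    thus "finite (ball_about x n) \<and> X \<subseteq> ball_about x n \<and> ball_about x n \<subseteq> E"
      using finite_ball_about[OF assms] X by (auto simp: ball_about_def sphere_about_def)
  qed
qed

lemma countable_E: "countable E"
proof (cases "E = {}")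
  case False
  then obtain x where x: "x \<in> E" by blast
  have "E = (\<Union>n. sphere_about x n)" by (auto simp: sphere_about_def)
  thus ?thesis using finite_sphere_about[OF x] by (metis countable_UN countableI_type countable_finite)
qed simp

end

section \<open>The spectral measure\<close>

definition spec_density :: "real \<Rightarrow> real" where
  "spec_density l = 9 * sqrt (- l\<^sup>2 + 6 * l - 1) / (2 * pi * (- l\<^sup>2 + 6 * l))"

lemma \<Sigma>_set_iff: "l \<in> \<Sigma>_set \<longleftrightarrow> (l - 3)\<^sup>2 \<le> 8"
proof -
  have "l \<in> \<Sigma>_set \<longleftrightarrow> \<bar>l - 3\<bar> \<le> \<bar>2 * sqrt 2\<bar>" by (auto simp: \<Sigma>_set_def abs_le_iff)
  also have "\<dots> \<longleftrightarrow> (l - 3)\<^sup>2 \<le> (2 * sqrt 2)\<^sup>2" by (rule abs_le_square_iff)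
  finally show ?thesis by (simp add: power_mult_distrib)
qed

lemma \<Sigma>_set_pos: "l \<in> \<Sigma>_set \<Longrightarrow> - l\<^sup>2 + 6 * l - 1 \<ge> 0"
  unfolding \<Sigma>_set_iff by (simp add: power2_eq_square algebra_simps)

lemma \<Sigma>_set_bounds:
  assumes "l \<in> \<Sigma>_set" shows "0 < l" "l < 6"
proof -
  have "l * (6 - l) > 0" using \<Sigma>_set_pos[OF assms] by (simp add: power2_eq_square algebra_simps)
  hence "0 < l \<and> l < 6" by (auto simp: zero_less_mult_iff)
  thus "0 < l" "l < 6" by auto
qed

lemma spec_density_nonneg: "l \<in> \<Sigma>_set \<Longrightarrow> spec_density l \<ge> 0"
  using \<Sigma>_set_pos[of l] unfolding spec_density_def by (intro divide_nonneg_nonneg mult_nonneg_nonneg) auto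

lemma continuous_spec_density: "continuous_on \<Sigma>_set spec_density"
  unfolding spec_density_def
  using \<Sigma>_set_pos by (intro continuous_intros) (fastforce)

lemma spec_measure_eq: "spec_measure = density lborel (\<lambda>l. ennreal (indicator \<Sigma>_set l * spec_density l))"
  unfolding spec_measure_def spec_density_def ..

lemma sets_spec_measure [measurable_cong]: "sets spec_measure = sets borel"
  by (simp add: spec_measure_def)

lemma space_spec_measure [simp]: "space spec_measure = UNIV"
  by (simp add: spec_measure_def)

lemma \<Sigma>_set_borel [measurable]: "\<Sigma>_set \<in> sets borel"
  by (simp add: \<Sigma>_set_def)

lemma spec_density_measurable [measurable]: "spec_density \<in> borel_measurable borel"
  unfolding spec_density_def by measurable

lemma AE_spec_measure_interior: "AE l in spec_measure. 3 - 2 * sqrt 2 < l \<and> l < 3 + 2 * sqrt 2"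
proof -
  have "AE l in lborel. l \<noteq> 3 - 2 * sqrt 2" "AE l in lborel. l \<noteq> 3 + 2 * sqrt 2"
    by (rule AE_lborel_singleton)+
  thus ?thesis unfolding spec_measure_eq
    by (subst AE_density, simp, eventually_elim) (auto simp: indicator_def \<Sigma>_set_def split: if_splits)
qed

lemma AE_spec_measure_\<Sigma>: "AE l in spec_measure. l \<in> \<Sigma>_set"
  using AE_spec_measure_interior by eventually_elim (auto simp: \<Sigma>_set_def)

text \<open>The substitution \<open>l = 3 - 2 \<surd>2 cos t\<close>, which turns \<open>-l\<^sup>2 + 6 l - 1\<close> into \<open>8 sin\<^sup>2 t\<close> and
  \<open>-l\<^sup>2 + 6 l\<close> into \<open>5 - 4 cos 2t\<close>.\<close>

lemma integral_spec_measure: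
  fixes h :: "real \<Rightarrow> real"
  assumes h: "continuous_on UNIV h"
  shows "integrable spec_measure h"
    and "(LINT l|spec_measure. h l) =
      integral {0..pi} (\<lambda>t. h (3 - 2 * sqrt 2 * cos t) * (36 * (sin t)\<^sup>2 / (pi * (5 - 4 * cos (2 * t)))))"
proof -
  have hb [measurable]: "h \<in> borel_measurable borel" using h by (rule borel_measurable_continuous_onI)
  have nn: "AE l in lborel. 0 \<le> indicator \<Sigma>_set l * spec_density l"
    using spec_density_nonneg by (auto simp: indicator_def)
  let ?f = "\<lambda>l. spec_density l * h l"
  have cont: "continuous_on \<Sigma>_set ?f"
    using continuous_spec_density continuous_on_subset[OF h] by (intro continuous_intros) auto
  have si: "set_integrable lborel \<Sigma>_set ?f"
    using cont unfolding \<Sigma>_set_def by (rule borel_integrable_atLeastAtMost')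
  have "integrable lborel (\<lambda>l. (indicator \<Sigma>_set l * spec_density l) *\<^sub>R h l)"
    using si unfolding set_integrable_def by (simp add: mult.assoc)
  thus "integrable spec_measure h"
    unfolding spec_measure_eq by (subst integrable_density) (use nn in auto)
  have 1: "(LINT l|spec_measure. h l) = (LBINT l. (indicator \<Sigma>_set l * spec_density l) *\<^sub>R h l)"
    unfolding spec_measure_eq by (rule integral_density) (use nn in auto)
  let ?g = "\<lambda>t::real. 3 - 2 * sqrt 2 * cos t"
  let ?g' = "\<lambda>t::real. 2 * sqrt 2 * sin t"
  have eq: "?f (?g t) * ?g' t = h (?g t) * (36 * (sin t)\<^sup>2 / (pi * (5 - 4 * cos (2 * t))))"
    if "t \<in> {0..pi}" for t
  proof -
    have sn: "sin t \<ge> 0" using that by (auto intro: sin_ge_zero)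
    have a: "- (?g t)\<^sup>2 + 6 * ?g t = 1 + 8 * (sin t)\<^sup>2"
      by (simp add: power2_eq_square algebra_simps sin_squared_eq[unfolded power2_eq_square])
    have b: "sqrt (- (?g t)\<^sup>2 + 6 * ?g t - 1) = 2 * sqrt 2 * sin t"
      unfolding a by (rule real_sqrt_unique) (use sn in \<open>auto simp: power_mult_distrib\<close>)
    have c: "5 - 4 * cos (2 * t) = 1 + 8 * (sin t)\<^sup>2" by (simp add: cos_double_sin)
    have "9 * (2 * sqrt 2 * s) / (2 * pi * D) * H * (2 * sqrt 2 * s) = H * (36 * s\<^sup>2 / (pi * D))"
      for s D H :: real
    proof -
      have "9 * (2 * sqrt 2 * s) / (2 * pi * D) * H * (2 * sqrt 2 * s)
          = (sqrt 2 * sqrt 2) * (18 * s * s * H / (pi * D))" by (simp add: field_simps)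
      thus ?thesis by (simp add: power2_eq_square)
    qed
    thus ?thesis unfolding spec_density_def b unfolding a c by blast
  qed
  have g: "?g 0 = 3 - 2 * sqrt 2" "?g pi = 3 + 2 * sqrt 2" by auto
  have sub: "set_integrable lborel {0..pi} (\<lambda>t. ?f (?g t) * ?g' t)"
    "(LBINT l. ?f l * indicator {?g 0..?g pi} l) = (LBINT t. ?f (?g t) * ?g' t * indicator {0..pi} t)"
  proof -
    have 1: "set_integrable lborel {?g 0..?g pi} ?f" using si unfolding g \<Sigma>_set_def .
    have 2: "(?g has_real_derivative ?g' t) (at t)" for t by (auto intro!: derivative_eq_intros)
    have 3: "continuous_on {0..pi} ?g'" by (intro continuous_intros)
    have 4: "?g' t \<ge> 0" if "t \<in> {0..pi}" for t using that by (auto intro!: mult_nonneg_nonneg sin_ge_zero)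
    show "set_integrable lborel {0..pi} (\<lambda>t. ?f (?g t) * ?g' t)"
      by (rule integral_substitution(1)[OF 1 2 3 4]) auto
    show "(LBINT l. ?f l * indicator {?g 0..?g pi} l) = (LBINT t. ?f (?g t) * ?g' t * indicator {0..pi} t)"
      by (rule integral_substitution(2)[OF 1 2 3 4]) auto
  qed
  have sub1: "set_integrable lborel {0..pi}
     (\<lambda>t. h (?g t) * (36 * (sin t)\<^sup>2 / (pi * (5 - 4 * cos (2 * t)))))"
    using sub(1) by (rule back_subst[where P = "\<lambda>x. x"], intro set_integrable_cong) (use eq in auto)
  have "(LINT l|spec_measure. h l) = (LBINT l. ?f l * indicator {?g 0..?g pi} l)"
    unfolding 1 g \<Sigma>_set_def by (simp add: mult_ac)
  also have "\<dots> = (LBINT t. ?f (?g t) * ?g' t * indicator {0..pi} t)" by (rule sub(2))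
  also have "\<dots> = (LINT t:{0..pi}|lborel. h (?g t) * (36 * (sin t)\<^sup>2 / (pi * (5 - 4 * cos (2 * t)))))"
    unfolding set_lebesgue_integral_def
    by (rule Bochner_Integration.integral_cong[OF refl]) (use eq in \<open>auto simp: indicator_def\<close>)
  also have "\<dots> = integral {0..pi} (\<lambda>t. h (?g t) * (36 * (sin t)\<^sup>2 / (pi * (5 - 4 * cos (2 * t)))))"
    using set_borel_integral_eq_integral(2)[OF sub1] .
  finally show "(LINT l|spec_measure. h l) = \<dots>" .
qed

lemma finite_spec_measure: "finite_measure spec_measure"
proof (rule finite_measureI)
  have "integrable spec_measure (\<lambda>_. 1 :: real)" by (rule integral_spec_measure) simp
  hence "(\<integral>\<^sup>+l. ennreal (norm (1::real)) \<partial>spec_measure) < \<infinity>"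
    unfolding integrable_iff_bounded by blast
  thus "emeasure spec_measure (space spec_measure) \<noteq> \<infinity>" by simp
qed

text \<open>Up to a factor, \<open>1 / (5 - 4 cos 2t)\<close> is the Poisson kernel of radius \<open>1/2\<close> in the angle \<open>2t\<close>, so
  its Fourier coefficients are a geometric sequence on the even integers and vanish on the odd ones.\<close>

definition fourier_coeff :: "int \<Rightarrow> real" where
  "fourier_coeff k = integral {0..pi} (\<lambda>t. cos (of_int k * t) / (5 - 4 * cos (2 * t)))"

lemma five_minus_pos: "5 - 4 * cos (2 * t :: real) > 0" "5 - 4 * cos (2 * t :: real) \<ge> 1"
proof -
  have "cos (2 * t) \<le> 1" by simp
  thus "5 - 4 * cos (2 * t) > 0" "5 - 4 * cos (2 * t) \<ge> 1" by linarith+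
qed

lemma fourier_integrable: "(\<lambda>t::real. cos (of_int k * t) / (5 - 4 * cos (2 * t))) integrable_on {0..pi}"
proof -
  have "5 - 4 * cos (2 * t :: real) \<noteq> 0" for t using five_minus_pos(1)[of t] by simp
  thus ?thesis by (intro integrable_continuous_real continuous_intros) auto
qed

lemma fourier_coeff_minus: "fourier_coeff (- k) = fourier_coeff k"
  by (simp add: fourier_coeff_def)

lemma fourier_coeff_bound: "\<bar>fourier_coeff k\<bar> \<le> pi"
proof -
  have "norm (integral (cbox 0 pi) (\<lambda>t::real. cos (of_int k * t) / (5 - 4 * cos (2 * t)))) \<le> 1 * measure lborel (cbox 0 (pi::real))"
  proof (rule integrable_bound)
    fix t :: real
    show "norm (cos (of_int k * t) / (5 - 4 * cos (2 * t))) \<le> 1"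
    proof -
      have "\<bar>cos (of_int k * t)\<bar> \<le> \<bar>5 - 4 * cos (2 * t)\<bar>"
        using five_minus_pos(2)[of t] abs_cos_le_one[of "of_int k * t"] by linarith
      thus ?thesis by (auto simp: divide_le_eq_1)
    qed
  qed (use fourier_integrable in auto)
  thus ?thesis unfolding fourier_coeff_def by simp
qed

lemma integral_cos_multiple:
  "integral {0..pi} (\<lambda>t. cos (of_int k * t)) = (if k = 0 then pi else 0)"
proof (cases "k = 0")
  case False
  have "((\<lambda>t. cos (of_int k * t)) has_integral (sin (of_int k * pi) / of_int k - sin (of_int k * 0) / of_int k)) {0..pi}"
    by (rule fundamental_theorem_of_calculus)
      (use False in \<open>auto intro!: derivative_eq_intros simp flip: has_real_derivative_iff_has_vector_derivative\<close>)
  moreover have "sin (of_int k * pi) = 0" by (simp add: sin_zero_iff_int2)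
  ultimately show ?thesis using False by (auto dest: integral_unique)
qed simp

text \<open>The combination of cosines on the left is \<open>cos kt\<close> times the denominator \<open>5 - 4 cos 2t\<close>.\<close>

lemma fourier_coeff_rec:
  "5 * fourier_coeff k - 2 * fourier_coeff (k + 2) - 2 * fourier_coeff (k - 2) = (if k = 0 then pi else 0)"
proof -
  let ?q = "\<lambda>k t::real. cos (of_int k * t) / (5 - 4 * cos (2 * t))"
  have "(?q k has_integral fourier_coeff k) {0..pi}" for k
    unfolding fourier_coeff_def using fourier_integrable by (rule integrable_integral)
  hence "((\<lambda>t. 5 * ?q k t - 2 * ?q (k + 2) t - 2 * ?q (k - 2) t) has_integral
      5 * fourier_coeff k - 2 * fourier_coeff (k + 2) - 2 * fourier_coeff (k - 2)) {0..pi}"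
    by (intro has_integral_diff has_integral_mult_right)
  hence "5 * fourier_coeff k - 2 * fourier_coeff (k + 2) - 2 * fourier_coeff (k - 2)
     = integral {0..pi} (\<lambda>t. 5 * ?q k t - 2 * ?q (k + 2) t - 2 * ?q (k - 2) t)"
    by (simp only: integral_unique)
  also have "\<dots> = integral {0..pi} (\<lambda>t. cos (of_int k * t))"
  proof (rule Henstock_Kurzweil_Integration.integral_cong)
    fix t :: real
    have "cos (of_int (k + 2) * t) + cos (of_int (k - 2) * t) = 2 * cos (of_int k * t) * cos (2 * t)"
      by (simp add: distrib_right left_diff_distrib cos_add cos_diff)
    hence "5 * cos (of_int k * t) - 2 * cos (of_int (k + 2) * t) - 2 * cos (of_int (k - 2) * t)
       = cos (of_int k * t) * (5 - 4 * cos (2 * t))" by (simp add: algebra_simps)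
    moreover have "5 * ?q k t - 2 * ?q (k + 2) t - 2 * ?q (k - 2) t =
      (5 * cos (of_int k * t) - 2 * cos (of_int (k + 2) * t) - 2 * cos (of_int (k - 2) * t)) / (5 - 4 * cos (2 * t))"
      by (simp add: diff_divide_distrib)
    ultimately show "5 * ?q k t - 2 * ?q (k + 2) t - 2 * ?q (k - 2) t = cos (of_int k * t)"
      using five_minus_pos(1)[of t] by simp
  qed
  finally show ?thesis by (simp add: integral_cos_multiple)
qed

text \<open>The characteristic roots of the recursion, in steps of two, are \<open>2\<close> and \<open>1/2\<close>. The component
  \<open>D\<close> along the root \<open>2\<close> doubles at every step while the coefficients stay bounded, so it vanishes.
  The recursion is homogeneous away from \<open>k = 0\<close>; starting at \<open>k = -1\<close> covers the odd integers, where
  symmetry then forces all coefficients to vanish.\<close>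

lemma fourier_coeff_halves:
  assumes k: "k \<ge> -1"
  shows "fourier_coeff (k + 2) = fourier_coeff k / 2"
proof -
  define D where "D j = fourier_coeff (k + 2 * int j + 2) - fourier_coeff (k + 2 * int j) / 2" for j
  have "D (Suc j) = 2 * D j" for j
  proof -
    have "k + 2 * int j + 2 \<noteq> 0" using k by linarith
    with fourier_coeff_rec[of "k + 2 * int j + 2"] show ?thesis
      unfolding D_def by (simp add: algebra_simps)
  qed
  hence D: "D j = 2 ^ j * D 0" for j by (induction j) auto
  have "\<bar>D j\<bar> \<le> 2 * pi" for j
    using fourier_coeff_bound[of "k + 2 * int j + 2"] fourier_coeff_bound[of "k + 2 * int j"] unfolding D_def by linarith
  hence bd: "2 ^ j * \<bar>D 0\<bar> \<le> 2 * pi" for j using D[of j] by (metis abs_mult abs_numeral power_abs)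
  \<comment> \<open>a sequence that doubles at each step is bounded only if it is zero\<close>
  have "D 0 = 0"
  proof (rule ccontr)
    assume "D 0 \<noteq> 0"
    then obtain j where "2 * pi / \<bar>D 0\<bar> < 2 ^ j" using real_arch_pow[of 2 "2 * pi / \<bar>D 0\<bar>"] by auto
    with bd[of j] \<open>D 0 \<noteq> 0\<close> show False by (simp add: divide_less_eq)
  qed
  thus ?thesis unfolding D_def by simp
qed

lemma fourier_coeff_even: "fourier_coeff (2 * int j) = pi / 3 * (1 / 2) ^ j"
proof (induction j)
  case 0
  have "5 * fourier_coeff 0 - 2 * fourier_coeff 2 - 2 * fourier_coeff 2 = pi"
    using fourier_coeff_rec[of 0] fourier_coeff_minus[of 2] by simp
  with fourier_coeff_halves[of 0] show ?case by simp
next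
  case (Suc j)
  have "fourier_coeff (2 * int (Suc j)) = fourier_coeff (2 * int j) / 2"
    using fourier_coeff_halves[of "2 * int j"] by (simp add: algebra_simps)
  with Suc show ?case by simp
qed

lemma fourier_coeff_odd: "fourier_coeff (2 * int j + 1) = 0"
proof (induction j)
  case 0
  show ?case using fourier_coeff_halves[of "-1"] fourier_coeff_minus[of 1] by simp
next
  case (Suc j)
  have "fourier_coeff (2 * int (Suc j) + 1) = fourier_coeff (2 * int j + 1) / 2"
    using fourier_coeff_halves[of "2 * int j + 1"] by (simp add: algebra_simps)
  with Suc show ?case by simp
qed

text \<open>After division by \<open>2 ^ (-n/2)\<close> the recursion of \<open>spherical\<close> is the one of the Chebyshev
  polynomials. Multiplication by \<open>sin t\<close> avoids the exceptional points \<open>t = 0\<close> and \<open>t = \<pi>\<close>.\<close>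

lemma spherical_trig:
  "sin t * spherical (3 - 2 * sqrt 2 * cos t) n =
    (1 / sqrt 2) ^ n * (cos (of_nat n * t) * sin t + sqrt 2 / 4 * sin (of_nat n * t))"
proof (induction n rule: induct_nat_012)
  case 0
  show ?case by simp
next
  case 1
  show ?case by (simp add: field_simps)
next
  case (ge2 n)
  define c where "c m = cos (of_nat m * t) * sin t + sqrt 2 / 4 * sin (of_nat m * t)" for m
  have c: "c (Suc (Suc n)) = 2 * cos t * c (Suc n) - c n"
  proof -
    have "cos (real (Suc (Suc n)) * t) = 2 * cos t * cos (real (Suc n) * t) - cos (real n * t)"
      "sin (real (Suc (Suc n)) * t) = 2 * cos t * sin (real (Suc n) * t) - sin (real n * t)"
    proof -
      have e: "real (Suc (Suc n)) * t = real (Suc n) * t + t" "real n * t = real (Suc n) * t - t"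
        by (simp_all add: algebra_simps)
      show "cos (real (Suc (Suc n)) * t) = 2 * cos t * cos (real (Suc n) * t) - cos (real n * t)"
        "sin (real (Suc (Suc n)) * t) = 2 * cos t * sin (real (Suc n) * t) - sin (real n * t)"
        unfolding e by (simp_all only: cos_add cos_diff sin_add sin_diff) (simp_all add: algebra_simps)
    qed
    thus ?thesis unfolding c_def by algebra
  qed
  have "2 * (sin t * spherical (3 - 2 * sqrt 2 * cos t) (Suc (Suc n)))
    = 2 * sqrt 2 * cos t * (sin t * spherical (3 - 2 * sqrt 2 * cos t) (Suc n)) - sin t * spherical (3 - 2 * sqrt 2 * cos t) n"
    by (simp add: field_simps)
  also have "\<dots> = 2 * sqrt 2 * cos t * ((1 / sqrt 2) ^ Suc n * c (Suc n)) - (1 / sqrt 2) ^ n * c n"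
    using ge2 by (simp only: c_def)
  also have "\<dots> = 2 * ((1 / sqrt 2) ^ Suc (Suc n) * (2 * cos t * c (Suc n) - c n))"
    by (simp add: algebra_simps)
  finally have "sin t * spherical (3 - 2 * sqrt 2 * cos t) (Suc (Suc n))
      = (1 / sqrt 2) ^ Suc (Suc n) * (2 * cos t * c (Suc n) - c n)"
    by (rule mult_left_cancel[THEN iffD1, rotated]) simp
  thus ?case unfolding c[symmetric] unfolding c_def .
qed

lemma continuous_spherical [continuous_intros]: "continuous_on A (\<lambda>l. spherical l n)"
  by (induction n rule: induct_nat_012) (auto intro!: continuous_intros)

text \<open>In the variable \<open>t\<close> the integrand is a combination of five functions
  \<open>cos kt / (5 - 4 cos 2t)\<close>. Those with \<open>k\<close> of the parity of \<open>n\<close> contribute for even \<open>n\<close>, the other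
  two for odd \<open>n\<close>. The case \<open>n = 0\<close> stands out because of the inhomogeneous term of
  \<open>fourier_coeff_rec\<close>; it is the mass of the measure, which is 3.\<close>

lemma integral_spherical:
  "(LINT l|spec_measure. spherical l n) = 9 / 2 * ((if n = 0 then 1 else 0) - 1 / 3 * (- 1 / 2) ^ n)"
proof -
  let ?a = fourier_coeff
  let ?q = "\<lambda>k t::real. cos (of_int k * t) / (5 - 4 * cos (2 * t))"
  let ?k = "int n"
  have ptw: "spherical (3 - 2 * sqrt 2 * cos t) n * (36 * (sin t)\<^sup>2 / (pi * (5 - 4 * cos (2 * t))))
    = 36 * (1 / sqrt 2) ^ n / pi * (1 / 2 * ?q ?k t - 1 / 4 * ?q (?k + 2) t - 1 / 4 * ?q (?k - 2) t
        + sqrt 2 / 8 * ?q (?k - 1) t - sqrt 2 / 8 * ?q (?k + 1) t)" for t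
  proof -
    have "spherical (3 - 2 * sqrt 2 * cos t) n * (sin t)\<^sup>2 = sin t * (sin t * spherical (3 - 2 * sqrt 2 * cos t) n)"
      by (simp add: power2_eq_square)
    also have "\<dots> = (1 / sqrt 2) ^ n * (cos (of_int ?k * t) * (sin t)\<^sup>2 + sqrt 2 / 4 * (sin (of_int ?k * t) * sin t))"
      unfolding spherical_trig by (simp add: algebra_simps power2_eq_square)
    also have "sin (of_int ?k * t) * sin t = (cos (of_int (?k - 1) * t) - cos (of_int (?k + 1) * t)) / 2"
      by (simp add: distrib_right left_diff_distrib cos_add cos_diff)
    also have "cos (of_int ?k * t) * (sin t)\<^sup>2
       = cos (of_int ?k * t) / 2 - (cos (of_int (?k + 2) * t) + cos (of_int (?k - 2) * t)) / 4"
    proof -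
      have "cos (of_int (?k + 2) * t) + cos (of_int (?k - 2) * t) = 2 * cos (of_int ?k * t) * cos (2 * t)"
        by (simp add: distrib_right left_diff_distrib cos_add cos_diff)
      moreover have "A + B = 2 * c * (1 - 2 * s) \<Longrightarrow> c * s = c / 2 - (A + B) / 4" for A B c s :: real
        by (simp add: field_simps)
      ultimately show ?thesis unfolding cos_double_sin by blast
    qed
    finally have *: "spherical (3 - 2 * sqrt 2 * cos t) n * (sin t)\<^sup>2 = (1 / sqrt 2) ^ n *
      (cos (of_int ?k * t) / 2 - (cos (of_int (?k + 2) * t) + cos (of_int (?k - 2) * t)) / 4
       + sqrt 2 / 4 * ((cos (of_int (?k - 1) * t) - cos (of_int (?k + 1) * t)) / 2))" .
    have "spherical (3 - 2 * sqrt 2 * cos t) n * (36 * (sin t)\<^sup>2 / (pi * (5 - 4 * cos (2 * t))))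
       = 36 / pi * (spherical (3 - 2 * sqrt 2 * cos t) n * (sin t)\<^sup>2) / (5 - 4 * cos (2 * t))" by simp
    also have "\<dots> = 36 * (1 / sqrt 2) ^ n / pi * (1 / 2 * ?q ?k t - 1 / 4 * ?q (?k + 2) t - 1 / 4 * ?q (?k - 2) t
        + sqrt 2 / 8 * ?q (?k - 1) t - sqrt 2 / 8 * ?q (?k + 1) t)"
    proof -
      have "36 / pi * (r * (A / 2 - (B + C) / 4 + s / 4 * ((D - E) / 2))) / q
        = 36 * r / pi * (1 / 2 * (A / q) - 1 / 4 * (B / q) - 1 / 4 * (C / q) + s / 8 * (D / q) - s / 8 * (E / q))"
        for A B C D E q r s :: real
      proof -
        have "1 / 2 * (A / q) - 1 / 4 * (B / q) - 1 / 4 * (C / q) + s / 8 * (D / q) - s / 8 * (E / q)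
          = (A / 2 - (B + C) / 4 + s / 4 * ((D - E) / 2)) / q"
          by (simp add: add_divide_distrib diff_divide_distrib right_diff_distrib)
        thus ?thesis by simp
      qed
      thus ?thesis unfolding * by blast
    qed
    finally show ?thesis .
  qed
  have q: "(?q k has_integral ?a k) {0..pi}" for k
    unfolding fourier_coeff_def using fourier_integrable by (rule integrable_integral)
  have "((\<lambda>t. 36 * (1 / sqrt 2) ^ n / pi * (1 / 2 * ?q ?k t - 1 / 4 * ?q (?k + 2) t - 1 / 4 * ?q (?k - 2) t
        + sqrt 2 / 8 * ?q (?k - 1) t - sqrt 2 / 8 * ?q (?k + 1) t)) has_integral
     36 * (1 / sqrt 2) ^ n / pi * (1 / 2 * ?a ?k - 1 / 4 * ?a (?k + 2) - 1 / 4 * ?a (?k - 2)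
        + sqrt 2 / 8 * ?a (?k - 1) - sqrt 2 / 8 * ?a (?k + 1))) {0..pi}"
    by (intro has_integral_mult_right has_integral_diff has_integral_add q)
  hence "(LINT l|spec_measure. spherical l n) = 
     36 * (1 / sqrt 2) ^ n / pi * (1 / 2 * ?a ?k - 1 / 4 * ?a (?k + 2) - 1 / 4 * ?a (?k - 2)
        + sqrt 2 / 8 * ?a (?k - 1) - sqrt 2 / 8 * ?a (?k + 1))"
    using integral_spec_measure(2)[OF continuous_spherical[of _ n]] unfolding ptw by (simp only: integral_unique)
  also have "\<dots> = 9 / 2 * ((if n = 0 then 1 else 0) - 1 / 3 * (- 1 / 2) ^ n)"
  proof (cases "even n")
    case True
    then obtain j where j: "n = 2 * j" by blast
    have a1: "?a (?k + 1) = 0" using fourier_coeff_odd[of j] j by simp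
    have a2: "?a (?k - 1) = 0"
    proof (cases j)
      case 0
      thus ?thesis using fourier_coeff_odd[of 0] fourier_coeff_minus[of 1] j by simp
    next
      case (Suc i)
      thus ?thesis using fourier_coeff_odd[of i] j by (simp add: algebra_simps)
    qed
    have a0: "?a ?k = pi / 3 * (1 / 2) ^ j" using fourier_coeff_even[of j] j by simp
    have r: "(1 / sqrt 2) ^ n = (1 / 2) ^ j" unfolding j power_mult by (simp add: power_divide)
    have s: "(- 1 / 2) ^ n = (1 / 2 :: real) ^ j * (1 / 2) ^ j"
      unfolding j by (simp add: power_mult power_mult_distrib[symmetric] power2_eq_square)
    have "1 / 2 * ?a ?k - 1 / 4 * ?a (?k + 2) - 1 / 4 * ?a (?k - 2)
       = - 1 / 8 * ?a ?k + (if n = 0 then pi else 0) / 8"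
      using fourier_coeff_rec[of ?k] by (simp split: if_splits)
    hence "36 * (1 / sqrt 2) ^ n / pi * (1 / 2 * ?a ?k - 1 / 4 * ?a (?k + 2) - 1 / 4 * ?a (?k - 2)
        + sqrt 2 / 8 * ?a (?k - 1) - sqrt 2 / 8 * ?a (?k + 1))
      = 36 * (1 / 2) ^ j / pi * (- 1 / 8 * (pi / 3 * (1 / 2) ^ j) + (if n = 0 then pi else 0) / 8)"
      unfolding a1 a2 r a0 by simp
    also have "\<dots> = 9 / 2 * ((if n = 0 then 1 else 0) - 1 / 3 * ((1 / 2) ^ j * (1 / 2) ^ j))"
      using j by (auto simp: field_simps)
    finally show ?thesis unfolding s .
  next
    case False
    then obtain j where j: "n = 2 * j + 1" by (elim oddE)
    have a0: "?a ?k = 0" using fourier_coeff_odd[of j] j by (simp add: add.commute)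
    have "5 * ?a ?k - 2 * ?a (?k + 2) - 2 * ?a (?k - 2) = 0" using fourier_coeff_rec[of ?k] j by simp
    hence a2: "?a (?k - 2) = - ?a (?k + 2)" using a0 by simp
    have a1: "?a (?k - 1) = pi / 3 * (1 / 2) ^ j" using fourier_coeff_even[of j] j by simp
    have a3: "?a (?k + 1) = pi / 3 * (1 / 2) ^ j / 2"
      using fourier_coeff_even[of "Suc j"] j by (simp add: algebra_simps)
    have r: "(1 / sqrt 2) ^ n = (1 / 2) ^ j / sqrt 2" unfolding j power_add power_mult by (simp add: power_divide)
    have s: "(- 1 / 2) ^ n = - ((1 / 2 :: real) ^ j * (1 / 2) ^ j / 2)"
      unfolding j by (simp add: power_mult power_mult_distrib[symmetric] power2_eq_square)
    have br: "1 / 2 * ?a ?k - 1 / 4 * ?a (?k + 2) - 1 / 4 * ?a (?k - 2)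
        + sqrt 2 / 8 * ?a (?k - 1) - sqrt 2 / 8 * ?a (?k + 1) = sqrt 2 / 8 * (pi / 3 * (1 / 2) ^ j / 2)"
      unfolding a0 a1 a2 a3 by (simp add: field_simps)
    have "36 * (1 / sqrt 2) ^ n / pi * (1 / 2 * ?a ?k - 1 / 4 * ?a (?k + 2) - 1 / 4 * ?a (?k - 2)
        + sqrt 2 / 8 * ?a (?k - 1) - sqrt 2 / 8 * ?a (?k + 1))
      = 36 * ((1 / 2) ^ j / sqrt 2) / pi * (sqrt 2 / 8 * (pi / 3 * (1 / 2) ^ j / 2))"
      unfolding r br by (rule refl)
    also have "\<dots> = 9 / 2 * (0 - 1 / 3 * (- ((1 / 2) ^ j * (1 / 2) ^ j / 2)))"
      by (simp add: field_simps)
    finally show ?thesis unfolding s using j by simp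
  qed
  finally show ?thesis .
qed

section \<open>Orthogonality and the Bessel inequality\<close>

text \<open>The integral for the spectral measure that \<open>-\<Delta>\<close> has at the delta function of a vertex: the
  eigenvalue \<open>6\<close> has mass \<open>1/3\<close>, and \<open>2/9\<close> is the kernel of the generalized projections on the diagonal.\<close>

definition spectral_mean :: "(real \<Rightarrow> real) \<Rightarrow> real" where
  "spectral_mean f = f 6 / 3 + 2 / 9 * (LINT l|spec_measure. f l)"

lemma spectral_mean_sum:
  assumes "\<And>i. i \<in> I \<Longrightarrow> continuous_on UNIV (f i)"
  shows "spectral_mean (\<lambda>l. \<Sum>i\<in>I. a i * f i l) = (\<Sum>i\<in>I. a i * spectral_mean (f i))"
proof -
  have "(LINT l|spec_measure. (\<Sum>i\<in>I. a i * f i l)) = (\<Sum>i\<in>I. a i * (LINT l|spec_measure. f i l))"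
    using integral_spec_measure(1)[OF assms] by (subst Bochner_Integration.integral_sum) auto
  thus ?thesis unfolding spectral_mean_def
    by (simp add: sum.distrib sum_distrib_left sum_divide_distrib distrib_left mult.left_commute)
qed

lemma spectral_mean_add:
  assumes "continuous_on UNIV f" "continuous_on UNIV g"
  shows "spectral_mean (\<lambda>l. a * f l + b * g l) = a * spectral_mean f + b * spectral_mean g"
  using spectral_mean_sum[of "UNIV :: bool set" "\<lambda>i. if i then f else g" "\<lambda>i. if i then a else b"] assms
  by (simp add: UNIV_bool add.commute)

text \<open>The value \<open>(-1/2) ^ n\<close> at the eigenvalue \<open>6\<close> cancels the integral over \<open>\<Sigma>\<close> exactly for \<open>n > 0\<close>.\<close>

lemma spectral_mean_spherical: "spectral_mean (\<lambda>l. spherical l n) = (if n = 0 then 1 else 0)"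
  unfolding spectral_mean_def integral_spherical spherical_at_6 by simp

text \<open>Multiplication by \<open>l\<close> can be expanded by the recursion in either factor. Equating the two
  expansions eliminates \<open>l\<close> and relates the products with indices \<open>(m + 2, n + 1)\<close>,
  \<open>(m + 1, n + 2)\<close>, \<open>(m + 1, n)\<close> and \<open>(m, n + 1)\<close>, so the claim propagates from
  \<open>m = 0\<close>, where it is \<open>spectral_mean_spherical\<close>.\<close>

lemma spectral_mean_orthogonal:
  "spectral_mean (\<lambda>l. spherical l m * spherical l n) = (if m = n then 1 / sphere_size n else 0)"
proof (induction m arbitrary: n rule: induct_nat_012)
  case 0
  show ?case using spectral_mean_spherical[of n] by (auto simp: sphere_size_def)
next
  case 1
  show ?case
  proof (cases n)
    case 0
    thus ?thesis using spectral_mean_spherical[of "Suc 0"] by simp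
  next
    case (Suc k)
    have "spherical l (Suc 0) * spherical l (Suc k)
      = 1 / 4 * (1 * spherical l (Suc k) + 2 * spherical l (Suc (Suc k))) + 1 / 4 * spherical l k" for l
      by (simp add: field_simps)
    hence "spectral_mean (\<lambda>l. spherical l (Suc 0) * spherical l (Suc k))
      = 1 / 4 * (1 * spectral_mean (\<lambda>l. spherical l (Suc k)) + 2 * spectral_mean (\<lambda>l. spherical l (Suc (Suc k))))
        + 1 / 4 * spectral_mean (\<lambda>l. spherical l k)"
      by (simp only: spectral_mean_add continuous_intros)
    thus ?thesis using Suc unfolding spectral_mean_spherical by (auto simp: sphere_size_def)
  qed
next
  case (ge2 m)
  show ?case
  proof (cases n)
    case 0
    thus ?thesis using spectral_mean_spherical[of "Suc (Suc m)"] by simp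
  next
    case (Suc k)
    have "spherical l (Suc (Suc m)) * spherical l (Suc k)
      = 1 * (1 * (spherical l (Suc m) * spherical l (Suc (Suc k))) + 1 / 2 * (spherical l (Suc m) * spherical l k))
        + (- 1 / 2) * (spherical l m * spherical l (Suc k))" for l
      by (simp add: field_simps)
    hence "spectral_mean (\<lambda>l. spherical l (Suc (Suc m)) * spherical l (Suc k))
      = 1 * (1 * spectral_mean (\<lambda>l. spherical l (Suc m) * spherical l (Suc (Suc k)))
          + 1 / 2 * spectral_mean (\<lambda>l. spherical l (Suc m) * spherical l k))
        + (- 1 / 2) * spectral_mean (\<lambda>l. spherical l m * spherical l (Suc k))"
      by (simp only: spectral_mean_add continuous_intros)
    thus ?thesis using Suc unfolding ge2 by (auto simp: sphere_size_def)
  qed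
qed

text \<open>By orthogonality only pairs \<open>(y, z)\<close> with \<open>r y = r z\<close> contribute to the square, each with the
  reciprocal of the size of their sphere. The arithmetic-geometric mean inequality bounds these
  contributions by squares of single coefficients, and since a sphere contributes no more points than its
  size, each square is counted with total weight at most 1.\<close>

lemma bessel_spectral_mean:
  fixes a :: "'a \<Rightarrow> real"
  assumes B: "finite B" and card: "\<And>n. real (card {y \<in> B. r y = n}) \<le> sphere_size n"
  shows "spectral_mean (\<lambda>l. (\<Sum>y\<in>B. a y * spherical l (r y))\<^sup>2) \<le> (\<Sum>y\<in>B. (a y)\<^sup>2)"
proof -
  \<comment> \<open>the Gram matrix of the functions that are summed\<close>
  define G where "G y z = (if r y = r z then 1 / sphere_size (r y) else 0)" for y z
  have Gsym: "G y z = G z y" and Gpos: "G y z \<ge> 0" for y z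
    using sphere_size_pos[of "r y"] by (auto simp: G_def)
  have G: "spectral_mean (\<lambda>l. spherical l (r y) * spherical l (r z)) = G y z" for y z
    unfolding spectral_mean_orthogonal G_def by simp
  have "(\<Sum>y\<in>B. a y * spherical l (r y))\<^sup>2
      = (\<Sum>(y, z)\<in>B \<times> B. (a y * a z) * (spherical l (r y) * spherical l (r z)))" for l
    unfolding power2_eq_square sum_product sum.cartesian_product by (simp add: mult_ac)
  hence "spectral_mean (\<lambda>l. (\<Sum>y\<in>B. a y * spherical l (r y))\<^sup>2)
      = spectral_mean (\<lambda>l. \<Sum>i\<in>B \<times> B. (a (fst i) * a (snd i)) * (spherical l (r (fst i)) * spherical l (r (snd i))))"
    by (simp add: case_prod_beta)
  also have "\<dots> = (\<Sum>i\<in>B \<times> B. (a (fst i) * a (snd i)) * G (fst i) (snd i))"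
    unfolding G[symmetric] by (rule spectral_mean_sum) (intro continuous_intros)
  also have "\<dots> = (\<Sum>y\<in>B. \<Sum>z\<in>B. a y * a z * G y z)"
    by (simp add: sum.cartesian_product case_prod_beta)
  also have "\<dots> \<le> (\<Sum>y\<in>B. \<Sum>z\<in>B. ((a y)\<^sup>2 * G y z + (a z)\<^sup>2 * G y z) / 2)"
  proof (intro sum_mono)
    fix y z
    have "2 * (a y * a z) \<le> (a y)\<^sup>2 + (a z)\<^sup>2" using sum_squares_bound[of "a y" "a z"] by simp
    hence "a y * a z \<le> ((a y)\<^sup>2 + (a z)\<^sup>2) / 2" by simp
    from mult_right_mono[OF this Gpos[of y z]]
    show "a y * a z * G y z \<le> ((a y)\<^sup>2 * G y z + (a z)\<^sup>2 * G y z) / 2"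
      by (simp add: distrib_right)
  qed
  also have "\<dots> = (\<Sum>y\<in>B. \<Sum>z\<in>B. (a y)\<^sup>2 * G y z) / 2 + (\<Sum>y\<in>B. \<Sum>z\<in>B. (a z)\<^sup>2 * G y z) / 2"
    by (simp add: sum.distrib sum_divide_distrib add_divide_distrib)
  also have "(\<Sum>y\<in>B. \<Sum>z\<in>B. (a z)\<^sup>2 * G y z) = (\<Sum>y\<in>B. \<Sum>z\<in>B. (a y)\<^sup>2 * G y z)"
    by (subst sum.swap) (simp add: Gsym)
  also have "(\<Sum>y\<in>B. \<Sum>z\<in>B. (a y)\<^sup>2 * G y z) / 2 + (\<Sum>y\<in>B. \<Sum>z\<in>B. (a y)\<^sup>2 * G y z) / 2
      = (\<Sum>y\<in>B. (a y)\<^sup>2 * (\<Sum>z\<in>B. G y z))"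
    by (simp add: sum_distrib_left)
  also have "\<dots> \<le> (\<Sum>y\<in>B. (a y)\<^sup>2 * 1)"
  proof (intro sum_mono mult_left_mono)
    fix y
    have "(\<Sum>z\<in>B. G y z) = (\<Sum>z | z \<in> B \<and> r z = r y. 1 / sphere_size (r y))"
      unfolding sum.inter_filter[OF B] G_def by (intro sum.cong) auto
    also have "\<dots> = real (card {z \<in> B. r z = r y}) / sphere_size (r y)" by simp
    also have "\<dots> \<le> 1" using card[of "r y"] sphere_size_pos[of "r y"] by (simp add: divide_le_eq_1)
    finally show "(\<Sum>z\<in>B. G y z) \<le> 1" .
  qed auto
  finally show ?thesis by simp
qed

definition spectral_kernel :: "nat \<Rightarrow> real \<Rightarrow> complex" where
  "spectral_kernel n l = 1 / (3 * (6 - of_real l)) * \<psi>_fun (Complex (1/2) (t_of l)) n"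

lemma two_powr_eq_exp: "2 powr z = exp (z * ln 2)" for z :: complex
  by (simp add: powr_def)

text \<open>In the variable \<open>W = 2 powr z\<close> everything is rational: \<open>l = 3 - W - 2 / W\<close>, the map
  \<open>z \<mapsto> 1 - z\<close> is \<open>W \<mapsto> 2 / W\<close>, and \<open>6 - l = (W + 1) (W + 2) / W\<close> cancels against factors of
  \<open>c_tilde\<close>. The conditions on \<open>W\<close> keep the denominators away from zero.\<close>

lemma \<psi>_fun_eq_powers:
  fixes z :: complex
  defines "W \<equiv> 2 powr z"
  assumes W: "W\<^sup>2 \<noteq> 2" "W \<noteq> - 1" "W \<noteq> - 2"
  shows "\<psi>_fun z n / (3 * (6 - (3 - W - 2 / W))) =
    ((1 + W) * (2 - W) * (1 / W) ^ n - (W + 2) * (W - 1) * (W / 2) ^ n) / (9 * (2 - W\<^sup>2))"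
proof -
  have W0: "W \<noteq> 0" by (simp add: W_def)
  have p: "2 powr - z = 1 / W" "2 powr (1 - z) = 2 / W" "2 powr (z - 1) = W / 2"
    "2 powr - (1 - z) = W / 2" "2 powr (1 - z - 1) = 1 / W" "2 powr (1 - (1 - z)) = W"
    by (simp_all add: W_def powr_diff powr_minus field_simps)
  have pn: "2 powr - (of_nat n * z) = (1 / W) ^ n" "2 powr - (of_nat n * (1 - z)) = (W / 2) ^ n"
  proof -
    have e: "2 powr - (of_nat n * u) = (2 powr (- u)) ^ n" for u :: complex
      unfolding two_powr_eq_exp exp_of_nat_mult[symmetric] by (simp add: algebra_simps)
    show "2 powr - (of_nat n * z) = (1 / W) ^ n" "2 powr - (of_nat n * (1 - z)) = (W / 2) ^ n"
      unfolding e p by (rule refl)+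
  qed
  have d: "2 - W\<^sup>2 \<noteq> 0" "W + 1 \<noteq> 0" "W + 2 \<noteq> 0"
    using W by (auto simp: add_eq_0_iff2)
  have d': "1 / W - W / 2 = (2 - W\<^sup>2) / (2 * W)" "W / 2 - 1 / W = - (2 - W\<^sup>2) / (2 * W)"
    using W0 by (simp_all add: field_simps power2_eq_square)
  have six: "6 - (3 - W - 2 / W) = (W + 1) * (W + 2) / W"
    using W0 by (simp add: field_simps)
  have c1: "c_tilde z = (1 + W)\<^sup>2 * (2 - W) * (2 + W) / (3 * W * (2 - W\<^sup>2))"
    unfolding c_tilde_def c_fun_def p d' W_def[symmetric] using W0 d(1)
    by (simp add: field_simps power2_eq_square)
  have c2: "c_tilde (1 - z) = - ((W + 2)\<^sup>2 * (W - 1) * (W + 1) / (3 * W * (2 - W\<^sup>2)))"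
    unfolding c_tilde_def c_fun_def p d' using W0 d(1)
    by (simp add: field_simps power2_eq_square)
  have q: "X / (3 * W * D) * u / (3 * ((W + 1) * (W + 2) / W)) = X / ((W + 1) * (W + 2)) * u / (9 * D)" for X u D
    using W0 by (simp add: field_simps)
  show ?thesis
    unfolding \<psi>_fun_def pn six c1 c2 add_divide_distrib minus_mult_left[symmetric] minus_divide_left[symmetric] q
    using d(2,3) by (simp add: diff_divide_distrib power2_eq_square add.commute)
qed


text \<open>For \<open>z = 1/2 + it\<close> the number \<open>W\<close> is \<open>\<surd>2 exp (i \<theta>)\<close> with \<open>cos \<theta> = (3 - l) / (2 \<surd>2)\<close>. Inside
  \<open>\<Sigma>\<close> the angle lies strictly between \<open>0\<close> and \<open>\<pi>\<close>, so \<open>W\<close> is not real and the exceptional values are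
  avoided.\<close>

lemma two_powr_critical_line:
  assumes l: "3 - 2 * sqrt 2 < l" "l < 3 + 2 * sqrt 2"
  defines "W \<equiv> 2 powr (Complex (1/2) (t_of l))"
  shows "of_real l = 3 - W - 2 / W" "W\<^sup>2 \<noteq> 2" "W \<noteq> - 1" "W \<noteq> - 2"
proof -
  define \<theta> where "\<theta> = arccos ((3 - l) / (2 * sqrt 2))"
  have b: "- 1 < (3 - l) / (2 * sqrt 2)" "(3 - l) / (2 * sqrt 2) < 1"
    using l by (simp_all add: field_simps)
  have c: "cos \<theta> = (3 - l) / (2 * sqrt 2)" using b by (simp add: \<theta>_def)
  have "0 < \<theta>" "\<theta> < pi" using arccos_lt_bounded[OF b] by (auto simp: \<theta>_def)
  hence s: "sin \<theta> > 0" by (rule sin_gt_zero)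
  have "Complex (1/2) (t_of l) * ln 2 = of_real (ln 2 / 2) + \<i> * of_real \<theta>"
    using Ln_of_real[of 2] by (simp add: complex_eq_iff t_of_def \<theta>_def)
  hence "W = exp (of_real (ln 2 / 2)) * cis \<theta>"
    unfolding W_def two_powr_eq_exp by (simp add: exp_add cis_conv_exp)
  moreover have "exp (ln 2 / 2) = sqrt (2::real)"
    by (rule real_sqrt_unique[symmetric]) (simp_all add: power2_eq_square exp_add[symmetric])
  ultimately have W: "W = of_real (sqrt 2) * cis \<theta>" by (simp only: exp_of_real)
  have s2: "complex_of_real (sqrt 2) * of_real (sqrt 2) = 2"
    unfolding of_real_mult[symmetric] by simp
  have W': "2 / W = of_real (sqrt 2) * cis (- \<theta>)"
    unfolding W s2[symmetric] by (simp add: cis_inverse[symmetric] field_simps)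
  show L: "of_real l = 3 - W - 2 / W"
    unfolding W' unfolding W using c by (simp add: complex_eq_iff field_simps)
  show "W\<^sup>2 \<noteq> 2"
  proof
    assume "W\<^sup>2 = 2"
    hence "2 / W = W" by (cases "W = 0") (auto simp: field_simps power2_eq_square)
    hence "Im (2 / W) = Im W" by simp
    thus False unfolding W' unfolding W using s by simp
  qed
  show "W \<noteq> - 1" "W \<noteq> - 2" unfolding W using s by (auto simp: complex_eq_iff)
qed

text \<open>Both \<open>1 / W\<close> and \<open>W / 2\<close> solve \<open>W + 2 / W = 1 / X + 2 X\<close>, so the kernel satisfies the
  recursion of \<open>spherical\<close>; only the values at \<open>n = 0\<close> and \<open>n = 1\<close> have to be compared.\<close>

lemma kernel_eq_spherical:
  assumes l: "3 - 2 * sqrt 2 < l" "l < 3 + 2 * sqrt 2"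
  shows "spectral_kernel n l = of_real (2 / 9 * spherical l n)"
proof -
  define W where "W = 2 powr (Complex (1/2) (t_of l))"
  note W = two_powr_critical_line[OF l, folded W_def]
  have W0: "W \<noteq> 0" by (simp add: W_def)
  have d: "2 - W\<^sup>2 \<noteq> 0" using W(2) by auto
  have k: "spectral_kernel n l = ((1 + W) * (2 - W) * (1 / W) ^ n - (W + 2) * (W - 1) * (W / 2) ^ n) / (9 * (2 - W\<^sup>2))"
    for n
    unfolding spectral_kernel_def W(1) \<psi>_fun_eq_powers[of "Complex (1/2) (t_of l)", folded W_def, OF W(2-4), symmetric]
    by simp
  show ?thesis
  proof (induction n rule: induct_nat_012)
    case 0
    show ?case unfolding k using d by (simp add: field_simps power2_eq_square)
  next
    case 1
    have one: "complex_of_real (2 / 9 * spherical l (Suc 0)) = 2 / 9 * ((4 - (3 - W - 2 / W)) / 4)"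
      unfolding W(1)[symmetric] by simp
    show ?case unfolding k one using d W0 by (simp add: field_simps power2_eq_square)
  next
    case (ge2 n)
    have rec: "(1 / W) ^ Suc (Suc n) = ((W + 2 / W) * (1 / W) ^ Suc n - (1 / W) ^ n) / 2"
      "(W / 2) ^ Suc (Suc n) = ((W + 2 / W) * (W / 2) ^ Suc n - (W / 2) ^ n) / 2"
      using W0 by (simp_all add: field_simps)
    have "spectral_kernel (Suc (Suc n)) l = ((W + 2 / W) * spectral_kernel (Suc n) l - spectral_kernel n l) / 2"
    proof -
      have "(A * ((m * x' - x) / 2) - B * ((m * y' - y) / 2)) / D
          = (m * ((A * x' - B * y') / D) - (A * x - B * y) / D) / 2" for A B m x x' y y' D :: complex
        by (cases "D = 0") (simp_all add: field_simps)
      thus ?thesis unfolding k rec .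
    qed
    also have "W + 2 / W = of_real (3 - l)" by (simp add: W(1))
    finally have "spectral_kernel (Suc (Suc n)) l
        = of_real (((3 - l) * (2 / 9 * spherical l (Suc n)) - 2 / 9 * spherical l n) / 2)"
      unfolding ge2 by simp
    also have "((3 - l) * (2 / 9 * spherical l (Suc n)) - 2 / 9 * spherical l n) / 2 = 2 / 9 * spherical l (Suc (Suc n))"
      by (simp add: field_simps)
    finally show ?case .
  qed
qed

text \<open>Outside \<open>[-1, 1]\<close> the value of \<open>arccos\<close> is an unspecified constant, the same everywhere.\<close>

lemma measurable_arccos [measurable]: "arccos \<in> borel_measurable borel"
proof -
  have "arccos = (\<lambda>y. if y \<in> {-1..1} then indicator {-1..1} y *\<^sub>R arccos y else (THE x. False))"
  proof
    fix y :: real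
    have "arccos y = (THE x. False)" if "y \<notin> {-1..1}"
    proof -
      have "(0 \<le> x \<and> x \<le> pi \<and> cos x = y) = False" for x
        using that cos_le_one[of x] cos_ge_minus_one[of x] by auto
      hence "(\<lambda>x. 0 \<le> x \<and> x \<le> pi \<and> cos x = y) = (\<lambda>x. False)" by (rule ext)
      thus ?thesis unfolding arccos_def by (rule arg_cong)
    qed
    thus "arccos y = (if y \<in> {-1..1} then indicator {-1..1} y *\<^sub>R arccos y else (THE x. False))" by simp
  qed
  moreover have "\<dots> \<in> borel_measurable borel"
    by (intro measurable_If_set borel_measurable_continuous_on_indicator continuous_on_arccos') auto
  ultimately show ?thesis by simp
qed

lemma measurable_kernel [measurable]: "spectral_kernel n \<in> borel_measurable borel"
proof -
  have 1: "(\<lambda>l. Complex (1/2) (t_of l)) = (\<lambda>l. 1 / 2 + \<i> * of_real (arccos ((3 - l) / (2 * sqrt 2)) / ln 2))"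
    by (auto simp: fun_eq_iff complex_eq_iff t_of_def)
  have [measurable]: "(\<lambda>l. Complex (1/2) (t_of l)) \<in> borel_measurable borel"
    unfolding 1 by measurable
  have [measurable]: "(\<lambda>z::complex. 2 powr z) \<in> borel_measurable borel"
    unfolding two_powr_eq_exp by (intro borel_measurable_continuous_onI continuous_intros)
  have "(\<lambda>l. 1 / (3 * (6 - of_real l)) * \<psi>_fun (Complex (1/2) (t_of l)) n) \<in> borel_measurable borel"
    unfolding \<psi>_fun_def c_tilde_def c_fun_def by measurable
  thus ?thesis unfolding spectral_kernel_def[abs_def] .
qed

lemma AE_kernel: "AE l in spec_measure. \<forall>n. spectral_kernel n l = of_real (2 / 9 * spherical l n)"
  using AE_spec_measure_interior by eventually_elim (simp add: kernel_eq_spherical)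

text \<open>This is the resolution of the identity on the level of kernels: the identity has the kernel
  \<open>1\<close> at distance \<open>0\<close>, and the term that is subtracted is the kernel of \<open>P6\<close>.\<close>

lemma integral_kernel:
  "integrable spec_measure (spectral_kernel n)"
  "(LINT l|spec_measure. spectral_kernel n l) = (if n = 0 then 1 else 0) - of_real (1 / 3 * (- 1 / 2) ^ n)"
proof -
  have ae: "AE l in spec_measure. spectral_kernel n l = of_real (2 / 9 * spherical l n)"
    using AE_kernel by eventually_elim auto
  have i: "integrable spec_measure (\<lambda>l. 2 / 9 * spherical l n)"
    by (rule integral_spec_measure) (intro continuous_intros)
  have ii: "integrable spec_measure (\<lambda>l. complex_of_real (2 / 9 * spherical l n))"
    using i by (rule integrable_of_real)
  show "integrable spec_measure (spectral_kernel n)"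
    by (rule integrable_cong_AE_imp[OF ii]) (use ae in auto)
  have "(LINT l|spec_measure. spectral_kernel n l) = (LINT l|spec_measure. complex_of_real (2 / 9 * spherical l n))"
    by (rule integral_cong_AE) (use ae ii in auto)
  also have "\<dots> = of_real (2 / 9 * (LINT l|spec_measure. spherical l n))" 
    by (simp only: integral_complex_of_real integral_mult_right_zero)
  finally show "(LINT l|spec_measure. spectral_kernel n l) = (if n = 0 then 1 else 0) - of_real (1 / 3 * (- 1 / 2) ^ n)"
    unfolding integral_spherical by (simp add: algebra_simps)
qed

text \<open>Real and imaginary parts are treated separately by \<open>bessel_spectral_mean\<close>. The atom at \<open>6\<close>
  contributes a nonnegative term to \<open>spectral_mean\<close> and can be dropped.\<close>

lemma bessel_kernel:
  fixes c :: "'a \<Rightarrow> complex"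
  assumes B: "finite B" and card: "\<And>n. real (card {y \<in> B. r y = n}) \<le> sphere_size n"
  shows "square_integrable spec_measure (\<lambda>l. \<Sum>y\<in>B. spectral_kernel (r y) l * c y)"
    and "(LINT l|spec_measure. (cmod (\<Sum>y\<in>B. spectral_kernel (r y) l * c y))\<^sup>2) \<le> (\<Sum>y\<in>B. (cmod (c y))\<^sup>2)"
proof -
  define S where "S a l = (\<Sum>y\<in>B. a y * spherical l (r y))\<^sup>2" for a l
  let ?g = "\<lambda>l. 4 / 81 * S (Re \<circ> c) l + 4 / 81 * S (Im \<circ> c) l"
  have cont: "continuous_on UNIV (S a)" for a unfolding S_def by (intro continuous_intros)
  have ae: "AE l in spec_measure. (cmod (\<Sum>y\<in>B. spectral_kernel (r y) l * c y))\<^sup>2 = ?g l"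
    using AE_kernel
  proof eventually_elim
    case (elim l)
    have "(\<Sum>y\<in>B. spectral_kernel (r y) l * c y) = (\<Sum>y\<in>B. of_real (2 / 9 * spherical l (r y)) * c y)"
      by (simp only: elim[rule_format])
    also have "\<dots> = 2 / 9 * (\<Sum>y\<in>B. of_real (spherical l (r y)) * c y)"
      by (simp add: sum_distrib_left mult.assoc)
    finally have "(\<Sum>y\<in>B. spectral_kernel (r y) l * c y) = 2 / 9 * (\<Sum>y\<in>B. of_real (spherical l (r y)) * c y)" .
    hence "(cmod (\<Sum>y\<in>B. spectral_kernel (r y) l * c y))\<^sup>2 = (2 / 9)\<^sup>2 * (cmod (\<Sum>y\<in>B. of_real (spherical l (r y)) * c y))\<^sup>2"
      by (simp only: norm_mult power_mult_distrib) (simp add: norm_divide)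
    also have "(cmod (\<Sum>y\<in>B. of_real (spherical l (r y)) * c y))\<^sup>2 = S (Re \<circ> c) l + S (Im \<circ> c) l"
      unfolding cmod_power2 S_def by (simp add: mult.commute)
    finally show ?case by (simp add: power2_eq_square)
  qed
  have ig: "integrable spec_measure ?g"
    by (rule integral_spec_measure) (intro continuous_intros cont)
  have m: "(\<lambda>l. \<Sum>y\<in>B. spectral_kernel (r y) l * c y) \<in> borel_measurable spec_measure" by measurable
  have "integrable spec_measure (\<lambda>l. (cmod (\<Sum>y\<in>B. spectral_kernel (r y) l * c y))\<^sup>2)"
    by (rule integrable_cong_AE_imp[OF ig]) (use ae in auto)
  with m show "square_integrable spec_measure (\<lambda>l. \<Sum>y\<in>B. spectral_kernel (r y) l * c y)"
    unfolding square_integrable_def by blast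
  have S: "2 / 9 * (LINT l|spec_measure. S a l) \<le> (\<Sum>y\<in>B. (a y)\<^sup>2)" for a
  proof -
    have "2 / 9 * (LINT l|spec_measure. S a l) \<le> spectral_mean (S a)"
    proof -
      have "S a 6 \<ge> 0" by (simp add: S_def)
      thus ?thesis unfolding spectral_mean_def by simp
    qed
    also have "\<dots> \<le> (\<Sum>y\<in>B. (a y)\<^sup>2)" unfolding S_def by (rule bessel_spectral_mean[OF B card])
    finally show ?thesis .
  qed
  have "(LINT l|spec_measure. (cmod (\<Sum>y\<in>B. spectral_kernel (r y) l * c y))\<^sup>2) = (LINT l|spec_measure. ?g l)"
    by (rule integral_cong_AE) (use ae ig in auto)
  also have "\<dots> = 2 / 9 * (2 / 9 * (LINT l|spec_measure. S (Re \<circ> c) l)) + 2 / 9 * (2 / 9 * (LINT l|spec_measure. S (Im \<circ> c) l))"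
    using integral_spec_measure(1)[OF cont] by simp
  also have "\<dots> \<le> 2 / 9 * (\<Sum>y\<in>B. ((Re \<circ> c) y)\<^sup>2) + 2 / 9 * (\<Sum>y\<in>B. ((Im \<circ> c) y)\<^sup>2)"
    by (intro add_mono mult_left_mono S) auto
  also have "\<dots> = 2 / 9 * (\<Sum>y\<in>B. (cmod (c y))\<^sup>2)" by (simp add: cmod_power2 sum.distrib distrib_left)
  also have "\<dots> \<le> (\<Sum>y\<in>B. (cmod (c y))\<^sup>2)" using sum_nonneg[of B "\<lambda>y. (cmod (c y))\<^sup>2"] by simp
  finally show "(LINT l|spec_measure. (cmod (\<Sum>y\<in>B. spectral_kernel (r y) l * c y))\<^sup>2) \<le> (\<Sum>y\<in>B. (cmod (c y))\<^sup>2)" .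
qed

section \<open>Square-summable functions\<close>

definition ell2_normsq :: "'a set \<Rightarrow> ('a \<Rightarrow> complex) \<Rightarrow> real" where
  "ell2_normsq A F = (\<Sum>\<^sub>\<infinity>x\<in>A. (cmod (F x))\<^sup>2)"

lemma ell2_normsq_nonneg: "ell2_normsq A F \<ge> 0"
  unfolding ell2_normsq_def by (rule infsum_nonneg) simp

lemma ell2_finite_le:
  "F \<in> ell2 A \<Longrightarrow> finite B \<Longrightarrow> B \<subseteq> A \<Longrightarrow> (\<Sum>x\<in>B. (cmod (F x))\<^sup>2) \<le> ell2_normsq A F"
  unfolding ell2_normsq_def ell2_def by (intro finite_sum_le_infsum) auto

lemma ell2I_bounded:
  assumes "\<And>B. finite B \<Longrightarrow> B \<subseteq> A \<Longrightarrow> (\<Sum>x\<in>B. (cmod (F x))\<^sup>2) \<le> C"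
  shows "F \<in> ell2 A" "ell2_normsq A F \<le> C"
proof -
  have *: "(\<lambda>x. (cmod (F x))\<^sup>2) summable_on A"
    by (rule nonneg_bdd_above_summable_on) (use assms in \<open>auto simp: bdd_above_def\<close>)
  thus "F \<in> ell2 A" by (simp add: ell2_def)
  show "ell2_normsq A F \<le> C"
    unfolding ell2_normsq_def by (rule infsum_le_finite_sums[OF *]) (use assms in auto)
qed

lemma cmod_add_square_le: "(cmod (a + b))\<^sup>2 \<le> 2 * (cmod a)\<^sup>2 + 2 * (cmod b)\<^sup>2"
proof -
  have "(cmod (a + b))\<^sup>2 \<le> (cmod a + cmod b)\<^sup>2"
    by (intro power_mono norm_triangle_ineq) auto
  also have "\<dots> \<le> 2 * (cmod a)\<^sup>2 + 2 * (cmod b)\<^sup>2"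
    using sum_squares_bound[of "cmod a" "cmod b"] by (simp add: power2_sum)
  finally show ?thesis .
qed

lemma ell2_add:
  assumes "F \<in> ell2 A" "G \<in> ell2 A" shows "(\<lambda>x. F x + G x) \<in> ell2 A"
proof (rule ell2I_bounded)
  fix B assume B: "finite B" "B \<subseteq> A"
  have "(\<Sum>x\<in>B. (cmod (F x + G x))\<^sup>2) \<le> (\<Sum>x\<in>B. 2 * (cmod (F x))\<^sup>2 + 2 * (cmod (G x))\<^sup>2)"
    by (rule sum_mono) (rule cmod_add_square_le)
  also have "\<dots> \<le> 2 * ell2_normsq A F + 2 * ell2_normsq A G"
    unfolding sum.distrib sum_distrib_left[symmetric]
    using ell2_finite_le[OF assms(1) B] ell2_finite_le[OF assms(2) B] by simp
  finally show "(\<Sum>x\<in>B. (cmod (F x + G x))\<^sup>2) \<le> 2 * ell2_normsq A F + 2 * ell2_normsq A G" .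
qed

lemma ell2_cmult: "F \<in> ell2 A \<Longrightarrow> (\<lambda>x. F x * c) \<in> ell2 A"
  unfolding ell2_def mem_Collect_eq norm_mult power_mult_distrib by (rule summable_on_cmult_left)

lemma ell2_sum:
  "finite I \<Longrightarrow> (\<And>i. i \<in> I \<Longrightarrow> F i \<in> ell2 A) \<Longrightarrow> (\<lambda>x. \<Sum>i\<in>I. F i x) \<in> ell2 A"
proof (induction I rule: finite_induct)
  case empty
  show ?case by (simp add: ell2_def)
next
  case (insert i I)
  have "F i \<in> ell2 A" "(\<lambda>x. \<Sum>i\<in>I. F i x) \<in> ell2 A" using insert by auto
  from ell2_add[OF this] show ?case using insert.hyps by simp
qed

lemma ell2_cnj: "F \<in> ell2 A \<Longrightarrow> (\<lambda>x. cnj (F x)) \<in> ell2 A"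
  by (simp add: ell2_def)

lemma ell2_product_summable:
  assumes "F \<in> ell2 A" "G \<in> ell2 A" shows "(\<lambda>x. F x * G x) summable_on A"
  using assms unfolding ell2_def mem_Collect_eq power2_eq_square norm_mult[symmetric]
  by (rule abs_summable_summable[OF abs_summable_product])

lemma ell2_inner_summable:
  "F \<in> ell2 A \<Longrightarrow> G \<in> ell2 A \<Longrightarrow> (\<lambda>x. F x * cnj (G x)) summable_on A"
  by (rule ell2_product_summable[OF _ ell2_cnj])

lemma ell2_inner_add_left:
  "F \<in> ell2 A \<Longrightarrow> G \<in> ell2 A \<Longrightarrow> H \<in> ell2 A \<Longrightarrow>
    ell2_inner A (\<lambda>x. F x + G x) H = ell2_inner A F H + ell2_inner A G H"
  unfolding ell2_inner_def distrib_right
  by (rule infsum_add) (simp_all add: ell2_inner_summable)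

lemma tendsto_infsum: 
  "f summable_on A \<Longrightarrow> ((\<lambda>B. \<Sum>x\<in>B. f x) \<longlongrightarrow> infsum f A) (finite_subsets_at_top A)"
  using has_sum_infsum[of f A] unfolding has_sum_def .

lemma infsum_finite_sum:
  fixes f :: "'i \<Rightarrow> 'a \<Rightarrow> complex"
  assumes "finite I" "\<And>i. i \<in> I \<Longrightarrow> f i summable_on A"
  shows "(\<Sum>\<^sub>\<infinity>x\<in>A. \<Sum>i\<in>I. f i x) = (\<Sum>i\<in>I. \<Sum>\<^sub>\<infinity>x\<in>A. f i x)"
proof (rule infsumI)
  show "((\<lambda>x. \<Sum>i\<in>I. f i x) has_sum (\<Sum>i\<in>I. \<Sum>\<^sub>\<infinity>x\<in>A. f i x)) A"
    using assms
  proof (induction I rule: finite_induct)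
    case (insert i I)
    have "((\<lambda>x. f i x + (\<Sum>i\<in>I. f i x)) has_sum (infsum (f i) A + (\<Sum>i\<in>I. \<Sum>\<^sub>\<infinity>x\<in>A. f i x))) A"
      using insert by (intro has_sum_add has_sum_infsum) auto
    thus ?case using insert.hyps by simp
  qed simp
qed

lemma ell2_Cauchy_Schwarz:
  assumes F: "F \<in> ell2 A" and G: "G \<in> ell2 A"
  shows "(cmod (ell2_inner A F G))\<^sup>2 \<le> ell2_normsq A F * ell2_normsq A G"
proof -
  have "((\<lambda>B. cmod (\<Sum>x\<in>B. F x * cnj (G x))) \<longlongrightarrow> cmod (ell2_inner A F G)) (finite_subsets_at_top A)"
    unfolding ell2_inner_def by (intro tendsto_norm tendsto_infsum ell2_inner_summable F G)
  moreover have "\<forall>\<^sub>F B in finite_subsets_at_top A.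
      cmod (\<Sum>x\<in>B. F x * cnj (G x)) \<le> sqrt (ell2_normsq A F) * sqrt (ell2_normsq A G)"
  proof (rule eventually_finite_subsets_at_top_weakI)
    fix B assume B: "finite B" "B \<subseteq> A"
    have "cmod (\<Sum>x\<in>B. F x * cnj (G x)) \<le> (\<Sum>x\<in>B. \<bar>cmod (F x)\<bar> * \<bar>cmod (G x)\<bar>)"
      by (rule order_trans[OF norm_sum]) (simp add: norm_mult)
    also have "\<dots> \<le> L2_set (\<lambda>x. cmod (F x)) B * L2_set (\<lambda>x. cmod (G x)) B"
      by (rule L2_set_mult_ineq)
    also have "\<dots> \<le> sqrt (ell2_normsq A F) * sqrt (ell2_normsq A G)"
      unfolding L2_set_def using ell2_finite_le[OF F B] ell2_finite_le[OF G B]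
      by (intro mult_mono) (auto intro: sum_nonneg ell2_normsq_nonneg)
    finally show "cmod (\<Sum>x\<in>B. F x * cnj (G x)) \<le> \<dots>" .
  qed
  ultimately have "cmod (ell2_inner A F G) \<le> sqrt (ell2_normsq A F) * sqrt (ell2_normsq A G)"
    by (rule tendsto_upperbound) simp
  hence "(cmod (ell2_inner A F G))\<^sup>2 \<le> (sqrt (ell2_normsq A F) * sqrt (ell2_normsq A G))\<^sup>2"
    by (intro power_mono) auto
  thus ?thesis by (simp add: power_mult_distrib ell2_normsq_nonneg)
qed

section \<open>The orthogonal projection onto the eigenvalue 6\<close>

context cubic_tree
begin

definition K6 :: "'v set \<Rightarrow> 'v set \<Rightarrow> complex" where
  "K6 x y = (1/3) * (- (1/2)) ^ d x y"

lemma K6_spherical: "K6 x y = 1 / 3 * of_real (spherical 6 (d x y))"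
  unfolding K6_def spherical_at_6 by simp

lemma cmod_K6_sq: "(cmod (K6 x y))\<^sup>2 = 1 / 9 * (1 / 4) ^ d x y"
proof -
  have "cmod (K6 x y) = 1 / 3 * (1 / 2) ^ d x y"
    by (simp add: K6_def norm_mult norm_power norm_divide)
  moreover have "((1 / 2 :: real) ^ n)\<^sup>2 = (1 / 4) ^ n" for n
  proof -
    have "((1 / 2 :: real) ^ n)\<^sup>2 = ((1 / 2)\<^sup>2) ^ n" by (simp only: power_mult[symmetric] mult.commute)
    thus ?thesis by (simp add: power2_eq_square)
  qed
  ultimately show ?thesis by (simp only: power_mult_distrib) (simp add: power2_eq_square)
qed

lemma K6_commute: "K6 x y = K6 y x"
  unfolding K6_def dist_commute[of x y] ..

lemma P6_eq: "P6 E F x = (\<Sum>\<^sub>\<infinity>y\<in>E. K6 x y * F y)"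
  unfolding P6_def K6_def ..

lemma sphere_weights_sum: "(\<Sum>k\<le>n. sphere_size k * (1 / 4) ^ k) = 3 - 2 * (1 / 2) ^ n"
proof (induction n)
  case (Suc n)
  have "(1 / 4 :: real) ^ Suc n = (1 / 2 * (1 / 2)) ^ Suc n" by simp
  also have "\<dots> = (1 / 2) ^ Suc n * (1 / 2) ^ Suc n" by (rule power_mult_distrib)
  finally have "sphere_size (Suc n) * (1 / 4) ^ Suc n = 2 * (2 ^ Suc n * (1 / 2) ^ Suc n) * (1 / 2) ^ Suc n"
    by (simp only: sphere_size_def) simp
  also have "2 ^ Suc n * (1 / 2 :: real) ^ Suc n = 1" by (simp only: power_mult_distrib[symmetric]) simp
  finally show ?case using Suc by simp
qed (simp add: sphere_size_def)

text \<open>The squares of the kernel decay like \<open>4 ^ (-n)\<close>, the spheres grow like \<open>2 ^ n\<close>.\<close>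

lemma K6_ell2: assumes x: "x \<in> E" shows "K6 x \<in> ell2 E"
proof (rule ell2I_bounded)
  fix B assume B: "finite B" "B \<subseteq> E"
  have "\<forall>\<^sub>F n in sequentially. finite (ball_about x n) \<and> B \<subseteq> ball_about x n \<and> ball_about x n \<subseteq> E"
    by (rule filterlim_ball_about[OF x, unfolded filterlim_finite_subsets_at_top, rule_format]) (use B in simp)
  hence "\<exists>n. finite (ball_about x n) \<and> B \<subseteq> ball_about x n \<and> ball_about x n \<subseteq> E"
    by (rule eventually_happens'[OF sequentially_bot])
  then obtain n where n: "B \<subseteq> ball_about x n" by (elim exE conjE)
  have "(\<Sum>y\<in>B. (cmod (K6 x y))\<^sup>2) \<le> (\<Sum>y\<in>ball_about x n. (cmod (K6 x y))\<^sup>2)"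
    using n finite_ball_about[OF x] by (intro sum_mono2) auto
  also have "\<dots> = (\<Sum>k\<le>n. \<Sum>y\<in>sphere_about x k. 1 / 9 * (1 / 4) ^ k)"
    unfolding sum_ball_about[OF x] cmod_K6_sq by (intro sum.cong) (auto simp: sphere_about_def)
  also have "\<dots> = 1 / 9 * (\<Sum>k\<le>n. sphere_size k * (1 / 4) ^ k)"
    by (simp add: card_sphere_about[OF x] sum_divide_distrib)
  also have "\<dots> \<le> 1 / 3" unfolding sphere_weights_sum by simp
  finally show "(\<Sum>y\<in>B. (cmod (K6 x y))\<^sup>2) \<le> 1 / 3" .
qed

lemma K6_ell2': "y \<in> E \<Longrightarrow> (\<lambda>x. K6 x y) \<in> ell2 E"
proof -
  assume "y \<in> E"
  moreover have "(\<lambda>x. K6 x y) = K6 y" by (rule ext, rule K6_commute)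
  ultimately show ?thesis using K6_ell2 by simp
qed

definition eigenspace6 :: "('v set \<Rightarrow> complex) set" where
  "eigenspace6 = {G \<in> ell2 E. eigenfunction E 6 G}"

text \<open>Summed over balls about \<open>x\<close>, the series becomes a sum over radii of kernel value times sphere sum
  of \<open>H\<close>. The sphere sum is again a multiple of \<open>(-1/2) ^ n * H x\<close>, and the resulting geometric series
  has sum 1.\<close>

lemma K6_reproducing:
  assumes H: "H \<in> eigenspace6" and x: "x \<in> E"
  shows "(\<Sum>\<^sub>\<infinity>y\<in>E. K6 x y * H y) = H x"
proof -
  have H': "H \<in> ell2 E" "eigenfunction E 6 H" using H by (auto simp: eigenspace6_def)
  have "((\<lambda>n. \<Sum>y\<in>ball_about x n. K6 x y * H y) \<longlonglongrightarrow> (\<Sum>\<^sub>\<infinity>y\<in>E. K6 x y * H y))"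
    by (rule filterlim_compose[OF tendsto_infsum filterlim_ball_about[OF x]])
      (intro ell2_product_summable K6_ell2 x H')
  moreover have "(\<Sum>y\<in>ball_about x n. K6 x y * H y) = of_real (1 - 2 / 3 * (1 / 2) ^ n) * H x" for n
  proof -
    have "(\<Sum>y\<in>ball_about x n. K6 x y * H y)
        = (\<Sum>k\<le>n. \<Sum>y\<in>sphere_about x k. of_real (1 / 3 * spherical 6 k) * H y)"
      unfolding sum_ball_about[OF x] K6_spherical by (intro sum.cong) (auto simp: sphere_about_def)
    also have "\<dots> = (\<Sum>k\<le>n. of_real (1 / 3 * (sphere_size k * (1 / 4) ^ k)) * H x)"
    proof (rule sum.cong[OF refl])
      fix k
      have "spherical 6 k * spherical 6 k = (1 / 4) ^ k"
        unfolding spherical_at_6 by (simp only: power_mult_distrib[symmetric]) simp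
      hence "1 / 3 * spherical 6 k * (sphere_size k * spherical 6 k) = 1 / 3 * (sphere_size k * (1 / 4) ^ k)"
        by simp
      thus "(\<Sum>y\<in>sphere_about x k. of_real (1 / 3 * spherical 6 k) * H y)
          = of_real (1 / 3 * (sphere_size k * (1 / 4) ^ k)) * H x"
        unfolding sum_distrib_left[symmetric] sphere_sum_eigenfunction[OF H'(2) x]
        by (metis mult.assoc of_real_mult)
    qed
    also have "\<dots> = of_real (1 / 3 * (\<Sum>k\<le>n. sphere_size k * (1 / 4) ^ k)) * H x"
      by (simp only: of_real_sum sum_distrib_left sum_distrib_right)
    finally show ?thesis unfolding sphere_weights_sum by (simp add: right_diff_distrib)
  qed
  moreover have "(\<lambda>n. complex_of_real (1 - 2 / 3 * (1 / 2) ^ n) * H x) \<longlonglongrightarrow> of_real (1 - 2 / 3 * 0) * H x"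
    by (intro tendsto_intros LIMSEQ_realpow_zero) auto
  ultimately show ?thesis using LIMSEQ_unique by force
qed

text \<open>The action of \<open>P6\<close> on the restriction of \<open>F\<close> to \<open>B\<close>, as a finite sum.\<close>

definition K6_on :: "'v set set \<Rightarrow> ('v set \<Rightarrow> complex) \<Rightarrow> 'v set \<Rightarrow> complex" where
  "K6_on B F x = (\<Sum>y\<in>B. K6 x y * F y)"

lemma eigenfunction_sum:
  assumes "\<And>i. i \<in> I \<Longrightarrow> eigenfunction E l (H i)"
  shows "eigenfunction E l (\<lambda>x. \<Sum>i\<in>I. H i x * c i)"
  unfolding eigenfunction_iff
proof
  fix x assume x: "x \<in> E"
  have "(\<Sum>y\<in>nbrs x. \<Sum>i\<in>I. H i y * c i) = (\<Sum>i\<in>I. (\<Sum>y\<in>nbrs x. H i y) * c i)"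
    by (subst sum.swap) (simp add: sum_distrib_right)
  also have "\<dots> = (\<Sum>i\<in>I. (4 - of_real l) * H i x * c i)"
    using assms x unfolding eigenfunction_iff by (intro sum.cong) auto
  finally show "(\<Sum>y\<in>nbrs x. \<Sum>i\<in>I. H i y * c i) = (4 - of_real l) * (\<Sum>i\<in>I. H i x * c i)"
    by (simp add: sum_distrib_left mult.assoc)
qed

lemma K6_eigenfunction: "y \<in> E \<Longrightarrow> eigenfunction E 6 (\<lambda>x. K6 x y)"
  using eigenfunction_radial[of y 6]
  unfolding eigenfunction_iff K6_spherical sum_distrib_left[symmetric] by (simp add: mult.left_commute)

lemma K6_on_eigenspace6:
  assumes B: "finite B" "B \<subseteq> E" shows "K6_on B F \<in> eigenspace6"
proof -
  have "(\<lambda>x. \<Sum>y\<in>B. K6 x y * F y) \<in> ell2 E"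
    using B(2) by (intro ell2_sum[OF B(1)] ell2_cmult K6_ell2') auto
  moreover have "eigenfunction E 6 (\<lambda>x. \<Sum>y\<in>B. K6 x y * F y)"
    using B(2) by (intro eigenfunction_sum K6_eigenfunction) auto
  ultimately show ?thesis unfolding eigenspace6_def K6_on_def[abs_def] by simp
qed

text \<open>Move the operator to \<open>H\<close>, by symmetry of the kernel, and apply \<open>K6_reproducing\<close>.\<close>

lemma K6_on_inner:
  assumes B: "finite B" "B \<subseteq> E" and H: "H \<in> eigenspace6"
  shows "ell2_inner E (K6_on B F) H = (\<Sum>y\<in>B. F y * cnj (H y))"
proof -
  have H': "H \<in> ell2 E" using H by (auto simp: eigenspace6_def)
  have "ell2_inner E (K6_on B F) H = (\<Sum>\<^sub>\<infinity>x\<in>E. \<Sum>y\<in>B. F y * (K6 x y * cnj (H x)))"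
    unfolding ell2_inner_def K6_on_def by (simp add: sum_distrib_right sum_distrib_left mult_ac)
  also have "\<dots> = (\<Sum>y\<in>B. \<Sum>\<^sub>\<infinity>x\<in>E. F y * (K6 x y * cnj (H x)))"
    using B K6_ell2' H'
    by (intro infsum_finite_sum summable_on_cmult_right ell2_inner_summable[OF _ H']) auto
  also have "\<dots> = (\<Sum>y\<in>B. F y * cnj (H y))"
  proof (rule sum.cong[OF refl])
    fix y assume "y \<in> B"
    hence y: "y \<in> E" using B by auto
    have "(\<Sum>\<^sub>\<infinity>x\<in>E. F y * (K6 x y * cnj (H x))) = F y * (\<Sum>\<^sub>\<infinity>x\<in>E. K6 x y * cnj (H x))"
      using K6_ell2'[OF y] H' by (intro infsum_cmult_right) (auto intro: ell2_inner_summable)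
    also have "(\<Sum>\<^sub>\<infinity>x\<in>E. K6 x y * cnj (H x)) = (\<Sum>\<^sub>\<infinity>x\<in>E. cnj (K6 y x * H x))"
      by (rule infsum_cong) (simp add: K6_commute[of _ y], simp add: K6_def)
    also have "\<dots> = cnj (H y)" unfolding infsum_cnj K6_reproducing[OF H y] ..
    finally show "(\<Sum>\<^sub>\<infinity>x\<in>E. F y * (K6 x y * cnj (H x))) = F y * cnj (H y)" .
  qed
  finally show ?thesis .
qed

lemma ell2_inner_self: "F \<in> ell2 A \<Longrightarrow> ell2_inner A F F = of_real (ell2_normsq A F)"
  unfolding ell2_inner_def ell2_normsq_def complex_norm_square[symmetric] ell2_def
  by (intro infsumI has_sum_of_real has_sum_infsum) simp

text \<open>Since \<open>K6_on B F\<close> is itself in the eigenspace, \<open>K6_on_inner\<close> expresses its squared norm as an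
  inner product with \<open>F\<close> over \<open>B\<close>, and the Cauchy-Schwarz inequality bounds this by the norm of \<open>F\<close> on
  \<open>B\<close> times the norm itself.\<close>

lemma K6_on_bound:
  assumes B: "finite B" "B \<subseteq> E"
  shows "ell2_normsq E (K6_on B F) \<le> (\<Sum>y\<in>B. (cmod (F y))\<^sup>2)"
proof -
  let ?G = "K6_on B F"
  let ?n = "ell2_normsq E ?G"
  have G: "?G \<in> eigenspace6" "?G \<in> ell2 E"
    using K6_on_eigenspace6[OF B] by (auto simp: eigenspace6_def)
  have "complex_of_real ?n = (\<Sum>y\<in>B. F y * cnj (?G y))"
    unfolding ell2_inner_self[OF G(2), symmetric] by (rule K6_on_inner[OF B G(1)])
  hence "?n = cmod (\<Sum>y\<in>B. F y * cnj (?G y))"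
    using ell2_normsq_nonneg[of E ?G] by (metis abs_of_nonneg norm_of_real)
  also have "\<dots> \<le> (\<Sum>y\<in>B. \<bar>cmod (F y)\<bar> * \<bar>cmod (?G y)\<bar>)"
    by (rule order_trans[OF norm_sum]) (simp add: norm_mult)
  also have "\<dots> \<le> L2_set (\<lambda>y. cmod (F y)) B * L2_set (\<lambda>y. cmod (?G y)) B"
    by (rule L2_set_mult_ineq)
  also have "\<dots> \<le> L2_set (\<lambda>y. cmod (F y)) B * sqrt ?n"
    unfolding L2_set_def using ell2_finite_le[OF G(2) B] by (intro mult_left_mono) (auto intro: sum_nonneg)
  finally have *: "?n \<le> L2_set (\<lambda>y. cmod (F y)) B * sqrt ?n" .
  have "sqrt ?n \<le> L2_set (\<lambda>y. cmod (F y)) B"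
  proof (cases "?n = 0")
    case False
    hence "sqrt ?n > 0" using ell2_normsq_nonneg[of E ?G] by simp
    moreover have "sqrt ?n * sqrt ?n = ?n" using ell2_normsq_nonneg[of E ?G] by simp
    ultimately show ?thesis using * by (metis mult_le_cancel_right_pos)
  qed (simp add: L2_set_nonneg)
  hence "(sqrt ?n)\<^sup>2 \<le> (L2_set (\<lambda>y. cmod (F y)) B)\<^sup>2"
    by (intro power_mono) (auto simp: ell2_normsq_nonneg)
  thus ?thesis by (simp add: L2_set_def ell2_normsq_nonneg sum_nonneg)
qed

lemma P6_summable: "F \<in> ell2 E \<Longrightarrow> x \<in> E \<Longrightarrow> (\<lambda>y. K6 x y * F y) summable_on E"
  by (intro ell2_product_summable K6_ell2)

text \<open>On a finite set of points, \<open>P6 E F\<close> is the pointwise limit of the contractions of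
  \<open>K6_on_bound\<close>.\<close>

lemma P6_bound:
  assumes F: "F \<in> ell2 E"
  shows "P6 E F \<in> ell2 E" "ell2_normsq E (P6 E F) \<le> ell2_normsq E F"
proof -
  have "(\<Sum>x\<in>A. (cmod (P6 E F x))\<^sup>2) \<le> ell2_normsq E F" if A: "finite A" "A \<subseteq> E" for A
  proof (rule tendsto_upperbound)
    show "((\<lambda>B. \<Sum>x\<in>A. (cmod (K6_on B F x))\<^sup>2) \<longlongrightarrow> (\<Sum>x\<in>A. (cmod (P6 E F x))\<^sup>2)) (finite_subsets_at_top E)"
      unfolding P6_eq K6_on_def using A F
      by (intro tendsto_sum tendsto_power tendsto_norm tendsto_infsum P6_summable) auto
    show "\<forall>\<^sub>F B in finite_subsets_at_top E. (\<Sum>x\<in>A. (cmod (K6_on B F x))\<^sup>2) \<le> ell2_normsq E F"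
    proof (rule eventually_finite_subsets_at_top_weakI)
      fix B assume B: "finite B" "B \<subseteq> E"
      have "(\<Sum>x\<in>A. (cmod (K6_on B F x))\<^sup>2) \<le> ell2_normsq E (K6_on B F)"
        using K6_on_eigenspace6[OF B] A by (intro ell2_finite_le) (auto simp: eigenspace6_def)
      also have "\<dots> \<le> (\<Sum>y\<in>B. (cmod (F y))\<^sup>2)" by (rule K6_on_bound[OF B])
      also have "\<dots> \<le> ell2_normsq E F" by (rule ell2_finite_le[OF F B])
      finally show "(\<Sum>x\<in>A. (cmod (K6_on B F x))\<^sup>2) \<le> ell2_normsq E F" .
    qed
  qed auto
  from ell2I_bounded[OF this] show "P6 E F \<in> ell2 E" "ell2_normsq E (P6 E F) \<le> ell2_normsq E F" by auto
qed

lemma P6_eigenspace6: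
  assumes F: "F \<in> ell2 E" shows "P6 E F \<in> eigenspace6"
proof -
  have "eigenfunction E 6 (P6 E F)"
    unfolding eigenfunction_iff
  proof
    fix x assume x: "x \<in> E"
    have "(\<Sum>z\<in>nbrs x. P6 E F z) = (\<Sum>\<^sub>\<infinity>y\<in>E. \<Sum>z\<in>nbrs x. K6 z y * F y)"
      unfolding P6_eq using nbrs_subset x finite_nbrs F by (intro infsum_finite_sum[symmetric] P6_summable) auto
    also have "\<dots> = (\<Sum>\<^sub>\<infinity>y\<in>E. (4 - of_real 6) * (K6 x y * F y))"
    proof (rule infsum_cong)
      fix y assume "y \<in> E"
      hence "(\<Sum>z\<in>nbrs x. K6 z y) = (4 - of_real 6) * K6 x y"
        using K6_eigenfunction x unfolding eigenfunction_iff by blast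
      thus "(\<Sum>z\<in>nbrs x. K6 z y * F y) = (4 - of_real 6) * (K6 x y * F y)"
        by (simp add: sum_distrib_right[symmetric])
    qed
    also have "\<dots> = (4 - of_real 6) * P6 E F x"
      unfolding P6_eq using P6_summable[OF F x] by (intro infsum_cmult_right) auto
    finally show "(\<Sum>z\<in>nbrs x. P6 E F z) = (4 - of_real 6) * P6 E F x" .
  qed
  thus ?thesis unfolding eigenspace6_def using P6_bound(1)[OF F] by simp
qed

text \<open>For finitely supported functions this is \<open>K6_on_inner\<close>. The remainder \<open>R B\<close> of \<open>F\<close> outside \<open>B\<close>
  tends to zero in norm, and \<open>P6\<close> is a contraction, so the identity passes to the limit.\<close>

lemma P6_symmetric:
  assumes F: "F \<in> ell2 E" and H: "H \<in> eigenspace6"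
  shows "ell2_inner E (P6 E F) H = ell2_inner E F H"
proof -
  have H': "H \<in> ell2 E" using H by (auto simp: eigenspace6_def)
  \<comment> \<open>the part of \<open>F\<close> outside \<open>B\<close>\<close>
  define R where "R B y = (if y \<in> B then 0 else F y)" for B y
  have R: "R B \<in> ell2 E" for B
    by (rule ell2I_bounded[of _ _ "ell2_normsq E F"], rule order_trans[OF sum_mono ell2_finite_le[OF F]])
      (auto simp: R_def)
  have Rn: "ell2_normsq E (R B) = ell2_normsq E F - (\<Sum>y\<in>B. (cmod (F y))\<^sup>2)" if B: "finite B" "B \<subseteq> E" for B
  proof -
    have "ell2_normsq E (R B) = (\<Sum>\<^sub>\<infinity>y\<in>E - B. (cmod (F y))\<^sup>2)"
      unfolding ell2_normsq_def by (rule infsum_cong_neutral) (auto simp: R_def)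
    thus ?thesis using F B by (subst (asm) infsum_Diff) (auto simp: ell2_normsq_def ell2_def)
  qed
  have split: "ell2_inner E (P6 E F) H = (\<Sum>y\<in>B. F y * cnj (H y)) + ell2_inner E (P6 E (R B)) H"
    if B: "finite B" "B \<subseteq> E" for B
  proof -
    have "P6 E F x = K6_on B F x + P6 E (R B) x" if x: "x \<in> E" for x
    proof -
      have "K6_on B F x = (\<Sum>\<^sub>\<infinity>y\<in>B. K6 x y * F y)" using B by (simp add: K6_on_def)
      moreover have "P6 E (R B) x = (\<Sum>\<^sub>\<infinity>y\<in>E - B. K6 x y * F y)"
        unfolding P6_eq by (rule infsum_cong_neutral) (auto simp: R_def)
      moreover have "(\<Sum>\<^sub>\<infinity>y\<in>E - B. K6 x y * F y) = P6 E F x - (\<Sum>\<^sub>\<infinity>y\<in>B. K6 x y * F y)"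
        unfolding P6_eq using P6_summable[OF F x] B by (intro infsum_Diff) auto
      ultimately show ?thesis by simp
    qed
    hence "ell2_inner E (P6 E F) H = ell2_inner E (\<lambda>x. K6_on B F x + P6 E (R B) x) H"
      unfolding ell2_inner_def by (intro infsum_cong) auto
    also have "\<dots> = ell2_inner E (K6_on B F) H + ell2_inner E (P6 E (R B)) H"
      using K6_on_eigenspace6[OF B] P6_bound(1)[OF R] H'
      by (intro ell2_inner_add_left) (auto simp: eigenspace6_def)
    finally show ?thesis unfolding K6_on_inner[OF B H] .
  qed
  have "((\<lambda>B. (ell2_normsq E F - (\<Sum>y\<in>B. (cmod (F y))\<^sup>2)) * ell2_normsq E H) \<longlongrightarrow>
      (ell2_normsq E F - ell2_normsq E F) * ell2_normsq E H) (finite_subsets_at_top E)"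
    unfolding ell2_normsq_def using F by (intro tendsto_intros tendsto_infsum) (auto simp: ell2_def)
  hence "((\<lambda>B. (cmod (ell2_inner E (P6 E (R B)) H))\<^sup>2) \<longlongrightarrow> 0) (finite_subsets_at_top E)"
  proof (rule Lim_null_comparison[rotated, OF tendsto_eq_rhs])
    show "\<forall>\<^sub>F B in finite_subsets_at_top E. norm ((cmod (ell2_inner E (P6 E (R B)) H))\<^sup>2)
        \<le> (ell2_normsq E F - (\<Sum>y\<in>B. (cmod (F y))\<^sup>2)) * ell2_normsq E H"
    proof (rule eventually_finite_subsets_at_top_weakI)
      fix B assume B: "finite B" "B \<subseteq> E"
      have "(cmod (ell2_inner E (P6 E (R B)) H))\<^sup>2 \<le> ell2_normsq E (P6 E (R B)) * ell2_normsq E H"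
        by (rule ell2_Cauchy_Schwarz[OF P6_bound(1)[OF R] H'])
      also have "\<dots> \<le> ell2_normsq E (R B) * ell2_normsq E H"
        by (intro mult_right_mono P6_bound(2) R ell2_normsq_nonneg)
      finally show "norm ((cmod (ell2_inner E (P6 E (R B)) H))\<^sup>2)
        \<le> (ell2_normsq E F - (\<Sum>y\<in>B. (cmod (F y))\<^sup>2)) * ell2_normsq E H" unfolding Rn[OF B] by simp
    qed
  qed simp
  hence "((\<lambda>B. ell2_inner E (P6 E (R B)) H) \<longlongrightarrow> 0) (finite_subsets_at_top E)"
    by (simp add: tendsto_norm_zero_iff)
  moreover have "((\<lambda>B. \<Sum>y\<in>B. F y * cnj (H y)) \<longlongrightarrow> ell2_inner E F H) (finite_subsets_at_top E)"
    unfolding ell2_inner_def by (intro tendsto_infsum ell2_inner_summable F H')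
  ultimately have "((\<lambda>B. (\<Sum>y\<in>B. F y * cnj (H y)) + ell2_inner E (P6 E (R B)) H) \<longlongrightarrow> ell2_inner E F H + 0)
      (finite_subsets_at_top E)" by (intro tendsto_add)
  moreover have "\<forall>\<^sub>F B in finite_subsets_at_top E.
      (\<Sum>y\<in>B. F y * cnj (H y)) + ell2_inner E (P6 E (R B)) H = ell2_inner E (P6 E F) H"
    by (rule eventually_finite_subsets_at_top_weakI) (simp only: split)
  ultimately have "((\<lambda>B. ell2_inner E (P6 E F) H) \<longlongrightarrow> ell2_inner E F H + 0) (finite_subsets_at_top E)"
    by (rule Lim_transform_eventually)
  thus ?thesis by (simp add: tendsto_const_iff)
qed

theorem P6_orthogonal_projection:
  assumes F: "F \<in> ell2 E"
  shows "is_orthogonal_projection E eigenspace6 F (P6 E F)"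
  unfolding is_orthogonal_projection_def
proof (intro conjI ballI P6_eigenspace6 F)
  fix H assume H: "H \<in> eigenspace6"
  have "ell2_inner E (\<lambda>x. (F x - P6 E F x) + P6 E F x) H
      = ell2_inner E (\<lambda>x. F x - P6 E F x) H + ell2_inner E (P6 E F) H"
    using ell2_add[OF F ell2_cmult[OF P6_bound(1)[OF F], of "-1"]] P6_bound(1)[OF F] H
    by (intro ell2_inner_add_left) (auto simp: eigenspace6_def)
  thus "ell2_inner E (\<lambda>x. F x - P6 E F x) H = 0" using P6_symmetric[OF F H] by simp
qed

end

section \<open>Unconditional convergence in the mean square\<close>

definition L2_normsq :: "'b measure \<Rightarrow> ('b \<Rightarrow> complex) \<Rightarrow> real" where
  "L2_normsq M f = (LINT l|M. (cmod (f l))\<^sup>2)"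

lemma L2_normsq_nonneg: "L2_normsq M f \<ge> 0"
  unfolding L2_normsq_def by (rule integral_nonneg_AE) simp

lemma square_integrableD:
  assumes "square_integrable M f"
  shows "f \<in> borel_measurable M" "integrable M (\<lambda>l. (cmod (f l))\<^sup>2)"
  using assms by (auto simp: square_integrable_def)

lemma square_integrable_add:
  assumes f: "square_integrable M f" and g: "square_integrable M g"
  shows "square_integrable M (\<lambda>l. f l + g l)"
    and "L2_normsq M (\<lambda>l. f l + g l) \<le> 2 * L2_normsq M f + 2 * L2_normsq M g"
proof -
  note [measurable] = square_integrableD(1)[OF f] square_integrableD(1)[OF g]
  have i: "integrable M (\<lambda>l. 2 * (cmod (f l))\<^sup>2 + 2 * (cmod (g l))\<^sup>2)"
    using square_integrableD(2)[OF f] square_integrableD(2)[OF g] by auto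
  have j: "integrable M (\<lambda>l. (cmod (f l + g l))\<^sup>2)"
    by (rule Bochner_Integration.integrable_bound[OF i]) (auto simp: cmod_add_square_le)
  thus "square_integrable M (\<lambda>l. f l + g l)" by (simp add: square_integrable_def)
  have "L2_normsq M (\<lambda>l. f l + g l) \<le> (LINT l|M. 2 * (cmod (f l))\<^sup>2 + 2 * (cmod (g l))\<^sup>2)"
    unfolding L2_normsq_def by (rule integral_mono[OF j i]) (rule cmod_add_square_le)
  also have "\<dots> = 2 * L2_normsq M f + 2 * L2_normsq M g"
    unfolding L2_normsq_def using square_integrableD(2)[OF f] square_integrableD(2)[OF g] by simp
  finally show "L2_normsq M (\<lambda>l. f l + g l) \<le> 2 * L2_normsq M f + 2 * L2_normsq M g" .
qed

lemma square_integrable_mult_bounded: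
  assumes f: "square_integrable M f" and h: "h \<in> borel_measurable M" and C: "AE l in M. cmod (h l) \<le> C"
  shows "square_integrable M (\<lambda>l. h l * f l)"
    and "L2_normsq M (\<lambda>l. h l * f l) \<le> C\<^sup>2 * L2_normsq M f"
proof -
  note [measurable] = square_integrableD(1)[OF f] h
  have i: "integrable M (\<lambda>l. C\<^sup>2 * (cmod (f l))\<^sup>2)" using square_integrableD(2)[OF f] by auto
  have le: "AE l in M. (cmod (h l * f l))\<^sup>2 \<le> C\<^sup>2 * (cmod (f l))\<^sup>2"
    using C
  proof eventually_elim
    case (elim l)
    have "(cmod (h l))\<^sup>2 \<le> C\<^sup>2" using elim by (intro power_mono) auto
    thus ?case by (simp add: norm_mult power_mult_distrib mult_right_mono)
  qed
  have j: "integrable M (\<lambda>l. (cmod (h l * f l))\<^sup>2)"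
    by (rule Bochner_Integration.integrable_bound[OF i]) (use le in \<open>auto\<close>)
  thus "square_integrable M (\<lambda>l. h l * f l)" by (simp add: square_integrable_def)
  have "L2_normsq M (\<lambda>l. h l * f l) \<le> (LINT l|M. C\<^sup>2 * (cmod (f l))\<^sup>2)"
    unfolding L2_normsq_def by (rule integral_mono_AE[OF j i le])
  thus "L2_normsq M (\<lambda>l. h l * f l) \<le> C\<^sup>2 * L2_normsq M f"
    unfolding L2_normsq_def by simp
qed

lemma square_integrable_diff:
  assumes f: "square_integrable M f" and g: "square_integrable M g"
  shows "square_integrable M (\<lambda>l. f l - g l)"
    and "L2_normsq M (\<lambda>l. f l - g l) \<le> 2 * L2_normsq M f + 2 * L2_normsq M g"
proof -
  have m: "square_integrable M (\<lambda>l. - g l)" "L2_normsq M (\<lambda>l. - g l) = L2_normsq M g"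
    using g by (auto simp: square_integrable_def L2_normsq_def)
  show "square_integrable M (\<lambda>l. f l - g l)"
    "L2_normsq M (\<lambda>l. f l - g l) \<le> 2 * L2_normsq M f + 2 * L2_normsq M g"
    using square_integrable_add[OF f m(1)] m(2) by auto
qed

text \<open>Expand \<open>0 \<le> \<integral>(|f| - c)\<^sup>2\<close>. The optimal \<open>c\<close> is the integral of \<open>|f|\<close> divided by the total
  mass; dividing by the total mass plus one instead includes the zero measure, at the cost of a slightly
  larger constant in the estimate.\<close>

lemma (in finite_measure) square_integrable_imp_integrable:
  assumes f: "square_integrable M f"
  shows "integrable M f"
    and "(LINT l|M. cmod (f l))\<^sup>2 \<le> (measure M (space M) + 1) * L2_normsq M f"
proof -
  note [measurable] = square_integrableD(1)[OF f]
  have "integrable M (\<lambda>l. 1 + (cmod (f l))\<^sup>2)" using square_integrableD(2)[OF f] by auto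
  thus i: "integrable M f"
  proof (rule Bochner_Integration.integrable_bound)
    have "cmod z \<le> 1 + (cmod z)\<^sup>2" for z
      using sum_squares_bound[of 1 "cmod z"] by (simp, smt (verit) norm_ge_zero)
    thus "AE l in M. cmod (f l) \<le> norm (1 + (cmod (f l))\<^sup>2)" by simp
  qed simp
  define n where "n = (LINT l|M. cmod (f l))"
  define \<mu> where "\<mu> = measure M (space M)"
  define c where "c = n / (\<mu> + 1)"
  have "\<mu> \<ge> 0" by (simp add: \<mu>_def)
  have "0 \<le> (LINT l|M. (cmod (f l) - c)\<^sup>2)" by (rule integral_nonneg_AE) simp
  also have "\<dots> = (LINT l|M. (cmod (f l))\<^sup>2 - 2 * c * cmod (f l) + c\<^sup>2)"
    by (simp add: power2_diff mult_ac diff_add_eq)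
  also have "\<dots> = L2_normsq M f - 2 * c * n + c\<^sup>2 * \<mu>"
    using square_integrableD(2)[OF f] i unfolding n_def \<mu>_def L2_normsq_def by simp
  finally have "2 * c * n \<le> L2_normsq M f + c\<^sup>2 * \<mu>" by simp
  moreover have "c\<^sup>2 * \<mu> \<le> c\<^sup>2 * (\<mu> + 1)" by (intro mult_left_mono) auto
  moreover have "c\<^sup>2 * (\<mu> + 1) = c * n" using \<open>\<mu> \<ge> 0\<close> by (simp add: c_def power2_eq_square)
  ultimately have "c * n \<le> L2_normsq M f" by linarith
  hence "n\<^sup>2 / (\<mu> + 1) \<le> L2_normsq M f" by (simp add: c_def power2_eq_square)
  thus "n\<^sup>2 \<le> (\<mu> + 1) * L2_normsq M f" using \<open>\<mu> \<ge> 0\<close> by (simp add: divide_le_eq mult.commute)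
qed

text \<open>On a finite measure space the sequence is also Cauchy in the mean, so a subsequence converges
  almost everywhere; by Fatou's lemma its limit is the limit in the mean square.\<close>

lemma (in finite_measure) L2_complete:
  fixes g :: "nat \<Rightarrow> 'a \<Rightarrow> complex"
  assumes g: "\<And>n. square_integrable M (g n)"
    and cauchy: "\<And>e. e > 0 \<Longrightarrow> \<exists>N. \<forall>i\<ge>N. \<forall>j\<ge>N. L2_normsq M (\<lambda>l. g i l - g j l) < e"
  shows "\<exists>S. square_integrable M S \<and> (\<lambda>n. L2_normsq M (\<lambda>l. g n l - S l)) \<longlonglongrightarrow> 0"
proof -
  note [measurable] = square_integrableD(1)[OF g]
  let ?\<mu> = "measure M (space M) + 1"
  have \<mu>: "?\<mu> > 0" by (simp add: add_nonneg_pos)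
  have "\<exists>N. \<forall>i\<ge>N. \<forall>j\<ge>N. (LINT l|M. norm (g i l - g j l)) < e" if e: "e > 0" for e :: real
  proof -
    obtain N where N: "\<forall>i\<ge>N. \<forall>j\<ge>N. L2_normsq M (\<lambda>l. g i l - g j l) < e\<^sup>2 / ?\<mu>"
      using cauchy[of "e\<^sup>2 / ?\<mu>"] \<mu> e by auto
    have "(LINT l|M. norm (g i l - g j l)) < e" if ij: "i \<ge> N" "j \<ge> N" for i j
    proof (rule power2_less_imp_less)
      have "(LINT l|M. norm (g i l - g j l))\<^sup>2 \<le> ?\<mu> * L2_normsq M (\<lambda>l. g i l - g j l)"
        by (rule square_integrable_imp_integrable(2)[OF square_integrable_diff(1)[OF g g]])
      also have "\<dots> < ?\<mu> * (e\<^sup>2 / ?\<mu>)" using N ij \<mu> by (intro mult_strict_left_mono) auto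
      also have "\<dots> = e\<^sup>2" using \<mu> by simp
      finally show "(LINT l|M. norm (g i l - g j l))\<^sup>2 < e\<^sup>2" .
    qed (use e in auto)
    thus ?thesis by blast
  qed
  then obtain r where r: "strict_mono r" and ae: "AE l in M. Cauchy (\<lambda>i. g (r i) l)"
    using cauchy_L1_AE_cauchy_subseq[of M g] square_integrable_imp_integrable(1)[OF g] by blast
  define S where "S l = lim (\<lambda>i. g (r i) l)" for l
  have [measurable]: "S \<in> borel_measurable M" unfolding S_def[abs_def] by measurable
  have lim: "AE l in M. (\<lambda>i. g (r i) l) \<longlonglongrightarrow> S l"
    using ae by eventually_elim (simp add: S_def Cauchy_convergent convergent_LIMSEQ_iff[symmetric])
  \<comment> \<open>used with \<open>e = 1\<close> to see that \<open>S\<close> is square integrable, and with small \<open>e\<close> for the convergence\<close>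
  have fatou: "square_integrable M (\<lambda>l. g n l - S l) \<and> L2_normsq M (\<lambda>l. g n l - S l) \<le> e"
    if N: "\<And>i. i \<ge> N \<Longrightarrow> L2_normsq M (\<lambda>l. g n l - g i l) \<le> e" for n N e
  proof -
    have "e \<ge> 0" using N[of N] L2_normsq_nonneg[of M "\<lambda>l. g n l - g N l"] by linarith
    have "(\<integral>\<^sup>+l. ennreal ((cmod (g n l - S l))\<^sup>2) \<partial>M)
        = (\<integral>\<^sup>+l. liminf (\<lambda>i. ennreal ((cmod (g n l - g (r i) l))\<^sup>2)) \<partial>M)"
    proof (rule nn_integral_cong_AE, use lim in eventually_elim)
      case (elim l)
      have "(\<lambda>i. ennreal ((cmod (g n l - g (r i) l))\<^sup>2)) \<longlonglongrightarrow> ennreal ((cmod (g n l - S l))\<^sup>2)"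
        by (intro tendsto_ennrealI tendsto_intros elim)
      thus ?case by (rule lim_imp_Liminf[OF sequentially_bot, symmetric])
    qed
    also have "\<dots> \<le> liminf (\<lambda>i. \<integral>\<^sup>+l. ennreal ((cmod (g n l - g (r i) l))\<^sup>2) \<partial>M)"
      by (rule nn_integral_liminf) measurable
    also have "\<dots> \<le> limsup (\<lambda>i. \<integral>\<^sup>+l. ennreal ((cmod (g n l - g (r i) l))\<^sup>2) \<partial>M)"
      by (rule Liminf_le_Limsup) simp
    also have "\<dots> \<le> ennreal e"
    proof (rule Limsup_bounded, rule eventually_sequentiallyI)
      fix i assume "i \<ge> N"
      hence "r i \<ge> N" using seq_suble[OF r, of i] by linarith
      have "(\<integral>\<^sup>+l. ennreal ((cmod (g n l - g (r i) l))\<^sup>2) \<partial>M) = ennreal (L2_normsq M (\<lambda>l. g n l - g (r i) l))"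
        unfolding L2_normsq_def
        using square_integrableD(2)[OF square_integrable_diff(1)[OF g g]] by (intro nn_integral_eq_integral) auto
      thus "(\<integral>\<^sup>+l. ennreal ((cmod (g n l - g (r i) l))\<^sup>2) \<partial>M) \<le> ennreal e"
        using N[OF \<open>r i \<ge> N\<close>] by (simp add: ennreal_leI)
    qed
    finally have *: "(\<integral>\<^sup>+l. ennreal ((cmod (g n l - S l))\<^sup>2) \<partial>M) \<le> ennreal e" .
    hence i: "integrable M (\<lambda>l. (cmod (g n l - S l))\<^sup>2)"
      by (intro integrableI_nonneg) (auto intro: le_less_trans)
    hence "ennreal (L2_normsq M (\<lambda>l. g n l - S l)) \<le> ennreal e"
      unfolding L2_normsq_def using * by (subst nn_integral_eq_integral[symmetric]) auto
    with i \<open>e \<ge> 0\<close> show ?thesis by (auto simp: square_integrable_def)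
  qed
  obtain N0 where "\<forall>i\<ge>N0. \<forall>j\<ge>N0. L2_normsq M (\<lambda>l. g i l - g j l) < 1" using cauchy[of 1] by auto
  hence "square_integrable M (\<lambda>l. g N0 l - S l)" using fatou[of N0 N0 1] by (simp add: less_imp_le)
  from square_integrable_diff(1)[OF g this, of N0] have S: "square_integrable M S" by simp
  have "(\<lambda>n. L2_normsq M (\<lambda>l. g n l - S l)) \<longlonglongrightarrow> 0"
  proof (rule LIMSEQ_I)
    fix e :: real assume e: "e > 0"
    then obtain N where N: "\<forall>i\<ge>N. \<forall>j\<ge>N. L2_normsq M (\<lambda>l. g i l - g j l) < e / 2"
      using cauchy[of "e / 2"] by auto
    have "L2_normsq M (\<lambda>l. g n l - S l) \<le> e / 2" if "n \<ge> N" for n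
      using fatou[of N n "e / 2"] N that by (simp add: less_imp_le)
    thus "\<exists>no. \<forall>n\<ge>no. norm (L2_normsq M (\<lambda>l. g n l - S l) - 0) < e"
      using e L2_normsq_nonneg[of M] by (intro exI[of _ N]) (auto intro: le_less_trans[of _ "e / 2"])
  qed
  with S show ?thesis by blast
qed

lemma L2_has_sum_iff:
  "L2_has_sum M f S A \<longleftrightarrow> (\<forall>y\<in>A. square_integrable M (f y)) \<and> square_integrable M S \<and>
    ((\<lambda>B. L2_normsq M (\<lambda>l. (\<Sum>y\<in>B. f y l) - S l)) \<longlongrightarrow> 0) (finite_subsets_at_top A)"
  unfolding L2_has_sum_def L2_normsq_def ..

lemma square_integrable_sum:
  "finite B \<Longrightarrow> (\<And>y. y \<in> B \<Longrightarrow> square_integrable M (f y)) \<Longrightarrow> square_integrable M (\<lambda>l. \<Sum>y\<in>B. f y l)"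
proof (induction B rule: finite_induct)
  case empty
  show ?case by (simp add: square_integrable_def)
next
  case (insert y B)
  have "square_integrable M (f y)" "square_integrable M (\<lambda>l. \<Sum>y\<in>B. f y l)" using insert by auto
  from square_integrable_add(1)[OF this] show ?case using insert.hyps by simp
qed

text \<open>The bound makes the net of finite partial sums Cauchy. The sets \<open>X n\<close> beyond which the tail of \<open>b\<close>
  is below \<open>1 / (n + 1)\<close> give a Cauchy sequence, and the whole net converges to its limit.\<close>

lemma (in finite_measure) L2_has_sum_exists:
  fixes f :: "'i \<Rightarrow> 'a \<Rightarrow> complex" and b :: "'i \<Rightarrow> real"
  assumes f: "\<And>y. y \<in> A \<Longrightarrow> square_integrable M (f y)"
    and b: "b summable_on A" "\<And>y. y \<in> A \<Longrightarrow> b y \<ge> 0"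
    and bound: "\<And>B. finite B \<Longrightarrow> B \<subseteq> A \<Longrightarrow> L2_normsq M (\<lambda>l. \<Sum>y\<in>B. f y l) \<le> (\<Sum>y\<in>B. b y)"
  shows "\<exists>S. L2_has_sum M f S A"
proof -
  have fB: "square_integrable M (\<lambda>l. \<Sum>y\<in>B. f y l)" if "finite B" "B \<subseteq> A" for B
    using that f by (intro square_integrable_sum) auto
  have tail: "\<exists>X. finite X \<and> X \<subseteq> A \<and> (\<forall>C. finite C \<longrightarrow> C \<subseteq> A \<longrightarrow> C \<inter> X = {} \<longrightarrow> sum b C \<le> e)" if "e > 0" for e
  proof -
    have "((\<lambda>B. sum b B) \<longlongrightarrow> infsum b A) (finite_subsets_at_top A)" using b(1) by (rule tendsto_infsum)
    hence "\<forall>\<^sub>F B in finite_subsets_at_top A. dist (sum b B) (infsum b A) < e" using \<open>e > 0\<close> by (rule tendstoD)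
    then obtain X where X: "finite X" "X \<subseteq> A" "dist (sum b X) (infsum b A) < e"
      unfolding eventually_finite_subsets_at_top by auto
    have "sum b C \<le> e" if C: "finite C" "C \<subseteq> A" "C \<inter> X = {}" for C
    proof -
      have "sum b C + sum b X = sum b (C \<union> X)" using C X by (simp add: sum.union_disjoint)
      also have "\<dots> \<le> infsum b A" using C X b by (intro finite_sum_le_infsum) auto
      finally show ?thesis using X(3) by (simp add: dist_real_def)
    qed
    with X show ?thesis by blast
  qed
  have "\<forall>n. \<exists>X. finite X \<and> X \<subseteq> A \<and> (\<forall>C. finite C \<longrightarrow> C \<subseteq> A \<longrightarrow> C \<inter> X = {} \<longrightarrow> sum b C \<le> 1 / real (Suc n))"
    using tail by simp
  then obtain X where X: "\<And>n. finite (X n)" "\<And>n. X n \<subseteq> A"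
    "\<And>n C. finite C \<Longrightarrow> C \<subseteq> A \<Longrightarrow> C \<inter> X n = {} \<Longrightarrow> sum b C \<le> 1 / real (Suc n)"
    by metis
  \<comment> \<open>common terms cancel, so only the symmetric difference of the index sets matters\<close>
  have diff: "L2_normsq M (\<lambda>l. (\<Sum>y\<in>B. f y l) - (\<Sum>y\<in>C. f y l)) \<le> 2 * sum b (B - C) + 2 * sum b (C - B)"
    if B: "finite B" "B \<subseteq> A" and C: "finite C" "C \<subseteq> A" for B C
  proof -
    have "(\<Sum>y\<in>B. f y l) - (\<Sum>y\<in>C. f y l) = (\<Sum>y\<in>B - C. f y l) - (\<Sum>y\<in>C - B. f y l)" for l
      using sum.Int_Diff[OF B(1), of "\<lambda>y. f y l" C] sum.Int_Diff[OF C(1), of "\<lambda>y. f y l" B]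
      by (simp add: Int_commute)
    hence "L2_normsq M (\<lambda>l. (\<Sum>y\<in>B. f y l) - (\<Sum>y\<in>C. f y l))
        = L2_normsq M (\<lambda>l. (\<Sum>y\<in>B - C. f y l) - (\<Sum>y\<in>C - B. f y l))" by simp
    also have "\<dots> \<le> 2 * L2_normsq M (\<lambda>l. \<Sum>y\<in>B - C. f y l) + 2 * L2_normsq M (\<lambda>l. \<Sum>y\<in>C - B. f y l)"
      using B C by (intro square_integrable_diff(2) fB) auto
    also have "\<dots> \<le> 2 * sum b (B - C) + 2 * sum b (C - B)"
      using B C by (intro add_mono mult_left_mono bound) auto
    finally show ?thesis .
  qed
  define g where "g n l = (\<Sum>y\<in>X n. f y l)" for n l
  have g: "square_integrable M (g n)" for n unfolding g_def[abs_def] by (intro fB X)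
  have "\<exists>N. \<forall>i\<ge>N. \<forall>j\<ge>N. L2_normsq M (\<lambda>l. g i l - g j l) < e" if e: "e > 0" for e
  proof -
    obtain N where N: "4 / real (Suc N) < e"
    proof -
      obtain N where "1 / real (Suc N) < e / 4" using nat_approx_posE[of "e / 4"] e by auto
      with that[of N] show thesis by simp
    qed
    have "L2_normsq M (\<lambda>l. g i l - g j l) < e" if ij: "i \<ge> N" "j \<ge> N" for i j
    proof -
      have "L2_normsq M (\<lambda>l. g i l - g j l) \<le> 2 * sum b (X i - X j) + 2 * sum b (X j - X i)"
        unfolding g_def by (rule diff) (use X in auto)
      also have "\<dots> \<le> 2 * (1 / real (Suc j)) + 2 * (1 / real (Suc i))"
        by (intro add_mono mult_left_mono X(3)) (use X in auto)
      also have "\<dots> \<le> 2 * (1 / real (Suc N)) + 2 * (1 / real (Suc N))"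
        using ij by (intro add_mono mult_left_mono divide_left_mono) auto
      also have "\<dots> < e" using N by simp
      finally show ?thesis .
    qed
    thus ?thesis by blast
  qed
  from L2_complete[OF g this] obtain S where S: "square_integrable M S"
    "(\<lambda>n. L2_normsq M (\<lambda>l. g n l - S l)) \<longlonglongrightarrow> 0" by blast
  have "((\<lambda>B. L2_normsq M (\<lambda>l. (\<Sum>y\<in>B. f y l) - S l)) \<longlongrightarrow> 0) (finite_subsets_at_top A)"
  proof (rule tendstoI)
    fix e :: real assume e: "e > 0"
    have "(\<lambda>n. 4 * (1 / real (Suc n)) + 2 * L2_normsq M (\<lambda>l. g n l - S l)) \<longlonglongrightarrow> 4 * 0 + 2 * 0"
      by (intro tendsto_intros S(2) LIMSEQ_Suc[OF lim_1_over_n])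
    hence "\<forall>\<^sub>F n in sequentially. 4 * (1 / real (Suc n)) + 2 * L2_normsq M (\<lambda>l. g n l - S l) < e"
      using e by (intro order_tendstoD(2)) auto
    then obtain n where n: "4 * (1 / real (Suc n)) + 2 * L2_normsq M (\<lambda>l. g n l - S l) < e"
      by (auto simp: eventually_sequentially)
    have "L2_normsq M (\<lambda>l. (\<Sum>y\<in>B. f y l) - S l) < e" if B: "finite B" "X n \<subseteq> B" "B \<subseteq> A" for B
    proof -
      have "L2_normsq M (\<lambda>l. (\<Sum>y\<in>B. f y l) - S l) = L2_normsq M (\<lambda>l. ((\<Sum>y\<in>B. f y l) - g n l) + (g n l - S l))"
        by simp
      also have "\<dots> \<le> 2 * L2_normsq M (\<lambda>l. (\<Sum>y\<in>B. f y l) - g n l) + 2 * L2_normsq M (\<lambda>l. g n l - S l)"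
        by (intro square_integrable_add(2) square_integrable_diff(1) fB B g S)
      also have "L2_normsq M (\<lambda>l. (\<Sum>y\<in>B. f y l) - g n l) \<le> 2 * sum b (B - X n) + 2 * sum b (X n - B)"
        unfolding g_def by (rule diff) (use X B in auto)
      also have "\<dots> \<le> 2 * (1 / real (Suc n)) + 2 * 0"
      proof -
        have "sum b (X n - B) = 0" using B by (simp add: Diff_eq_empty_iff[THEN iffD2])
        moreover have "sum b (B - X n) \<le> 1 / real (Suc n)" by (rule X(3)) (use B in auto)
        ultimately show ?thesis by simp
      qed
      finally show ?thesis using n by simp
    qed
    thus "\<forall>\<^sub>F B in finite_subsets_at_top A. dist (L2_normsq M (\<lambda>l. (\<Sum>y\<in>B. f y l) - S l)) 0 < e"
      unfolding eventually_finite_subsets_at_top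
      by (intro exI[of _ "X n"]) (use X in \<open>auto simp: dist_real_def abs_of_nonneg L2_normsq_nonneg\<close>)
  qed
  with S(1) f show ?thesis unfolding L2_has_sum_iff by blast
qed

lemma L2_has_sum_add:
  assumes f: "L2_has_sum M f S A" and g: "L2_has_sum M g T A"
  shows "L2_has_sum M (\<lambda>y l. f y l + g y l) (\<lambda>l. S l + T l) A"
  unfolding L2_has_sum_iff
proof (intro conjI ballI)
  note f' = f[unfolded L2_has_sum_iff] and g' = g[unfolded L2_has_sum_iff]
  show "square_integrable M (\<lambda>l. f y l + g y l)" if "y \<in> A" for y
    using f' g' that by (intro square_integrable_add(1)) auto
  show "square_integrable M (\<lambda>l. S l + T l)" using f' g' by (intro square_integrable_add(1)) auto
  have "((\<lambda>B. 2 * L2_normsq M (\<lambda>l. (\<Sum>y\<in>B. f y l) - S l) + 2 * L2_normsq M (\<lambda>l. (\<Sum>y\<in>B. g y l) - T l))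
      \<longlongrightarrow> 2 * 0 + 2 * 0) (finite_subsets_at_top A)"
    using f' g' by (intro tendsto_intros) auto
  hence lim: "((\<lambda>B. 2 * L2_normsq M (\<lambda>l. (\<Sum>y\<in>B. f y l) - S l) + 2 * L2_normsq M (\<lambda>l. (\<Sum>y\<in>B. g y l) - T l))
      \<longlongrightarrow> 0) (finite_subsets_at_top A)" by simp
  show "((\<lambda>B. L2_normsq M (\<lambda>l. (\<Sum>y\<in>B. f y l + g y l) - (S l + T l))) \<longlongrightarrow> 0) (finite_subsets_at_top A)"
  proof (rule Lim_null_comparison[OF _ lim], rule eventually_finite_subsets_at_top_weakI)
    fix B assume B: "finite B" "B \<subseteq> A"
    have e: "(\<Sum>y\<in>B. f y l + g y l) - (S l + T l) = ((\<Sum>y\<in>B. f y l) - S l) + ((\<Sum>y\<in>B. g y l) - T l)" for l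
      by (simp add: sum.distrib)
    have "L2_normsq M (\<lambda>l. ((\<Sum>y\<in>B. f y l) - S l) + ((\<Sum>y\<in>B. g y l) - T l))
      \<le> 2 * L2_normsq M (\<lambda>l. (\<Sum>y\<in>B. f y l) - S l) + 2 * L2_normsq M (\<lambda>l. (\<Sum>y\<in>B. g y l) - T l)"
      using B f' g' by (intro square_integrable_add(2) square_integrable_diff(1) square_integrable_sum) auto
    thus "norm (L2_normsq M (\<lambda>l. (\<Sum>y\<in>B. f y l + g y l) - (S l + T l)))
      \<le> 2 * L2_normsq M (\<lambda>l. (\<Sum>y\<in>B. f y l) - S l) + 2 * L2_normsq M (\<lambda>l. (\<Sum>y\<in>B. g y l) - T l)"
      unfolding e by (simp only: real_norm_def abs_of_nonneg L2_normsq_nonneg)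
  qed
qed

lemma L2_has_sum_mult_bounded:
  assumes f: "L2_has_sum M f S A" and h: "h \<in> borel_measurable M" and C: "AE l in M. cmod (h l) \<le> C"
  shows "L2_has_sum M (\<lambda>y l. h l * f y l) (\<lambda>l. h l * S l) A"
  unfolding L2_has_sum_iff
proof (intro conjI ballI)
  note f' = f[unfolded L2_has_sum_iff]
  show "square_integrable M (\<lambda>l. h l * f y l)" if "y \<in> A" for y
    using f' that by (intro square_integrable_mult_bounded(1)[OF _ h C]) auto
  show "square_integrable M (\<lambda>l. h l * S l)" using f' by (intro square_integrable_mult_bounded(1)[OF _ h C]) auto
  have lim: "((\<lambda>B. C\<^sup>2 * L2_normsq M (\<lambda>l. (\<Sum>y\<in>B. f y l) - S l)) \<longlongrightarrow> 0) (finite_subsets_at_top A)"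
    using f' by (intro tendsto_mult_right_zero) auto
  show "((\<lambda>B. L2_normsq M (\<lambda>l. (\<Sum>y\<in>B. h l * f y l) - h l * S l)) \<longlongrightarrow> 0) (finite_subsets_at_top A)"
  proof (rule Lim_null_comparison[OF _ lim], rule eventually_finite_subsets_at_top_weakI)
    fix B assume B: "finite B" "B \<subseteq> A"
    have "(\<Sum>y\<in>B. h l * f y l) - h l * S l = h l * ((\<Sum>y\<in>B. f y l) - S l)" for l
      by (simp add: sum_distrib_left right_diff_distrib)
    moreover have "L2_normsq M (\<lambda>l. h l * ((\<Sum>y\<in>B. f y l) - S l)) \<le> C\<^sup>2 * L2_normsq M (\<lambda>l. (\<Sum>y\<in>B. f y l) - S l)"
      using B f' by (intro square_integrable_mult_bounded(2)[OF _ h C] square_integrable_diff(1) square_integrable_sum) auto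
    ultimately show "norm (L2_normsq M (\<lambda>l. (\<Sum>y\<in>B. h l * f y l) - h l * S l))
        \<le> C\<^sup>2 * L2_normsq M (\<lambda>l. (\<Sum>y\<in>B. f y l) - S l)"
      by (simp add: L2_normsq_nonneg)
  qed
qed

lemma L2_has_sum_finite_sum:
  assumes "finite I" "\<And>i. i \<in> I \<Longrightarrow> L2_has_sum M (f i) (S i) A"
  shows "L2_has_sum M (\<lambda>y l. \<Sum>i\<in>I. f i y l) (\<lambda>l. \<Sum>i\<in>I. S i l) A"
  using assms
proof (induction I rule: finite_induct)
  case empty
  show ?case by (simp add: L2_has_sum_iff square_integrable_def L2_normsq_def)
next
  case (insert i I)
  have "L2_has_sum M (f i) (S i) A" "L2_has_sum M (\<lambda>y l. \<Sum>i\<in>I. f i y l) (\<lambda>l. \<Sum>i\<in>I. S i l) A"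
    using insert by auto
  from L2_has_sum_add[OF this] show ?case using insert.hyps by simp
qed

text \<open>All finite partial sums vanish almost everywhere, so the distance of \<open>S\<close> from them does not
  depend on the partial sum.\<close>

lemma L2_has_sum_zero:
  assumes f: "L2_has_sum M f S A" and z: "\<And>y. y \<in> A \<Longrightarrow> AE l in M. f y l = 0"
  shows "AE l in M. S l = 0"
proof -
  note f' = f[unfolded L2_has_sum_iff]
  have "L2_normsq M (\<lambda>l. (\<Sum>y\<in>B. f y l) - S l) = L2_normsq M S" if B: "finite B" "B \<subseteq> A" for B
    unfolding L2_normsq_def
  proof (rule integral_cong_AE)
    have "square_integrable M (\<lambda>l. (\<Sum>y\<in>B. f y l) - S l)" "square_integrable M S"
      using B f' by (auto intro!: square_integrable_diff(1) square_integrable_sum)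
    note [measurable] = this[THEN square_integrableD(1)]
    show "(\<lambda>l. (cmod ((\<Sum>y\<in>B. f y l) - S l))\<^sup>2) \<in> borel_measurable M" "(\<lambda>l. (cmod (S l))\<^sup>2) \<in> borel_measurable M"
      by measurable
    have "AE l in M. \<forall>y\<in>B. f y l = 0" using B z by (intro AE_finite_allI) auto
    thus "AE l in M. (cmod ((\<Sum>y\<in>B. f y l) - S l))\<^sup>2 = (cmod (S l))\<^sup>2" by eventually_elim simp
  qed
  hence ev: "\<forall>\<^sub>F B in finite_subsets_at_top A. L2_normsq M (\<lambda>l. (\<Sum>y\<in>B. f y l) - S l) = L2_normsq M S"
    by (intro eventually_finite_subsets_at_top_weakI)
  have "((\<lambda>B. L2_normsq M (\<lambda>l. (\<Sum>y\<in>B. f y l) - S l)) \<longlongrightarrow> 0) (finite_subsets_at_top A)" using f' by blast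
  from Lim_transform_eventually[OF this ev] have "L2_normsq M S = 0" by (simp add: tendsto_const_iff)
  moreover have "integrable M (\<lambda>l. (cmod (S l))\<^sup>2)" using f' square_integrableD(2) by blast
  ultimately have "AE l in M. (cmod (S l))\<^sup>2 = 0"
    unfolding L2_normsq_def by (subst (asm) integral_nonneg_eq_0_iff_AE) auto
  thus ?thesis by eventually_elim simp
qed

text \<open>On a finite measure space, integration is continuous in the mean square.\<close>

lemma (in finite_measure) L2_has_sum_integral:
  assumes f: "L2_has_sum M f S A"
  shows "((\<lambda>y. LINT l|M. f y l) has_sum (LINT l|M. S l)) A"
proof -
  note f' = f[unfolded L2_has_sum_iff]
  let ?\<mu> = "measure M (space M) + 1"
  have "((\<lambda>B. ?\<mu> * L2_normsq M (\<lambda>l. (\<Sum>y\<in>B. f y l) - S l)) \<longlongrightarrow> 0) (finite_subsets_at_top A)"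
    using f' by (intro tendsto_mult_right_zero) auto
  hence "((\<lambda>B. (cmod ((\<Sum>y\<in>B. LINT l|M. f y l) - (LINT l|M. S l)))\<^sup>2) \<longlongrightarrow> 0) (finite_subsets_at_top A)"
  proof (rule Lim_null_comparison[rotated], intro eventually_finite_subsets_at_top_weakI)
    fix B assume B: "finite B" "B \<subseteq> A"
    have sq: "square_integrable M (\<lambda>l. (\<Sum>y\<in>B. f y l) - S l)"
      using B f' by (auto intro!: square_integrable_diff(1) square_integrable_sum)
    have i: "integrable M S" "\<And>y. y \<in> B \<Longrightarrow> integrable M (f y)"
      using f' B square_integrable_imp_integrable(1) by blast+
    have "(\<Sum>y\<in>B. LINT l|M. f y l) - (LINT l|M. S l) = (LINT l|M. (\<Sum>y\<in>B. f y l) - S l)"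
      using i by simp
    also have "cmod \<dots> \<le> (LINT l|M. cmod ((\<Sum>y\<in>B. f y l) - S l))" by (rule integral_norm_bound)
    finally have "(cmod ((\<Sum>y\<in>B. LINT l|M. f y l) - (LINT l|M. S l)))\<^sup>2 \<le> (LINT l|M. cmod ((\<Sum>y\<in>B. f y l) - S l))\<^sup>2"
      by (intro power_mono) auto
    also have "\<dots> \<le> ?\<mu> * L2_normsq M (\<lambda>l. (\<Sum>y\<in>B. f y l) - S l)"
      by (rule square_integrable_imp_integrable(2)[OF sq])
    finally show "norm ((cmod ((\<Sum>y\<in>B. LINT l|M. f y l) - (LINT l|M. S l)))\<^sup>2) \<le> \<dots>" by simp
  qed
  hence "((\<lambda>B. (\<Sum>y\<in>B. LINT l|M. f y l) - (LINT l|M. S l)) \<longlongrightarrow> 0) (finite_subsets_at_top A)"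
    by (simp add: tendsto_norm_zero_iff)
  thus ?thesis unfolding has_sum_def by (rule LIM_zero_cancel)
qed

section \<open>The spectral resolution\<close>

context cubic_tree
begin

lemma is_spectral_projection_iff:
  "is_spectral_projection E F P \<longleftrightarrow>
    (\<forall>x\<in>E. L2_has_sum spec_measure (\<lambda>y l. spectral_kernel (d x y) l * F y) (\<lambda>l. P l x) E)"
  unfolding is_spectral_projection_def spectral_kernel_def by (simp add: mult.assoc)

lemma card_sphere_in_le:
  assumes x: "x \<in> E" and B: "finite B" "B \<subseteq> E"
  shows "real (card {y \<in> B. d x y = n}) \<le> sphere_size n"
proof -
  have "card {y \<in> B. d x y = n} \<le> card (sphere_about x n)"
    using B finite_sphere_about[OF x] by (intro card_mono) (auto simp: sphere_about_def)
  thus ?thesis using card_sphere_about[OF x, of n] by linarith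
qed

lemma spectral_projection_exists:
  assumes F: "F \<in> ell2 E"
  shows "\<exists>P. is_spectral_projection E F P"
proof -
  interpret finite_measure spec_measure by (rule finite_spec_measure)
  have "\<exists>S. L2_has_sum spec_measure (\<lambda>y l. spectral_kernel (d x y) l * F y) S E" if x: "x \<in> E" for x
  proof (rule L2_has_sum_exists)
    show "square_integrable spec_measure (\<lambda>l. spectral_kernel (d x y) l * F y)" if "y \<in> E" for y
      using bessel_kernel(1)[of "{y}" "d x" F] card_sphere_in_le[OF x, of "{y}"] that by simp
    show "(\<lambda>y. (cmod (F y))\<^sup>2) summable_on E" using F by (simp add: ell2_def)
    show "L2_normsq spec_measure (\<lambda>l. \<Sum>y\<in>B. spectral_kernel (d x y) l * F y) \<le> (\<Sum>y\<in>B. (cmod (F y))\<^sup>2)"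
      if "finite B" "B \<subseteq> E" for B
      unfolding L2_normsq_def by (rule bessel_kernel(2)[OF that(1) card_sphere_in_le[OF x that]])
  qed simp
  then obtain S where "\<And>x. x \<in> E \<Longrightarrow> L2_has_sum spec_measure (\<lambda>y l. spectral_kernel (d x y) l * F y) (S x) E"
    by metis
  hence "is_spectral_projection E F (\<lambda>l x. S x l)" unfolding is_spectral_projection_iff by simp
  thus ?thesis by (rule exI[where x = "\<lambda>l x. S x l"])
qed

text \<open>Each summand of the series is an eigenfunction of \<open>x\<close>. At a fixed \<open>x\<close> the eigenvalue equation
  involves finitely many points and a bounded factor \<open>l - 4\<close>, so it carries over to the \<open>L\<^sup>2\<close> sum, for
  almost every \<open>l\<close>. The graph is countable, so almost every \<open>l\<close> serves all \<open>x\<close> at once.\<close>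

lemma spectral_projection_eigenfunction:
  assumes P: "is_spectral_projection E F P"
  shows "AE l in spec_measure. eigenfunction E l (P l)"
proof -
  have "AE l in spec_measure. (\<Sum>z\<in>nbrs x. P l z) + (of_real l - 4) * P l x = 0" if x: "x \<in> E" for x
  proof (rule L2_has_sum_zero)
    have "AE l in spec_measure. cmod (of_real l - 4) \<le> 4"
      using AE_spec_measure_\<Sigma>
    proof eventually_elim
      case (elim l)
      have "cmod (of_real l - 4) = \<bar>l - 4\<bar>" by (metis norm_of_real of_real_diff of_real_numeral)
      thus ?case using \<Sigma>_set_bounds[OF elim] by auto
    qed
    thus "L2_has_sum spec_measure
        (\<lambda>y l. (\<Sum>z\<in>nbrs x. spectral_kernel (d z y) l * F y) + (of_real l - 4) * (spectral_kernel (d x y) l * F y))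
        (\<lambda>l. (\<Sum>z\<in>nbrs x. P l z) + (of_real l - 4) * P l x) E"
      using P x nbrs_subset finite_nbrs[OF x] unfolding is_spectral_projection_iff
      by (intro L2_has_sum_add L2_has_sum_finite_sum L2_has_sum_mult_bounded[where C = 4]) auto
    show "AE l in spec_measure. (\<Sum>z\<in>nbrs x. spectral_kernel (d z y) l * F y)
        + (of_real l - 4) * (spectral_kernel (d x y) l * F y) = 0" if y: "y \<in> E" for y
      using AE_kernel
    proof eventually_elim
      case (elim l)
      have "(\<Sum>z\<in>nbrs x. complex_of_real (spherical l (d z y))) = (4 - of_real l) * of_real (spherical l (d x y))"
        using eigenfunction_radial[OF y, of l] x unfolding eigenfunction_iff by blast
      hence "2 / 9 * F y * ((\<Sum>z\<in>nbrs x. complex_of_real (spherical l (d z y))) + (of_real l - 4) * of_real (spherical l (d x y))) = 0"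
        by (simp add: algebra_simps)
      thus ?case unfolding elim[rule_format] distrib_left sum_distrib_left by (simp add: mult_ac)
    qed
  qed
  hence "AE l in spec_measure. \<forall>x\<in>E. (\<Sum>z\<in>nbrs x. P l z) + (of_real l - 4) * P l x = 0"
    using countable_E by (intro AE_ball_countable') auto
  thus ?thesis
  proof eventually_elim
    case (elim l)
    show ?case unfolding eigenfunction_iff
    proof
      fix x assume "x \<in> E"
      with elim have "(\<Sum>z\<in>nbrs x. P l z) + (of_real l - 4) * P l x = 0" by blast
      hence "(\<Sum>z\<in>nbrs x. P l z) = - ((of_real l - 4) * P l x)" by (rule eq_neg_iff_add_eq_0[THEN iffD2])
      thus "(\<Sum>z\<in>nbrs x. P l z) = (4 - of_real l) * P l x" by (simp add: left_diff_distrib)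
    qed
  qed
qed

text \<open>Integrate the series termwise and insert \<open>integral_kernel\<close>.\<close>

lemma spectral_projection_resolution:
  assumes F: "F \<in> ell2 E" and P: "is_spectral_projection E F P" and x: "x \<in> E"
  shows "integrable spec_measure (\<lambda>l. P l x)"
    and "F x = P6 E F x + (LINT l|spec_measure. P l x)"
proof -
  interpret finite_measure spec_measure by (rule finite_spec_measure)
  have L: "L2_has_sum spec_measure (\<lambda>y l. spectral_kernel (d x y) l * F y) (\<lambda>l. P l x) E"
    using P x unfolding is_spectral_projection_iff by blast
  thus "integrable spec_measure (\<lambda>l. P l x)"
    using square_integrable_imp_integrable(1) unfolding L2_has_sum_iff by blast
  have 1: "((\<lambda>y. LINT l|spec_measure. spectral_kernel (d x y) l * F y) has_sum (LINT l|spec_measure. P l x)) E"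
    by (rule L2_has_sum_integral[OF L])
  have int: "(LINT l|spec_measure. spectral_kernel (d x y) l * F y) = (if y = x then F x else 0) - K6 x y * F y"
    if "y \<in> E" for y
  proof -
    have "(LINT l|spec_measure. spectral_kernel (d x y) l * F y) = (LINT l|spec_measure. spectral_kernel (d x y) l) * F y"
      by simp
    also have "(LINT l|spec_measure. spectral_kernel (d x y) l) = (if y = x then 1 else 0) - K6 x y"
      unfolding integral_kernel K6_def using dist_eq_0_iff[OF x that] by simp
    finally show ?thesis by (simp add: left_diff_distrib)
  qed
  have "((\<lambda>y. if y = x then F x else 0) has_sum F x) E"
    using has_sum_finite_neutralI[of "{x}" E "\<lambda>y. if y = x then F x else 0"] x by simp
  moreover have "((\<lambda>y. K6 x y * F y) has_sum P6 E F x) E"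
    unfolding P6_eq using P6_summable[OF F x] by (rule has_sum_infsum)
  hence "((\<lambda>y. - 1 * (K6 x y * F y)) has_sum - 1 * P6 E F x) E" by (rule has_sum_cmult_right)
  ultimately have "((\<lambda>y. (if y = x then F x else 0) + - 1 * (K6 x y * F y)) has_sum (F x + - 1 * P6 E F x)) E"
    by (rule has_sum_add)
  hence "((\<lambda>y. (if y = x then F x else 0) - K6 x y * F y) has_sum (F x - P6 E F x)) E"
    by simp
  hence "((\<lambda>y. LINT l|spec_measure. spectral_kernel (d x y) l * F y) has_sum (F x - P6 E F x)) E"
    by (subst has_sum_cong[OF int])
  from has_sum_unique[OF 1 this] show "F x = P6 E F x + (LINT l|spec_measure. P l x)" by simp
qed

end

theorem theorem4p12:
  fixes V :: "'v set" and E :: "'v set set" and F :: "'v set \<Rightarrow> complex"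
  assumes "tree_graph V E" and "regular_graph 3 V E" and "F \<in> ell2 E"
  shows "is_orthogonal_projection E {G \<in> ell2 E. eigenfunction E 6 G} F (P6 E F) \<and>
    (\<exists>P. is_spectral_projection E F P) \<and>
    (\<forall>P. is_spectral_projection E F P \<longrightarrow>
       (AE l in spec_measure. eigenfunction E l (P l)) \<and>
       (\<forall>x\<in>E. integrable spec_measure (\<lambda>l. P l x) \<and>
               F x = P6 E F x + (LINT l|spec_measure. P l x)))"
proof -
  interpret cubic_tree V E using assms by unfold_locales
  show ?thesis
    using P6_orthogonal_projection[OF assms(3)] spectral_projection_exists[OF assms(3)]
      spectral_projection_eigenfunction spectral_projection_resolution[OF assms(3)]
    unfolding eigenspace6_def by blast
qed

end
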